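(* Let $X,Y$ be normed linear spaces, $(\bar x,\bar y)\in X\times Y$, and let $f:X\times Y\to\mathbb{R}\cup\{+\infty\}$ satisfy $f(\bar x,\bar y)=0$ and the conditions (P1), (P2) recalled in the context. Then: (i) $|\nabla f|_{\rho}(x,y)\le |\partial f|_{\rho^2}(x,y)+\rho$ for all $\rho>0$ and all $(x,y)\in X\times Y$ with $f(x,y)<\infty$; (ii) $\overline{|\nabla f|}{}^{>}(\bar x,\bar y)\le \overline{|\partial f|}{}^{>}(\bar x,\bar y)$; (iii) if $X$ and $Y$ are Asplund and $f_+$ is lower semicontinuous near $(\bar x,\bar y)$, then $\overline{|\nabla f|}{}^{>}(\bar x,\bar y)= \overline{|\partial f|}{}^{>}(\bar x,\bar y)$.
   Context: Metrics are those induced by the norms, $d(x,u)=\|x-u\|$. $\alpha_+:=\max\{\alpha,0\}$, $f_+(x,y):=(f(x,y))_+$. Conventions: $\inf\emptyset=+\infty$; $c/0=+\infty$ for $c>0$; the upper limit of nonnegative quotients at an isolated point is $0$. (P1) $f(x,y)>0$ whenever $y\ne\bar y$. (P2) $\liminf_{f(x,y)\downarrow 0}\frac{f(x,y)}{d(y,\bar y)}>0$ (lower limit over all $(x,y)$ with $f(x,y)>0$, as $f(x,y)\to0$). For $\rho>0$, $d_\rho((x,y),(u,v)):=\max\{d(x,u),\rho\,d(y,v)\}$. For $f(x,y)<\infty$, the $\rho$-slope is $$|\nabla f|_\rho(x,y):=\limsup_{u\to x,\ v\to y,\ (u,v)\ne(x,y)}\frac{[f(x,y)-f(u,v)]_+}{d_\rho((u,v),(x,y))},$$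 and the strict outer slope is $$\overline{|\nabla f|}{}^{>}(\bar x,\bar y):=\lim_{\rho\downarrow0}\ \inf_{d(x,\bar x)<\rho,\ 0<f(x,y)<\rho}|\nabla f|_\rho(x,y).$$ The Fréchet subdifferential of $f$ at a point $z=(x,y)$ with $f(z)<\infty$ is $$\partial f(z):=\Big\{z^*\in (X\times Y)^*=X^*\times Y^*\ \Big|\ \liminf_{w\to z,\,w\ne z}\frac{f(w)-f(z)-\langle z^*,w-z\rangle}{\|w-z\|}\ge0\Big\}.$$ The subdifferential $\rho$-slope and the strict outer subdifferential slope are $$|\partial f|_\rho(x,y):=\inf_{(x^*,y^* )\in\partial f(x,y),\ \|y^*\|<\rho}\|x^*\|,\qquad \overline{|\partial f|}{}^{>}(\bar x,\bar y):=\lim_{\rho\downarrow0}\ \inf_{d(x,\bar x)<\rho,\ 0<f(x,y)<\rho}|\partial f|_\rho(x,y).$$ *)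

theory Defs
  imports "HOL-Analysis.Analysis"
begin

definition pos_part :: "('a \<Rightarrow> ereal) \<Rightarrow> 'a \<Rightarrow> ereal" where
  "pos_part f z = max (f z) 0"

definition rho_dist :: "real \<Rightarrow> 'a::metric_space \<times> 'b::metric_space \<Rightarrow> 'a \<times> 'b \<Rightarrow> real" where
  "rho_dist \<rho> z w = max (dist (fst z) (fst w)) (\<rho> * dist (snd z) (snd w))"

definition P1 :: "('a \<times> 'b \<Rightarrow> ereal) \<Rightarrow> 'b \<Rightarrow> bool" where
  "P1 f yb \<longleftrightarrow> (\<forall>x y. y \<noteq> yb \<longrightarrow> 0 < f (x, y))"

text \<open>The filter below describes the pairs \<open>z\<close> with \<open>f z > 0\<close> and \<open>f z\<close> tending to \<open>0\<close>,
  without any restriction on the location of \<open>z\<close>. If it is trivial the lower limit is \<open>\<infinity>\<close>. In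
  type \<open>ereal\<close> we have \<open>c / 0 = \<infinity>\<close> for \<open>c > 0\<close>.\<close>

definition P2 :: "('a \<times> 'b::metric_space \<Rightarrow> ereal) \<Rightarrow> 'b \<Rightarrow> bool" where
  "P2 f yb \<longleftrightarrow>
     0 < Liminf (filtercomap f (at_right 0)) (\<lambda>z. f z / ereal (dist (snd z) yb))"

text \<open>The outer maximum matters only at an isolated point, where \<open>Limsup\<close> is \<open>-\<infinity>\<close> but the upper
  limit of nonnegative quotients is to be \<open>0\<close>. Both slopes below are meant for \<open>f z < \<infinity>\<close>.\<close>

definition rho_slope ::
  "real \<Rightarrow> ('a::metric_space \<times> 'b::metric_space \<Rightarrow> ereal) \<Rightarrow> 'a \<times> 'b \<Rightarrow> ereal" where
  "rho_slope \<rho> f z =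
     max 0 (Limsup (at z) (\<lambda>w. max (f z - f w) 0 / ereal (rho_dist \<rho> w z)))"

text \<open>The infimum below, for either slope, is nonincreasing in \<open>\<rho> > 0\<close>, so the limits exist in
  \<open>ereal\<close>. In \<open>ereal\<close> the infimum over the empty set is \<open>\<infinity>\<close>.\<close>

definition strict_outer_slope ::
  "('a::metric_space \<times> 'b::metric_space \<Rightarrow> ereal) \<Rightarrow> 'a \<times> 'b \<Rightarrow> ereal" where
  "strict_outer_slope f zb =
     Lim (at_right 0) (\<lambda>\<rho>. INF z\<in>{z. dist (fst z) (fst zb) < \<rho> \<and> 0 < f z \<and> f z < ereal \<rho>}.
       rho_slope \<rho> f z)"

text \<open>The dual of the product is represented by pairs of functionals. The norm on \<open>'a \<times> 'b\<close> is the
  Euclidean combination of the two norms; the set does not depend on which of the equivalent product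
  norms is used.\<close>

definition frechet_subdiff ::
  "('a::real_normed_vector \<times> 'b::real_normed_vector \<Rightarrow> ereal) \<Rightarrow> 'a \<times> 'b \<Rightarrow>
     (('a \<Rightarrow>\<^sub>L real) \<times> ('b \<Rightarrow>\<^sub>L real)) set" where
  "frechet_subdiff f z = {(xs, ys).
     0 \<le> Liminf (at z) (\<lambda>w. (f w - f z -
           ereal (blinfun_apply xs (fst (w - z)) + blinfun_apply ys (snd (w - z))))
         / ereal (norm (w - z)))}"

definition subdiff_rho_slope ::
  "real \<Rightarrow> ('a::real_normed_vector \<times> 'b::real_normed_vector \<Rightarrow> ereal) \<Rightarrow> 'a \<times> 'b \<Rightarrow> ereal" where
  "subdiff_rho_slope \<rho> f z =
     (INF (xs, ys)\<in>{(xs, ys). (xs, ys) \<in> frechet_subdiff f z \<and> norm ys < \<rho>}. ereal (norm xs))"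

definition strict_outer_subdiff_slope ::
  "('a::real_normed_vector \<times> 'b::real_normed_vector \<Rightarrow> ereal) \<Rightarrow> 'a \<times> 'b \<Rightarrow> ereal" where
  "strict_outer_subdiff_slope f zb =
     Lim (at_right 0) (\<lambda>\<rho>. INF z\<in>{z. dist (fst z) (fst zb) < \<rho> \<and> 0 < f z \<and> f z < ereal \<rho>}.
       subdiff_rho_slope \<rho> f z)"

definition lsc_at :: "('a::topological_space \<Rightarrow> ereal) \<Rightarrow> 'a \<Rightarrow> bool" where
  "lsc_at g z \<longleftrightarrow> g z \<le> Liminf (at z) g"

definition lsc_near :: "('a::topological_space \<Rightarrow> ereal) \<Rightarrow> 'a \<Rightarrow> bool" where
  "lsc_near g zb \<longleftrightarrow> (\<forall>\<^sub>F z in nhds zb. lsc_at g z)"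

text \<open>A Banach space in which every continuous convex function on an open convex set is Frechet
  differentiable on a dense subset of that set. The set of differentiability points of such a
  function is always a \<open>G\<close>-delta, so asking for a dense \<open>G\<close>-delta subset is the same. Completeness
  is included because the ambient spaces are only assumed to be normed.\<close>

definition asplund :: "'a::real_normed_vector itself \<Rightarrow> bool" where
  "asplund _ \<longleftrightarrow> complete (UNIV :: 'a set) \<and>
     (\<forall>(U :: 'a set) (g :: 'a \<Rightarrow> real).
        open U \<and> convex U \<and> convex_on U g \<and> continuous_on U g \<longrightarrow>
        U \<subseteq> closure {x \<in> U. g differentiable (at x)})"

end

theory Submission
  imports Defs
begin

text \<open>The first two claims are direct estimates: a Frechet subgradient \<open>(x*, y*)\<close> with
  \<open>|y*| < rho^2\<close> bounds the decrease of \<open>f\<close> along \<open>h\<close> by \<open>(|x*| + rho + o(1)) |h|\<close>, with \<open>|h|\<close> measured in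
  \<open>d_rho\<close>.

  For the reverse inequality, a small slope at \<open>z\<close> means that \<open>f + N (. - z)\<close> has a local minimum at \<open>z\<close>
  for a seminorm \<open>N (h, k) = gamma (|h| + rho |k|)\<close>, and one needs a subgradient of \<open>f\<close> close to \<open>z\<close>
  which is almost bounded by \<open>N\<close>. By a countable closure argument it is enough to find it on a suitable
  separable subspace. Separable subspaces of Asplund spaces have separable duals, and on them \<open>N\<close> is a
  uniform limit of convex functions that are Frechet smooth everywhere, namely the conjugates of small
  locally uniformly convex penalties on the weak*-compact set of functionals below \<open>N\<close>.
  Adding countably many such functions to \<open>f\<close> produces an exact minimum near \<open>z\<close>, and the derivative of
  their sum at the minimum point is the negative of the subgradient. Condition \<open>P2\<close> keeps the
  second coordinates of the points in question close to \<open>yb\<close>, where lower semicontinuity is known.\<close>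

section \<open>Sublinear functionals\<close>

text \<open>The definition of \<open>asplund\<close> provides only dense points of
  differentiability, not functions that are smooth everywhere, so no smooth perturbation is at hand
  on the whole space. This forces the detour through separable subspaces. A subspace
  \<open>M\<close> is never made into a type: functionals remain linear functions on the whole
  space, and closeness or smoothness is tested only at points of \<open>M\<close>.

  Ekeland's principle would add a nonsmooth multiple of the norm and leave a sum to be
  differentiated. Smooth perturbations yield a subgradient at once as a negative derivative, but
  only along \<open>M\<close>. To return to the whole space, the existence of a subgradient below
  \<open>N\<close> is rewritten, by the sandwich theorem, as a family of inequalities that involve
  finitely many points each. Their failure is stable under small changes of the centre and of the
  weights, so it can be detected with rational data and with points of a suitable countable
  set.\<close>

definition sublinear :: "('c::real_vector \<Rightarrow> real) \<Rightarrow> bool" where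
  "sublinear p \<longleftrightarrow> (\<forall>x y. p (x + y) \<le> p x + p y) \<and> (\<forall>t\<ge>0. \<forall>x. p (t *\<^sub>R x) = t * p x)"

text \<open>Continuity is not demanded: bounds at \<open>x\<close> and \<open>- x\<close> give it as
  soon as \<open>p\<close> is below a multiple of the norm. With plain functions as elements, the
  product topology plays the role of the weak* topology.\<close>

definition dual_below :: "('c::real_vector \<Rightarrow> real) \<Rightarrow> ('c \<Rightarrow> real) set" where
  "dual_below p = {k. linear k \<and> (\<forall>x. k x \<le> p x)}"

text \<open>The reverse scaling inequality is the assumed one for \<open>inverse t\<close>.\<close>

lemma sublinearI:
  fixes p :: "'c::real_vector \<Rightarrow> real"
  assumes add: "\<And>x y. p (x + y) \<le> p x + p y"
    and scale: "\<And>t x. t > 0 \<Longrightarrow> p (t *\<^sub>R x) \<le> t * p x"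
    and zero: "p 0 = 0"
  shows "sublinear p"
proof -
  have "p (t *\<^sub>R x) = t * p x" if "t \<ge> 0" for t x
  proof (cases "t = 0")
    case True
    then show ?thesis using zero by simp
  next
    case False
    with that have t: "t > 0" by simp
    have "p x \<le> inverse t * p (t *\<^sub>R x)"
      using scale[of "inverse t" "t *\<^sub>R x"] t by simp
    then have "t * p x \<le> p (t *\<^sub>R x)"
      using t by (simp add: field_simps)
    with scale[OF t, of x] show ?thesis by simp
  qed
  with add show ?thesis unfolding sublinear_def by blast
qed

lemma sublinear_add: "sublinear p \<Longrightarrow> p (x + y) \<le> p x + p y"
  and sublinear_scale: "sublinear p \<Longrightarrow> t \<ge> 0 \<Longrightarrow> p (t *\<^sub>R x) = t * p x"
  unfolding sublinear_def by auto

lemma sublinear_zero: "sublinear p \<Longrightarrow> p 0 = 0"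
  using sublinear_scale[of p 0 0] by simp

lemma sublinear_minus: "sublinear p \<Longrightarrow> - p (- x) \<le> p x"
  using sublinear_add[of p x "- x"] sublinear_zero[of p] by simp

text \<open>Lower bounds of chains for Zorn's lemma. The infimum is finite because each
  \<open>q x\<close> is at least \<open>- q (- x)\<close>, hence at least \<open>- p (- x)\<close>.
  Subadditivity needs the chain: two members can be replaced by the smaller one.\<close>

lemma sublinear_chain_Inf:
  fixes p :: "'c::real_vector \<Rightarrow> real"
  assumes "C \<noteq> {}" and sub: "\<And>q. q \<in> C \<Longrightarrow> sublinear q" and le: "\<And>q x. q \<in> C \<Longrightarrow> q x \<le> p x"
    and chain: "\<And>q r. q \<in> C \<Longrightarrow> r \<in> C \<Longrightarrow> (\<forall>x. q x \<le> r x) \<or> (\<forall>x. r x \<le> q x)"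
  shows "sublinear (\<lambda>x. INF q\<in>C. q x)"
    and "q \<in> C \<Longrightarrow> (INF q\<in>C. q x) \<le> q x"
proof -
  have bdd: "bdd_below ((\<lambda>q. q x) ` C)" for x
  proof (rule bdd_belowI2)
    fix q assume "q \<in> C"
    with sublinear_minus[OF sub, of q x] le[of q "- x"] show "- p (- x) \<le> q x" by force
  qed
  show "(INF q\<in>C. q x) \<le> q x" if "q \<in> C" for q x
    using cINF_lower[OF bdd that] .
  note lower = this
  show "sublinear (\<lambda>x. INF q\<in>C. q x)"
  proof (rule sublinearI)
    fix x y :: 'c
    have "(INF q\<in>C. q (x + y)) - q y \<le> r x" if qr: "q \<in> C" "r \<in> C" for q r
    proof -
      obtain s where s: "s \<in> C" "s x \<le> r x" "s y \<le> q y"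
        using chain[OF qr] qr by blast
      show ?thesis
        using lower[OF s(1), of "x + y"] sublinear_add[OF sub[OF s(1)], of x y] s by linarith
    qed
    then have "(INF q\<in>C. q (x + y)) - q y \<le> (INF r\<in>C. r x)" if "q \<in> C" for q
      using that by (intro cINF_greatest[OF \<open>C \<noteq> {}\<close>]) auto
    then have "(INF q\<in>C. q (x + y)) - (INF r\<in>C. r x) \<le> q y" if "q \<in> C" for q
      using that by (smt (verit))
    then have "(INF q\<in>C. q (x + y)) - (INF r\<in>C. r x) \<le> (INF q\<in>C. q y)"
      by (intro cINF_greatest[OF \<open>C \<noteq> {}\<close>]) auto
    then show "(INF q\<in>C. q (x + y)) \<le> (INF q\<in>C. q x) + (INF q\<in>C. q y)" by linarith
  next
    fix t :: real and x :: 'c assume t: "t > 0"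
    have "inverse t * (INF q\<in>C. q (t *\<^sub>R x)) \<le> q x" if "q \<in> C" for q
    proof -
      have "(INF q\<in>C. q (t *\<^sub>R x)) \<le> t * q x"
        using lower[OF that, of "t *\<^sub>R x"] sublinear_scale[OF sub[OF that], of t x] t by simp
      then show ?thesis using t by (simp add: field_simps)
    qed
    then have "inverse t * (INF q\<in>C. q (t *\<^sub>R x)) \<le> (INF q\<in>C. q x)"
      by (intro cINF_greatest[OF \<open>C \<noteq> {}\<close>]) auto
    then show "(INF q\<in>C. q (t *\<^sub>R x)) \<le> t * (INF q\<in>C. q x)"
      using t by (simp add: field_simps)
  next
    have "(INF q\<in>C. q 0) = (INF q\<in>C. 0::real)"
      using sublinear_zero[OF sub] by (intro INF_cong) auto
    then show "(INF q\<in>C. q 0) = (0::real)" using \<open>C \<noteq> {}\<close> by simp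
  qed
qed

text \<open>Tilting a sublinear functional along \<open>a\<close> gives a smaller one that is linear along \<open>a\<close>; hence
  minimal sublinear functionals are linear.\<close>

lemma sublinear_tilt:
  fixes m :: "'c::real_vector \<Rightarrow> real" and a :: 'c
  assumes m: "sublinear m"
  defines "r \<equiv> \<lambda>y. INF t\<in>{0..}. m (y + t *\<^sub>R a) - t * m a"
  shows "sublinear r" and "0 \<le> t \<Longrightarrow> r y \<le> m (y + t *\<^sub>R a) - t * m a"
proof -
  have bdd: "bdd_below ((\<lambda>t. m (y + t *\<^sub>R a) - t * m a) ` {0..})" for y
  proof (rule bdd_belowI2)
    fix t :: real assume "t \<in> {0..}"
    then have "t * m a = m ((y + t *\<^sub>R a) + (- y))" using sublinear_scale[OF m, of t a] by simp
    also have "\<dots> \<le> m (y + t *\<^sub>R a) + m (- y)" by (rule sublinear_add[OF m])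
    finally show "- m (- y) \<le> m (y + t *\<^sub>R a) - t * m a" by simp
  qed
  show lower: "r y \<le> m (y + t *\<^sub>R a) - t * m a" if "0 \<le> t" for y t
    unfolding r_def using that by (intro cINF_lower[OF bdd]) auto
  have greatest: "c \<le> r y" if "\<And>t. t \<ge> 0 \<Longrightarrow> c \<le> m (y + t *\<^sub>R a) - t * m a" for c y
    unfolding r_def using that by (intro cINF_greatest) auto
  show "sublinear r"
  proof (rule sublinearI)
    fix x y :: 'c
    \<comment> \<open>The parameters add up: the competitor for \<open>x + y\<close> with parameter
      \<open>s + t\<close> splits by subadditivity of \<open>m\<close>.\<close>
    have *: "r (x + y) \<le> (m (x + s *\<^sub>R a) - s * m a) + (m (y + t *\<^sub>R a) - t * m a)"
      if "s \<ge> 0" "t \<ge> 0" for s t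
      using lower[of "s + t" "x + y"] sublinear_add[OF m, of "x + s *\<^sub>R a" "y + t *\<^sub>R a"] that
      by (simp add: algebra_simps)
    have "r (x + y) - (m (x + s *\<^sub>R a) - s * m a) \<le> r y" if "s \<ge> 0" for s
      using *[OF that] by (intro greatest) (smt (verit))
    then have "r (x + y) - r y \<le> r x"
      by (intro greatest) (smt (verit))
    then show "r (x + y) \<le> r x + r y" by simp
  next
    fix s :: real and x :: 'c assume s: "s > 0"
    have "inverse s * r (s *\<^sub>R x) \<le> r x"
    proof (rule greatest)
      fix t :: real assume t: "t \<ge> 0"
      have "r (s *\<^sub>R x) \<le> m (s *\<^sub>R (x + t *\<^sub>R a)) - s * t * m a"
        using lower[of "s * t" "s *\<^sub>R x"] s t by (simp add: algebra_simps)
      also have "\<dots> = s * (m (x + t *\<^sub>R a) - t * m a)"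
        using sublinear_scale[OF m, of s "x + t *\<^sub>R a"] s by (simp add: right_diff_distrib)
      finally show "inverse s * r (s *\<^sub>R x) \<le> m (x + t *\<^sub>R a) - t * m a"
        using s by (simp add: field_simps)
    qed
    then show "r (s *\<^sub>R x) \<le> s * r x" using s by (simp add: field_simps)
  next
    have "r 0 \<le> 0" using lower[of 0 0] sublinear_zero[OF m] by simp
    moreover have "0 \<le> r 0"
      using sublinear_scale[OF m] by (intro greatest) simp
    ultimately show "r 0 = 0" by simp
  qed
qed

theorem hahn_banach_sublinear:
  fixes p :: "'c::real_vector \<Rightarrow> real"
  assumes p: "sublinear p"
  shows "dual_below p \<noteq> {}"
proof -
  define A where "A = {q. sublinear q \<and> (\<forall>x. q x \<le> p x)}"
  \<comment> \<open>The order is reversed, so that a maximal element in Zorn's lemma is a pointwise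
    minimal sublinear minorant.\<close>
  define P where "P = (\<lambda>a b::'c \<Rightarrow> real. \<forall>x. b x \<le> a x)"
  have "\<exists>m\<in>A. \<forall>a\<in>A. P m a \<longrightarrow> a = m"
  proof (rule predicate_Zorn)
    show "partial_order_on A (relation_of P A)"
      by (rule partial_order_on_relation_ofI) (auto simp: P_def fun_eq_iff intro: order_trans antisym)
  next
    fix C assume C: "C \<in> Chains (relation_of P A)"
    have CA: "q \<in> A" if "q \<in> C" for q
      using C that unfolding Chains_def relation_of_def by auto
    have ch: "(\<forall>x. q x \<le> r x) \<or> (\<forall>x. r x \<le> q x)" if "q \<in> C" "r \<in> C" for q r
      using C that unfolding Chains_def relation_of_def P_def by auto
    show "\<exists>u\<in>A. \<forall>a\<in>C. P a u"
    proof (cases "C = {}")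
      case True
      then show ?thesis using p by (auto simp: A_def)
    next
      case False
      have sub: "sublinear q" and le: "q x \<le> p x" if "q \<in> C" for q x
        using CA[OF that] by (auto simp: A_def)
      let ?u = "\<lambda>x. INF q\<in>C. q x"
      have u: "sublinear ?u" "q \<in> C \<Longrightarrow> ?u x \<le> q x" for q x
        using sublinear_chain_Inf[of C p] False sub le ch by blast+
      obtain q where "q \<in> C" using False by blast
      then have "?u x \<le> p x" for x using u(2)[of q x] le[of q x] by linarith
      then have "?u \<in> A" using u(1) by (simp add: A_def)
      moreover have "\<forall>a\<in>C. P a ?u" using u(2) by (simp add: P_def)
      ultimately show ?thesis by blast
    qed
  qed
  then obtain m where mA: "m \<in> A" and mP: "\<forall>q\<in>A. P m q \<longrightarrow> q = m" by blast
  then have m: "sublinear m" "\<And>x. m x \<le> p x" by (auto simp: A_def)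
  have min: "q = m" if "sublinear q" "\<And>x. q x \<le> m x" for q
    using mP that order_trans[OF that(2) m(2)] by (auto simp: A_def P_def)
  have add: "m (y + a) = m y + m a" for y a
  proof -
    note tilt = sublinear_tilt[where a = a, OF m(1)]
    \<comment> \<open>Parameter 0 shows that the tilt lies below \<open>m\<close>, so minimality
      makes it equal to \<open>m\<close>; parameter 1 then gives superadditivity along
      \<open>a\<close>.\<close>
    have "(\<lambda>y. INF t\<in>{0..}. m (y + t *\<^sub>R a) - t * m a) = m"
      using tilt(2)[where t = 0] by (intro min tilt(1)) simp
    then have "m y \<le> m (y + a) - m a" using tilt(2)[where t = 1 and y = y] by (simp add: fun_eq_iff)
    with sublinear_add[OF m(1), of y a] show ?thesis by simp
  qed
  have "m (t *\<^sub>R x) = t * m x" for t x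
  proof (cases "t \<ge> 0")
    case True
    then show ?thesis by (rule sublinear_scale[OF m(1)])
  next
    case False
    have "m (t *\<^sub>R x) + m ((- t) *\<^sub>R x) = 0"
      using add[of "t *\<^sub>R x" "(- t) *\<^sub>R x"] sublinear_zero[OF m(1)] by simp
    moreover have "m ((- t) *\<^sub>R x) = (- t) * m x"
      using False by (intro sublinear_scale[OF m(1)]) simp
    ultimately show ?thesis by simp
  qed
  with add have "linear m" by (intro linearI) auto
  with m show ?thesis by (auto simp: dual_below_def)
qed

lemma dual_below_linear: "k \<in> dual_below p \<Longrightarrow> linear k"
  and dual_below_le: "k \<in> dual_below p \<Longrightarrow> k x \<le> p x"
  by (auto simp: dual_below_def)

lemma dual_below_ge:
  assumes "k \<in> dual_below p"
  shows "- p (- x) \<le> k x"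
  using dual_below_le[OF assms, of "- x"] linear_neg[OF dual_below_linear[OF assms], of x] by simp

lemma dual_below_abs_le:
  assumes "k \<in> dual_below p" "\<And>x. p (- x) = p x"
  shows "\<bar>k x\<bar> \<le> p x"
  using dual_below_le[OF assms(1), of x] dual_below_ge[OF assms(1), of x] assms(2)[of x] by simp

lemma dual_below_mono:
  "k \<in> dual_below p \<Longrightarrow> (\<And>x. p x \<le> q x) \<Longrightarrow> k \<in> dual_below q"
  unfolding dual_below_def by (auto intro: order_trans)

text \<open>Hahn-Banach is applied to the tilt of \<open>p\<close> along \<open>a\<close>. Testing
  at \<open>- a\<close> with parameter 1 forces \<open>k (- a)\<close> to be at most
  \<open>- p a\<close>.\<close>

lemma dual_below_attained:
  fixes p :: "'c::real_vector \<Rightarrow> real"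
  assumes p: "sublinear p"
  shows "\<exists>k\<in>dual_below p. k a = p a"
proof -
  note tilt = sublinear_tilt[where a = a, OF p]
  obtain k where k: "k \<in> dual_below (\<lambda>y. INF t\<in>{0..}. p (y + t *\<^sub>R a) - t * p a)"
    using hahn_banach_sublinear[OF tilt(1)] by blast
  have "k x \<le> p x" for x
    using dual_below_le[OF k, of x] tilt(2)[where t = 0 and y = x] by simp
  then have kp: "k \<in> dual_below p"
    using k by (simp add: dual_below_def)
  have "k (- a) \<le> p (- a + 1 *\<^sub>R a) - 1 * p a"
    using dual_below_le[OF k, of "- a"] tilt(2)[where t = 1 and y = "- a"] by linarith
  then have "p a \<le> k a"
    using linear_neg[OF dual_below_linear[OF k], of a] sublinear_zero[OF p] by simp
  with dual_below_le[OF kp, of a] kp show ?thesis by force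
qed

text \<open>The set \<open>T\<close> collects the inequalities \<open>k w \<le> c\<close> that are imposed on \<open>k\<close>.\<close>

lemma dual_below_sandwich:
  fixes N :: "'c::real_vector \<Rightarrow> real" and T :: "('c \<times> real) set"
  assumes N: "sublinear N" and sym: "\<And>x. N (- x) = N x"
    and T: "\<And>w c. (w, c) \<in> convex hull T \<Longrightarrow> 0 \<le> c + N w"
  shows "\<exists>k\<in>dual_below N. \<forall>(w, c)\<in>T. k w \<le> c"
proof (cases "T = {}")
  case True
  then show ?thesis using hahn_banach_sublinear[OF N] by auto
next
  case False
  \<comment> \<open>\<open>p\<close> is the infimal convolution of \<open>N\<close> with the conical
    cost \<open>t * c\<close> at \<open>t\<close> times \<open>w\<close>. The choice
    \<open>t = 0\<close> gives \<open>p\<close> below \<open>N\<close>, and \<open>t = 1\<close>,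
    \<open>v = w\<close> gives \<open>p w\<close> below \<open>c\<close>, so any functional below
    \<open>p\<close> does what is wanted.\<close>
  define I where "I = {0::real..} \<times> (convex hull T)"
  define F where "F = (\<lambda>v (t, w, c). t * c + N (v - t *\<^sub>R w))"
  define p where "p = (\<lambda>v. INF i\<in>I. F v i)"
  have I: "I \<noteq> {}" using False by (simp add: I_def)
  \<comment> \<open>The hypothesis on the convex hull is exactly what keeps the infimum
    finite.\<close>
  have Fge: "- N v \<le> F v i" if "i \<in> I" for v i
  proof -
    obtain t w c where i: "i = (t, w, c)" by (cases i)
    with that have t: "t \<ge> 0" and wc: "(w, c) \<in> convex hull T" by (auto simp: I_def)
    have "t * N w = N ((v - t *\<^sub>R w) + (- v))"
      using sublinear_scale[OF N t, of w] sym[of "t *\<^sub>R w"] by simp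
    also have "\<dots> \<le> N (v - t *\<^sub>R w) + N v"
      using sublinear_add[OF N, of "v - t *\<^sub>R w" "- v"] sym[of v] by simp
    finally have "t * N w \<le> N (v - t *\<^sub>R w) + N v" .
    moreover have "0 \<le> t * (c + N w)" using T[OF wc] t by simp
    ultimately show ?thesis by (simp add: i F_def algebra_simps)
  qed
  have lower: "p v \<le> F v i" if "i \<in> I" for v i
    unfolding p_def using Fge that by (intro cINF_lower bdd_belowI2[of _ "- N v"]) auto
  have greatest: "b \<le> p v" if "\<And>i. i \<in> I \<Longrightarrow> b \<le> F v i" for b v
    unfolding p_def using that I by (intro cINF_greatest) auto
  have pN: "p v \<le> N v" for v
  proof -
    obtain w c where "(w, c) \<in> convex hull T" using False by (metis hull_inc surj_pair ex_in_conv)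
    then show ?thesis using lower[of "(0, w, c)" v] by (simp add: I_def F_def)
  qed
  have "sublinear p"
  proof (rule sublinearI)
    fix x y :: 'c
    have *: "p (x + y) \<le> F x i + F y j" if i: "i \<in> I" and j: "j \<in> I" for i j
    proof -
      obtain t w c where i': "i = (t, w, c)" by (cases i)
      obtain s v d where j': "j = (s, v, d)" by (cases j)
      have t: "t \<ge> 0" and s: "s \<ge> 0" and wc: "(w, c) \<in> convex hull T"
        and vd: "(v, d) \<in> convex hull T" using i j by (auto simp: I_def i' j')
      show ?thesis
      proof (cases "t + s = 0")
        case True
        then have "t = 0" "s = 0" using t s by auto
        then show ?thesis
          using pN[of "x + y"] sublinear_add[OF N, of x y] by (simp add: i' j' F_def)
      next
        case False
        with t s have ts: "t + s > 0" by simp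
        \<comment> \<open>Two competitors with weights \<open>t\<close> and \<open>s\<close> merge
          into one of weight \<open>t + s\<close>; this is why the index set uses the convex hull
          instead of \<open>T\<close>.\<close>
        define z where "z = (t / (t + s)) *\<^sub>R (w, c) + (s / (t + s)) *\<^sub>R (v, d)"
        have z: "z \<in> convex hull T"
          unfolding z_def using wc vd t s ts
          by (intro convexD[OF convex_convex_hull]) (auto simp: add_divide_distrib[symmetric])
        have "(t + s) *\<^sub>R z = t *\<^sub>R (w, c) + s *\<^sub>R (v, d)"
          unfolding z_def using ts by (simp only: scaleR_add_right scaleR_scaleR) simp
        then have zz: "(t + s) *\<^sub>R fst z = t *\<^sub>R w + s *\<^sub>R v" "(t + s) * snd z = t * c + s * d"
          by (auto simp: prod_eq_iff)
        have "p (x + y) \<le> F (x + y) (t + s, fst z, snd z)"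
          using t s z by (intro lower) (auto simp: I_def)
        also have "\<dots> = t * c + s * d + N ((x - t *\<^sub>R w) + (y - s *\<^sub>R v))"
        proof -
          have "x + y - (t + s) *\<^sub>R fst z = (x - t *\<^sub>R w) + (y - s *\<^sub>R v)" unfolding zz by simp
          then show ?thesis by (simp only: F_def prod.case zz)
        qed
        also have "\<dots> \<le> F x i + F y j"
          using sublinear_add[OF N, of "x - t *\<^sub>R w" "y - s *\<^sub>R v"] by (simp add: i' j' F_def)
        finally show ?thesis .
      qed
    qed
    have "p (x + y) - F x i \<le> p y" if "i \<in> I" for i
      using *[OF that] by (intro greatest) (smt (verit))
    then have "p (x + y) - p y \<le> p x"
      by (intro greatest) (smt (verit))
    then show "p (x + y) \<le> p x + p y" by simp
  next
    fix s :: real and x :: 'c assume s: "s > 0"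
    have "inverse s * p (s *\<^sub>R x) \<le> p x"
    proof (rule greatest)
      fix i assume i: "i \<in> I"
      obtain t w c where i': "i = (t, w, c)" by (cases i)
      have "p (s *\<^sub>R x) \<le> F (s *\<^sub>R x) (s * t, w, c)"
        using i s by (intro lower) (auto simp: I_def i')
      also have "\<dots> = s * F x i"
        using sublinear_scale[OF N, of s "x - t *\<^sub>R w"] s
        by (simp add: F_def i' scaleR_diff_right distrib_left)
      finally show "inverse s * p (s *\<^sub>R x) \<le> F x i"
        using s by (simp add: field_simps)
    qed
    then show "p (s *\<^sub>R x) \<le> s * p x" using s by (simp add: field_simps)
  next
    have "0 \<le> p 0" using Fge[of _ 0] sublinear_zero[OF N] by (intro greatest) auto
    with pN[of 0] sublinear_zero[OF N] show "p 0 = 0" by simp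
  qed
  then obtain k where k: "k \<in> dual_below p" using hahn_banach_sublinear by blast
  have "k w \<le> c" if "(w, c) \<in> T" for w c
    using dual_below_le[OF k, of w] lower[of "(1, w, c)" w] hull_inc[OF that, of convex] sublinear_zero[OF N]
    by (simp add: I_def F_def)
  moreover have "k \<in> dual_below N"
    using k pN by (rule dual_below_mono)
  ultimately show ?thesis by blast
qed

section \<open>Weak* compactness of sets of functionals\<close>

lemma closed_dual_below:
  fixes p :: "'c::real_vector \<Rightarrow> real"
  shows "closed (dual_below p)"
proof -
  have "dual_below p = (\<Inter>x. \<Inter>y. {k. k (x + y) = k x + k y}) \<inter> (\<Inter>t. \<Inter>x. {k. k (t *\<^sub>R x) = t * k x})
      \<inter> (\<Inter>x. {k. k x \<le> p x})"
    unfolding dual_below_def by (auto simp: linear_iff)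
  also have "closed \<dots>"
    by (intro closed_Int closed_INT ballI closed_Collect_eq closed_Collect_le continuous_intros
        continuous_on_product_coordinates)
  finally show ?thesis .
qed

text \<open>The Banach-Alaoglu argument: a closed subset of a product of compact intervals, compact
  by Tychonoff.\<close>

lemma compact_dual_below:
  fixes p :: "'c::real_vector \<Rightarrow> real"
  shows "compact (dual_below p)"
proof -
  have "compactin (product_topology (\<lambda>i. euclidean) UNIV) (PiE UNIV (\<lambda>x. {- p (- x)..p x}))"
    by (subst compactin_PiE) auto
  then have "compact (PiE UNIV (\<lambda>x. {- p (- x)..p x}))"
    by (simp add: euclidean_product_topology)
  moreover have "dual_below p \<subseteq> PiE UNIV (\<lambda>x. {- p (- x)..p x})"
    using dual_below_le dual_below_ge by (fastforce simp: PiE_def Pi_def)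
  ultimately show ?thesis
    by (metis compact_Int_closed[OF _ closed_dual_below] inf.absorb_iff2)
qed

section \<open>Asplund spaces and separability of the dual\<close>

text \<open>Each point of \<open>P\<close> outside \<open>P'\<close> lies in a basic open set that
  meets \<open>P\<close> in a countable set, and there are only countably many such sets. Removing
  them cannot make an uncountable relatively open piece countable.\<close>

lemma uncountable_condensation:
  fixes P :: "'x::second_countable_topology set"
  defines "P' \<equiv> {a \<in> P. \<forall>U. open U \<longrightarrow> a \<in> U \<longrightarrow> uncountable (U \<inter> P)}"
  shows "countable (P - P')"
    and "\<lbrakk>open U; U \<inter> P' \<noteq> {}\<rbrakk> \<Longrightarrow> uncountable (U \<inter> P')"
proof -
  obtain B :: "'x set set" where B: "countable B" "topological_basis B"
    using ex_countable_basis by blast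
  have "P - P' \<subseteq> (\<Union>b\<in>{b \<in> B. countable (b \<inter> P)}. b \<inter> P)"
  proof
    fix a assume a: "a \<in> P - P'"
    then obtain U where U: "open U" "a \<in> U" "countable (U \<inter> P)" unfolding P'_def by blast
    then obtain b where b: "b \<in> B" "a \<in> b" "b \<subseteq> U"
      using topological_basisE[OF B(2)] by metis
    then have "b \<inter> P \<subseteq> U \<inter> P" by blast
    then have "countable (b \<inter> P)" using U(3) by (rule countable_subset)
    then show "a \<in> (\<Union>b\<in>{b \<in> B. countable (b \<inter> P)}. b \<inter> P)" using a b by auto
  qed
  moreover have "countable (\<Union>b\<in>{b \<in> B. countable (b \<inter> P)}. b \<inter> P)"
    using B(1) by (intro countable_UN) auto
  ultimately show *: "countable (P - P')" by (rule countable_subset)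
  show "uncountable (U \<inter> P')" if "open U" "U \<inter> P' \<noteq> {}"
  proof
    assume "countable (U \<inter> P')"
    then have "countable ((U \<inter> P') \<union> (P - P'))" using * by simp
    then have "countable (U \<inter> P)" by (rule countable_subset[rotated]) blast
    then show False using that unfolding P'_def by blast
  qed
qed

lemma finite_chain_has_least:
  assumes "finite F" "F \<noteq> {}" "F \<subseteq> C" and "\<And>K L. K \<in> C \<Longrightarrow> L \<in> C \<Longrightarrow> K \<subseteq> L \<or> L \<subseteq> K"
  shows "\<exists>K\<in>F. \<forall>L\<in>F. K \<subseteq> L"
  using assms(1-3)
proof (induction F rule: finite_ne_induct)
  case (singleton x)
  then show ?case by simp
next
  case (insert x F)
  then obtain K where K: "K \<in> F" "\<forall>L\<in>F. K \<subseteq> L" by auto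
  have "x \<subseteq> K \<or> K \<subseteq> x" using assms(4) insert.prems K(1) by blast
  then show ?case
  proof
    assume "x \<subseteq> K"
    then show ?thesis using K by blast
  next
    assume "K \<subseteq> x"
    then show ?thesis using K by blast
  qed
qed

text \<open>Zorn's lemma for reverse inclusion. The intersection of a chain still covers: for each
  \<open>a\<close> in \<open>P\<close>, the closed fibres of \<open>R\<close> over \<open>a\<close>
  in the members of the chain have the finite intersection property in the compact set
  \<open>B\<close>.\<close>

lemma minimal_compact_cover:
  fixes R :: "'x::topological_space \<Rightarrow> 'y::t1_space"
  assumes B: "compact B" "closed B" and P: "P \<subseteq> R ` B" and R: "continuous_on UNIV R"
  shows "\<exists>K. closed K \<and> K \<subseteq> B \<and> P \<subseteq> R ` K \<and>
    (\<forall>L. closed L \<longrightarrow> L \<subseteq> K \<longrightarrow> P \<subseteq> R ` L \<longrightarrow> L = K)"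
proof -
  define \<K> where "\<K> = {K. closed K \<and> K \<subseteq> B \<and> P \<subseteq> R ` K}"
  define above where "above = (\<lambda>K L::'x set. L \<subseteq> K)"
  have "\<exists>K\<in>\<K>. \<forall>L\<in>\<K>. above K L \<longrightarrow> L = K"
  proof (rule predicate_Zorn)
    show "partial_order_on \<K> (relation_of above \<K>)"
      by (rule partial_order_on_relation_ofI) (auto simp: above_def)
  next
    fix C assume "C \<in> Chains (relation_of above \<K>)"
    then have C: "K \<in> C \<Longrightarrow> K \<in> \<K>" and ch: "K \<in> C \<Longrightarrow> L \<in> C \<Longrightarrow> K \<subseteq> L \<or> L \<subseteq> K" for K L
      unfolding Chains_def relation_of_def above_def by auto
    show "\<exists>u\<in>\<K>. \<forall>K\<in>C. above K u"
    proof (cases "C = {}")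
      case True
      then show ?thesis using B P by (auto simp: \<K>_def)
    next
      case False
      have cl: "closed K" if "K \<in> C" for K
        using C[OF that] by (auto simp: \<K>_def)
      have "closed (\<Inter>C)" using cl by (intro closed_Inter) auto
      moreover have "\<Inter>C \<subseteq> B" using False C by (auto simp: \<K>_def)
      moreover have "P \<subseteq> R ` \<Inter>C"
      proof
        fix a assume a: "a \<in> P"
        have "B \<inter> \<Inter>((\<lambda>K. K \<inter> R -` {a}) ` C) \<noteq> {}"
        proof (rule compact_imp_fip[OF B(1)])
          fix T assume "T \<in> (\<lambda>K. K \<inter> R -` {a}) ` C"
          then show "closed T"
            using cl closed_vimage[OF _ R, of "{a}"] by auto
        next
          fix F assume F: "finite F" "F \<subseteq> (\<lambda>K. K \<inter> R -` {a}) ` C"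
          then obtain C' where C': "C' \<subseteq> C" "finite C'" "F = (\<lambda>K. K \<inter> R -` {a}) ` C'"
            by (meson finite_subset_image)
          show "B \<inter> \<Inter>F \<noteq> {}"
          proof (cases "C' = {}")
            case True
            then show ?thesis using C'(3) P a by auto
          next
            case False
            then obtain K where K: "K \<in> C'" "\<forall>L\<in>C'. K \<subseteq> L"
              using finite_chain_has_least[of C' C] C' ch by blast
            then have "K \<in> \<K>" using C C' by blast
            then have "K \<subseteq> B" "P \<subseteq> R ` K" by (auto simp: \<K>_def)
            then obtain k where "k \<in> K" "R k = a" "k \<in> B" using a by blast
            then have "k \<in> B \<inter> \<Inter>F" using K C'(3) by auto
            then show ?thesis by blast
          qed
        qed
        then obtain k where "k \<in> \<Inter>((\<lambda>K. K \<inter> R -` {a}) ` C)" by blast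
        then have "k \<in> \<Inter>C" "R k = a" using False by auto
        then show "a \<in> R ` \<Inter>C" by blast
      qed
      ultimately have "\<Inter>C \<in> \<K>" by (simp add: \<K>_def)
      then show ?thesis by (auto simp: above_def)
    qed
  qed
  then obtain K where K: "K \<in> \<K>" and min: "\<forall>L\<in>\<K>. above K L \<longrightarrow> L = K" by blast
  show ?thesis
  proof (intro exI[of _ K] conjI allI impI)
    show "closed K" "K \<subseteq> B" "P \<subseteq> R ` K" using K by (auto simp: \<K>_def)
    then show "L = K" if "closed L" "L \<subseteq> K" "P \<subseteq> R ` L" for L
      using that min by (auto simp: \<K>_def above_def)
  qed
qed

text \<open>The restrictions of \<open>A\<close> to \<open>Q\<close> condense at a set \<open>P'\<close> of restrictions. If \<open>K\<close> is a minimal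
  weak*-compact set of functionals whose restrictions cover \<open>P'\<close>, then no slice of \<open>K\<close> has diameter
  below \<open>e\<close>, so that the support function of \<open>K\<close> is nowhere Frechet differentiable.\<close>

lemma asplund_separated_countable:
  fixes A :: "('a::real_normed_vector \<Rightarrow> real) set"
  assumes asp: "asplund TYPE('a)" and Q: "countable Q" and e: "e > 0"
    and A: "A \<subseteq> dual_below norm"
    and sep: "\<And>k l. k \<in> A \<Longrightarrow> l \<in> A \<Longrightarrow> k \<noteq> l \<Longrightarrow> \<exists>h\<in>Q. e * norm h < \<bar>k h - l h\<bar>"
  shows "countable A"
proof (rule ccontr)
  assume unc: "uncountable A"
  have "Q \<noteq> {}"
  proof
    assume "Q = {}"
    obtain k where k: "k \<in> A" using unc by fastforce
    with sep \<open>Q = {}\<close> have "A \<subseteq> {k}" by blast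
    with unc show False by (metis countable_subset countable_insert countable_empty)
  qed
  define q where "q = from_nat_into Q"
  have q: "range q = Q" unfolding q_def using Q \<open>Q \<noteq> {}\<close> by (rule range_from_nat_into[rotated])
  \<comment> \<open>Restriction to the countable set \<open>Q\<close>, listed as a sequence. Its
    values lie in a second countable space, where condensation points are available.\<close>
  define R where "R = (\<lambda>(k::'a \<Rightarrow> real) n::nat. k (q n))"
  have R: "continuous_on UNIV R"
    unfolding R_def by (intro continuous_on_coordinatewise_then_product continuous_on_product_coordinates)
  have injR: "inj_on R A"
  proof (rule inj_onI, rule ccontr)
    fix k l assume kl: "k \<in> A" "l \<in> A" "R k = R l" "k \<noteq> l"
    then obtain h where "h \<in> Q" "e * norm h < \<bar>k h - l h\<bar>" using sep by blast
    moreover have "k h = l h" using kl(3) q \<open>h \<in> Q\<close> by (auto simp: R_def fun_eq_iff)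
    ultimately show False using e by (simp add: mult_less_0_iff)
  qed
  define P' where "P' = {a \<in> R ` A. \<forall>U. open U \<longrightarrow> a \<in> U \<longrightarrow> uncountable (U \<inter> R ` A)}"
  note cond = uncountable_condensation[where P = "R ` A", folded P'_def]
  have "P' \<noteq> {}"
  proof
    assume "P' = {}"
    with cond(1) have "countable (R ` A)" by simp
    with unc injR show False by (simp add: countable_image_inj_eq)
  qed
  have P'A: "P' \<subseteq> R ` A" by (auto simp: P'_def)
  then have "P' \<subseteq> R ` dual_below norm" using A by blast
  from minimal_compact_cover[OF compact_dual_below closed_dual_below this R]
  obtain K where Kcl: "closed K" and K: "K \<subseteq> dual_below norm" "P' \<subseteq> R ` K"
    and min: "\<And>L. closed L \<Longrightarrow> L \<subseteq> K \<Longrightarrow> P' \<subseteq> R ` L \<Longrightarrow> L = K"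
    by blast
  have "K \<noteq> {}" using K(2) \<open>P' \<noteq> {}\<close> by blast
  have lin: "linear k" if "k \<in> K" for k using K(1) that dual_below_linear by blast
  have kn: "k x \<le> norm x" if "k \<in> K" for k x using K(1) that dual_below_le by blast
  define p where "p = (\<lambda>x. SUP k\<in>K. k x)"
  have bdd: "bdd_above ((\<lambda>k. k x) ` K)" for x using kn by (intro bdd_aboveI2[of _ _ "norm x"]) auto
  have kp: "k x \<le> p x" if "k \<in> K" for k x unfolding p_def by (rule cSUP_upper[OF that bdd])
  have pl: "p x \<le> c" if "\<And>k. k \<in> K \<Longrightarrow> k x \<le> c" for x c
    unfolding p_def using \<open>K \<noteq> {}\<close> that by (rule cSUP_least)
  have plip: "p y \<le> p x + norm (y - x)" for x y
  proof (rule pl)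
    fix k assume k: "k \<in> K"
    have "k y = k x + k (y - x)" using linear_add[OF lin[OF k], of x "y - x"] by simp
    with kp[OF k, of x] kn[OF k, of "y - x"] show "k y \<le> p x + norm (y - x)" by linarith
  qed
  have "continuous_on UNIV p"
  proof (rule continuous_on_iff[THEN iffD2], intro ballI allI impI)
    fix x :: 'a and d :: real assume "d > 0"
    moreover have "dist (p y) (p x) \<le> dist y x" for y
      using plip[of y x] plip[of x y] by (simp add: dist_norm norm_minus_commute abs_le_iff)
    ultimately show "\<exists>r>0. \<forall>y\<in>UNIV. dist y x < r \<longrightarrow> dist (p y) (p x) < d"
      by (intro exI[of _ d]) (auto intro: le_less_trans)
  qed
  moreover have "convex_on UNIV p"
  proof (rule convex_onI)
    fix t :: real and x y :: 'a assume t: "0 < t" "t < 1"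
    show "p ((1 - t) *\<^sub>R x + t *\<^sub>R y) \<le> (1 - t) * p x + t * p y"
    proof (rule pl)
      fix k assume k: "k \<in> K"
      have "k ((1 - t) *\<^sub>R x + t *\<^sub>R y) = (1 - t) * k x + t * k y"
        using lin[OF k] by (simp add: linear_add linear_scale)
      also have "\<dots> \<le> (1 - t) * p x + t * p y"
        using kp[OF k] t by (intro add_mono mult_left_mono) auto
      finally show "k ((1 - t) *\<^sub>R x + t *\<^sub>R y) \<le> (1 - t) * p x + t * p y" .
    qed
  qed simp
  ultimately have "UNIV \<subseteq> closure {x \<in> UNIV. p differentiable (at x)}"
    using asp[unfolded asplund_def, THEN conjunct2, rule_format, of UNIV p] by simp
  then have "{x \<in> UNIV. p differentiable (at x)} \<noteq> {}" by force
  then obtain x D where D: "(p has_derivative D) (at x)" by (auto simp: differentiable_def)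
  have linD: "linear D" using has_derivative_linear[OF D] .
  \<comment> \<open>The proof ends with \<open>s * e < 4 * (r * s)\<close>, which this value
    refutes.\<close>
  define r where "r = e / 16"
  have r: "r > 0" using e by (simp add: r_def)
  from D[unfolded has_derivative_at_alt] r obtain d where d: "d > 0"
    and Dd: "\<And>y. norm (y - x) < d \<Longrightarrow> norm (p y - p x - D (y - x)) \<le> r * norm (y - x)" by blast
  define s where "s = d / 2"
  have s: "s > 0" "s < d" using d by (auto simp: s_def)
  \<comment> \<open>The slice of functionals that almost attain the supremum
    \<open>p x\<close>.\<close>
  define U where "U = {k::'a \<Rightarrow> real. p x - r * s < k x}"
  have U: "open U" unfolding U_def
    by (intro open_Collect_less continuous_intros continuous_on_product_coordinates)
  have "p x - r * s < p x" using r s by simp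
  then obtain k0 where k0: "k0 \<in> K" "k0 \<in> U"
    unfolding U_def p_def using less_cSUP_iff[OF \<open>K \<noteq> {}\<close> bdd] by (auto simp: p_def)
  have KU: "closed (K - U)" by (intro closed_Diff Kcl U)
  have "dual_below norm \<inter> (K - U) = K - U" using K(1) by blast
  then have KUc: "compact (K - U)" using compact_Int_closed[OF compact_dual_below KU] by metis
  have "K - U \<noteq> K" using k0 by blast
  \<comment> \<open>By minimality the part of \<open>K\<close> outside the slice no longer covers
    \<open>P'\<close>, so some \<open>a\<close> is covered only from inside the slice.\<close>
  then have "\<not> P' \<subseteq> R ` (K - U)" using min[OF KU] by blast
  then obtain a where a: "a \<in> P'" "a \<notin> R ` (K - U)" by blast
  define V where "V = - R ` (K - U)"
  have "open V" unfolding V_def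
    by (intro open_Compl compact_imp_closed compact_continuous_image KUc continuous_on_subset[OF R]) auto
  \<comment> \<open>Condensation supplies a second point \<open>b\<close> near \<open>a\<close> that
    is also covered only from inside the slice. Both are restrictions of distinct members of
    \<open>A\<close>, so their lifts \<open>k\<close> and \<open>l\<close> to the slice differ by
    more than \<open>e\<close> times the norm at some point of \<open>Q\<close>.\<close>
  then have unc': "uncountable (V \<inter> P')" using cond(2)[where U = V] a by (auto simp: V_def)
  have "\<not> V \<inter> P' \<subseteq> {a}" using unc' by (metis countable_subset countable_insert countable_empty)
  then obtain b where b: "b \<in> P'" "b \<notin> R ` (K - U)" "b \<noteq> a" by (auto simp: V_def)
  have lift: "\<exists>k\<in>K. k \<in> U \<and> R k = c" if "c \<in> P'" "c \<notin> R ` (K - U)" for c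
    using that K(2) by blast
  obtain k where k: "k \<in> K" "k \<in> U" "R k = a" using lift a by blast
  obtain l where l: "l \<in> K" "l \<in> U" "R l = b" using lift b by blast
  obtain k' l' where kl': "k' \<in> A" "l' \<in> A" "R k' = a" "R l' = b" using a(1) b(1) P'A by blast
  with b(3) sep obtain h where h: "h \<in> Q" "e * norm h < \<bar>k' h - l' h\<bar>" by metis
  have "k h = k' h" "l h = l' h"
    using k(3) l(3) kl' q h(1) by (auto simp: R_def fun_eq_iff)
  with h have h': "e * norm h < \<bar>k h - l h\<bar>" by simp
  have "h \<noteq> 0" using h' linear_0[OF lin[OF k(1)]] linear_0[OF lin[OF l(1)]] by auto
  define v where "v = (s / norm h) *\<^sub>R h"
  have v: "norm v = s" using \<open>h \<noteq> 0\<close> s by (simp add: v_def)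
  \<comment> \<open>One error \<open>r * s\<close> comes from the slice and one from
    differentiability of \<open>p\<close> at radius \<open>s\<close>. Used for \<open>v\<close> and
    \<open>- v\<close>, this puts all functionals of the slice close to \<open>D v\<close>.\<close>
  have up: "m w \<le> D w + 2 * (r * s)" if m: "m \<in> K" "m \<in> U" and w: "norm w = s" for m w
  proof -
    have "m w = m (x + w) - m x" using linear_add[OF lin[OF m(1)]] by simp
    also have "\<dots> \<le> p (x + w) - p x + r * s" using kp[OF m(1), of "x + w"] m(2) by (simp add: U_def)
    also have "\<dots> \<le> D w + 2 * (r * s)" using Dd[of "x + w"] w s by (simp add: abs_le_iff)
    finally show ?thesis .
  qed
  have close: "\<bar>m v - D v\<bar> \<le> 2 * (r * s)" if m: "m \<in> K" "m \<in> U" for m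
    using up[OF m v] up[OF m, of "- v"] v linear_neg[OF lin[OF m(1)], of v] linear_neg[OF linD, of v]
    by (simp add: abs_le_iff)
  have "\<bar>k v - l v\<bar> \<le> 4 * (r * s)" using close[OF k(1,2)] close[OF l(1,2)] by linarith
  moreover have "k v - l v = (s / norm h) * (k h - l h)"
    unfolding v_def using lin k(1) l(1) by (simp add: linear_scale right_diff_distrib)
  then have "\<bar>k v - l v\<bar> = (s / norm h) * \<bar>k h - l h\<bar>" using s by (simp add: abs_mult)
  moreover have "(s / norm h) * \<bar>k h - l h\<bar> > (s / norm h) * (e * norm h)"
    using h' s \<open>h \<noteq> 0\<close> by (intro mult_strict_left_mono) auto
  moreover have "(s / norm h) * (e * norm h) = s * e" using \<open>h \<noteq> 0\<close> by simp
  ultimately have "s * e < 4 * (r * s)" by linarith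
  then show False using s e by (simp add: r_def)
qed

text \<open>The dual of every separable subspace is norm separable. By Hahn-Banach it suffices to look at
  restrictions of functionals that are defined on the whole space.\<close>

definition separable_dual :: "'c::real_normed_vector itself \<Rightarrow> bool" where
  "separable_dual _ \<longleftrightarrow> (\<forall>(Q :: 'c set) e. countable Q \<longrightarrow> e > 0 \<longrightarrow>
     (\<exists>D. countable D \<and> D \<subseteq> dual_below norm \<and>
       (\<forall>k\<in>dual_below norm. \<exists>d\<in>D. \<forall>h\<in>Q. \<bar>k h - d h\<bar> \<le> e * norm h)))"

text \<open>A maximal \<open>e\<close>-separated family of functionals is countable by the previous
  lemma, and maximality makes it an \<open>e\<close>-net on \<open>Q\<close>.\<close>

lemma asplund_separable_dual:
  assumes asp: "asplund TYPE('a::real_normed_vector)"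
  shows "separable_dual TYPE('a)"
  unfolding separable_dual_def
proof (intro allI impI)
  fix Q :: "'a set" and e :: real assume Q: "countable Q" and e: "e > 0"
  define far where "far = (\<lambda>k l :: 'a \<Rightarrow> real. \<exists>h\<in>Q. e * norm h < \<bar>k h - l h\<bar>)"
  define \<A> where "\<A> = {A. A \<subseteq> dual_below norm \<and> (\<forall>k\<in>A. \<forall>l\<in>A. k \<noteq> l \<longrightarrow> far k l)}"
  have "\<exists>A\<in>\<A>. \<forall>B\<in>\<A>. A \<subseteq> B \<longrightarrow> B = A"
  proof (rule subset_Zorn')
    fix C assume C: "subset.chain \<A> C"
    have "far k l" if kl: "k \<in> \<Union>C" "l \<in> \<Union>C" "k \<noteq> l" for k l
    proof -
      obtain A B where AB: "A \<in> C" "k \<in> A" "B \<in> C" "l \<in> B" using kl by blast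
      then have "A \<subseteq> B \<or> B \<subseteq> A" "A \<in> \<A>" "B \<in> \<A>" using C by (auto simp: subset_chain_def)
      then show ?thesis using AB kl(3) by (auto simp: \<A>_def)
    qed
    then show "\<Union>C \<in> \<A>" using C by (auto simp: \<A>_def subset_chain_def)
  qed
  then obtain A where A: "A \<in> \<A>" and max: "\<And>B. B \<in> \<A> \<Longrightarrow> A \<subseteq> B \<Longrightarrow> B = A" by blast
  have "countable A"
    using A by (intro asplund_separated_countable[OF asp Q e]) (auto simp: \<A>_def far_def)
  moreover have "\<exists>d\<in>A. \<forall>h\<in>Q. \<bar>k h - d h\<bar> \<le> e * norm h" if k: "k \<in> dual_below norm" for k
  proof (cases "k \<in> A")
    case True
    then show ?thesis using e by (intro bexI[of _ k]) auto
  next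
    case False
    then have "insert k A \<notin> \<A>" using max[of "insert k A"] by blast
    moreover have "far d l \<longleftrightarrow> far l d" for d l
      by (simp add: far_def abs_minus_commute)
    ultimately obtain d where "d \<in> A" "\<not> far k d"
      using A k unfolding \<A>_def by blast
    then show ?thesis by (auto simp: far_def not_less)
  qed
  ultimately show "\<exists>D. countable D \<and> D \<subseteq> dual_below norm \<and>
       (\<forall>k\<in>dual_below norm. \<exists>d\<in>D. \<forall>h\<in>Q. \<bar>k h - d h\<bar> \<le> e * norm h)"
    using A by (auto simp: \<A>_def)
qed

text \<open>A functional splits into its two partial functionals, which are approximated separately.
  The sum of the two approximants need not be below the product norm, so \<open>pick\<close>
  replaces it by an admissible functional nearby. This doubles the error \<open>e / 2\<close>, which
  itself is the sum of two errors \<open>e / 4\<close>.\<close>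

lemma separable_dual_prod:
  assumes "separable_dual TYPE('a::real_normed_vector)" "separable_dual TYPE('b::real_normed_vector)"
  shows "separable_dual TYPE('a \<times> 'b)"
  unfolding separable_dual_def
proof (intro allI impI)
  fix Q :: "('a \<times> 'b) set" and e :: real assume Q: "countable Q" and e: "e > 0"
  obtain D where D: "countable D" "D \<subseteq> dual_below norm"
    and Dk: "\<And>k. k \<in> dual_below norm \<Longrightarrow> \<exists>d\<in>D. \<forall>h\<in>fst ` Q. \<bar>k h - d h\<bar> \<le> e / 4 * norm h"
    using assms(1)[unfolded separable_dual_def, rule_format, of "fst ` Q" "e / 4"] Q e by auto
  obtain E where E: "countable E" "E \<subseteq> dual_below norm"
    and Ek: "\<And>k. k \<in> dual_below norm \<Longrightarrow> \<exists>d\<in>E. \<forall>h\<in>snd ` Q. \<bar>k h - d h\<bar> \<le> e / 4 * norm h"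
    using assms(2)[unfolded separable_dual_def, rule_format, of "snd ` Q" "e / 4"] Q e by auto
  define near where "near = (\<lambda>(d, c) k. \<forall>h\<in>Q. \<bar>k h - (d (fst h) + c (snd h))\<bar> \<le> e / 2 * norm h)"
  define pick where "pick = (\<lambda>i. SOME k. k \<in> dual_below norm \<and> near i k)"
  define I where "I = {i \<in> D \<times> E. \<exists>k\<in>dual_below norm. near i k}"
  have pick: "pick i \<in> dual_below norm" "near i (pick i)" if "i \<in> I" for i
    using someI_ex[of "\<lambda>k. k \<in> dual_below norm \<and> near i k"] that unfolding I_def pick_def by blast+
  have 1: "countable (pick ` I)"
    using D(1) E(1) by (intro countable_image countable_subset[of I "D \<times> E"]) (auto simp: I_def)
  have 2: "pick ` I \<subseteq> dual_below norm" using pick by blast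
  have 3: "\<exists>d\<in>pick ` I. \<forall>h\<in>Q. \<bar>k h - d h\<bar> \<le> e * norm h" if k: "k \<in> dual_below norm" for k
  proof -
    have lin: "linear k" using dual_below_linear[OF k] .
    note le = dual_below_le[OF k]
    have k1: "(\<lambda>x. k (x, 0)) \<in> dual_below norm"
    proof -
      have "linear (\<lambda>x. k (x, 0))"
        using linear_add[OF lin, of "(_, 0)" "(_, 0)"] linear_scale[OF lin, of _ "(_, 0)"]
        by (intro linearI) auto
      moreover have "k (x, 0) \<le> norm x" for x using le[of "(x, 0)"] by simp
      ultimately show ?thesis by (simp add: dual_below_def)
    qed
    have k2: "(\<lambda>y. k (0, y)) \<in> dual_below norm"
    proof -
      have "linear (\<lambda>y. k (0, y))"
        using linear_add[OF lin, of "(0, _)" "(0, _)"] linear_scale[OF lin, of _ "(0, _)"]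
        by (intro linearI) auto
      moreover have "k (0, x) \<le> norm x" for x using le[of "(0, x)"] by simp
      ultimately show ?thesis by (simp add: dual_below_def)
    qed
    obtain d where d: "d \<in> D" "\<forall>h\<in>fst ` Q. \<bar>k (h, 0) - d h\<bar> \<le> e / 4 * norm h" using Dk[OF k1] by blast
    obtain c where c: "c \<in> E" "\<forall>h\<in>snd ` Q. \<bar>k (0, h) - c h\<bar> \<le> e / 4 * norm h" using Ek[OF k2] by blast
    have nk: "near (d, c) k"
      unfolding near_def prod.case
    proof
      fix h assume h: "h \<in> Q"
      obtain x y where xy: "h = (x, y)" by (cases h)
      have "k (x, y) = k (x, 0) + k (0, y)" using linear_add[OF lin, of "(x, 0)" "(0, y)"] by simp
      moreover have "\<bar>k (x, 0) - d x\<bar> \<le> e / 4 * norm x" "\<bar>k (0, y) - c y\<bar> \<le> e / 4 * norm y"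
        using d(2) c(2) h xy by force+
      moreover have "e / 4 * norm x \<le> e / 4 * norm h" "e / 4 * norm y \<le> e / 4 * norm h"
        using e norm_fst_le[of x y] norm_snd_le[of y x] by (auto simp: xy intro!: mult_left_mono)
      ultimately show "\<bar>k h - (d (fst h) + c (snd h))\<bar> \<le> e / 2 * norm h"
        unfolding xy fst_conv snd_conv by linarith
    qed
    then have i: "(d, c) \<in> I" using d(1) c(1) k by (auto simp: I_def)
    have "\<bar>k h - pick (d, c) h\<bar> \<le> e * norm h" if "h \<in> Q" for h
    proof -
      have "\<bar>k h - (d (fst h) + c (snd h))\<bar> \<le> e / 2 * norm h"
        "\<bar>pick (d, c) h - (d (fst h) + c (snd h))\<bar> \<le> e / 2 * norm h"
        using nk pick(2)[OF i] that by (auto simp: near_def)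
      then have "\<bar>k h - pick (d, c) h\<bar> \<le> e / 2 * norm h + e / 2 * norm h" by linarith
      then show ?thesis by simp
    qed
    then show ?thesis using i by blast
  qed
  show "\<exists>D. countable D \<and> D \<subseteq> dual_below norm \<and>
       (\<forall>k\<in>dual_below norm. \<exists>d\<in>D. \<forall>h\<in>Q. \<bar>k h - d h\<bar> \<le> e * norm h)"
    by (intro exI[of _ "pick ` I"] conjI ballI 1 2 3)
qed

section \<open>Smooth approximation of seminorms\<close>

lemma sq_ge_of_near:
  fixes a n e :: real
  assumes "n - e \<le> \<bar>a\<bar>" "0 \<le> e" "0 \<le> n"
  shows "n\<^sup>2 - 2 * e * n \<le> a\<^sup>2"
proof (cases "e \<le> n")
  case True
  then have "(n - e)\<^sup>2 \<le> \<bar>a\<bar>\<^sup>2" using assms by (intro power_mono) auto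
  moreover have "(n - e)\<^sup>2 = n\<^sup>2 - 2 * e * n + e\<^sup>2" by (simp add: power2_diff)
  ultimately show ?thesis using zero_le_power2[of e] by (simp only: power2_abs)
next
  case False
  then have "n * n \<le> 2 * e * n" using assms by (intro mult_right_mono) auto
  then show ?thesis unfolding power2_eq_square using zero_le_square[of a] by linarith
qed

text \<open>The operator norm of the restriction of \<open>g\<close> to \<open>M\<close>; the
  supremum is meaningful for \<open>g\<close> bounded on the unit ball of \<open>M\<close>.\<close>

definition norm_on :: "'c::real_normed_vector set \<Rightarrow> ('c \<Rightarrow> real) \<Rightarrow> real" where
  "norm_on M g = (SUP h\<in>{h \<in> M. norm h \<le> 1}. \<bar>g h\<bar>)"

context
  fixes M :: "'c::real_normed_vector set" and g :: "'c \<Rightarrow> real" and C :: real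
  assumes M: "subspace M" and g: "linear g" and C: "\<And>h. \<bar>g h\<bar> \<le> C * norm h" and C0: "0 \<le> C"
begin

lemma norm_on_bdd: "bdd_above ((\<lambda>h. \<bar>g h\<bar>) ` {h \<in> M. norm h \<le> 1})"
proof (rule bdd_aboveI2)
  fix h assume "h \<in> {h \<in> M. norm h \<le> 1}"
  then have "C * norm h \<le> C * 1" using C0 by (intro mult_left_mono) auto
  with C[of h] show "\<bar>g h\<bar> \<le> C" by simp
qed

lemma norm_on_nonempty: "{h \<in> M. norm h \<le> 1} \<noteq> {}"
  using subspace_0[OF M] by force

lemma norm_on_upper: "h \<in> M \<Longrightarrow> norm h \<le> 1 \<Longrightarrow> \<bar>g h\<bar> \<le> norm_on M g"
  unfolding norm_on_def by (intro cSUP_upper norm_on_bdd) auto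

lemma norm_on_nonneg: "0 \<le> norm_on M g"
  using norm_on_upper[of 0] subspace_0[OF M] by force

lemma norm_on_bound:
  assumes h: "h \<in> M"
  shows "\<bar>g h\<bar> \<le> norm_on M g * norm h"
proof (cases "h = 0")
  case True
  then show ?thesis using linear_0[OF g] by simp
next
  case False
  have "\<bar>g (inverse (norm h) *\<^sub>R h)\<bar> \<le> norm_on M g"
    using False by (intro norm_on_upper subspace_scale[OF M] h) auto
  then have "inverse (norm h) * \<bar>g h\<bar> \<le> norm_on M g"
    by (simp add: linear_scale[OF g] abs_mult)
  then show ?thesis using False by (simp add: field_simps)
qed

lemma norm_on_least:
  assumes "\<And>h. h \<in> M \<Longrightarrow> \<bar>g h\<bar> \<le> c * norm h" "0 \<le> c"
  shows "norm_on M g \<le> c"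
  unfolding norm_on_def
proof (rule cSUP_least[OF norm_on_nonempty])
  fix h assume h: "h \<in> {h \<in> M. norm h \<le> 1}"
  then have "c * norm h \<le> c * 1" using assms(2) by (intro mult_left_mono) auto
  with assms(1)[of h] h show "\<bar>g h\<bar> \<le> c" by simp
qed

lemma norm_on_approx:
  assumes "e > 0"
  obtains h where "h \<in> M" "norm h \<le> 1" "norm_on M g - e \<le> \<bar>g h\<bar>"
proof -
  have "norm_on M g - e < norm_on M g" using assms by simp
  then obtain h where "h \<in> {h \<in> M. norm h \<le> 1}" "norm_on M g - e < \<bar>g h\<bar>"
    using less_cSUP_iff[OF norm_on_nonempty norm_on_bdd] unfolding norm_on_def by blast
  with that show thesis by force
qed

end

text \<open>The penalty \<open>\<Sum>j. 2^-j |k - d j|^2\<close> is locally uniformly convex at every \<open>k\<close> that is a limit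
  of the \<open>d j\<close>, because the parallelogram defect of its \<open>j\<close>-th term controls the difference of the
  distances to \<open>d j\<close>. This forces maximisers to be strong and makes the conjugate smooth.\<close>

locale smoothing =
  fixes N :: "'c::real_normed_vector \<Rightarrow> real" and L :: real and M :: "'c set"
    and d :: "nat \<Rightarrow> 'c \<Rightarrow> real" and eta :: real
  assumes N: "sublinear N" and NL: "\<And>x. N x \<le> L * norm x" and L: "L > 0" and M: "subspace M"
    and d: "\<And>j. d j \<in> dual_below (\<lambda>x. L * norm x)"
    and dense: "\<And>k e. k \<in> dual_below N \<Longrightarrow> e > 0 \<Longrightarrow> \<exists>j. \<forall>h\<in>M. \<bar>k h - d j h\<bar> \<le> e * norm h"
    and eta: "eta > 0"
begin

definition w :: "nat \<Rightarrow> real" where "w j = (1 / 2) ^ Suc j"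
definition n :: "nat \<Rightarrow> ('c \<Rightarrow> real) \<Rightarrow> real" where "n j k = norm_on M (\<lambda>h. k h - d j h)"
definition q :: "('c \<Rightarrow> real) \<Rightarrow> real" where "q k = (\<Sum>j. w j * (n j k)\<^sup>2)"
text \<open>Since \<open>n j k\<close> is at most \<open>2 * L\<close> and the weights sum to 1,
  \<open>q\<close> is at most \<open>4 * L\<^sup>2\<close>, so the penalty \<open>c * q\<close>
  never exceeds \<open>eta\<close>.\<close>

definition c :: real where "c = eta / (4 * L\<^sup>2)"
definition F :: "'c \<Rightarrow> ('c \<Rightarrow> real) \<Rightarrow> real" where "F x k = k x - c * q k"
text \<open>The conjugate of \<open>c * q\<close> restricted to \<open>dual_below N\<close>. Without
  the penalty it would be \<open>N\<close> itself, the support function of that set.\<close>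

definition Phi :: "'c \<Rightarrow> real" where "Phi x = (SUP k\<in>dual_below N. F x k)"

lemma w: "w j > 0" "w sums 1"
  unfolding w_def using power_half_series by simp_all

lemma w_term_nonneg: "0 \<le> w j * b\<^sup>2"
  using w(1)[of j] by simp

lemma c: "c > 0"
  using eta L by (simp add: c_def)

lemma abs_le: "k \<in> dual_below N \<Longrightarrow> \<bar>k h\<bar> \<le> L * norm h"
  by (rule dual_below_abs_le[OF dual_below_mono[OF _ NL]]) auto

lemma diff_linear: "k \<in> dual_below N \<Longrightarrow> linear (\<lambda>h. k h - d j h)"
  by (intro linear_compose_sub dual_below_linear[of k N] dual_below_linear[OF d])

lemma diff_abs_le:
  assumes "k \<in> dual_below N"
  shows "\<bar>k h - d j h\<bar> \<le> (2 * L) * norm h"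
  using abs_le[OF assms, of h] dual_below_abs_le[OF d[of j], of h] by simp

lemmas n_props = M diff_linear diff_abs_le

lemma n_nonneg: "k \<in> dual_below N \<Longrightarrow> 0 \<le> n j k"
  unfolding n_def using L by (intro norm_on_nonneg[where C = "2 * L"] n_props) auto

lemma n_bound: "k \<in> dual_below N \<Longrightarrow> h \<in> M \<Longrightarrow> \<bar>k h - d j h\<bar> \<le> n j k * norm h"
  unfolding n_def using L norm_on_bound[where C = "2 * L" and g = "\<lambda>h. k h - d j h"] n_props by auto

lemma n_least:
  assumes "k \<in> dual_below N" "\<And>h. h \<in> M \<Longrightarrow> \<bar>k h - d j h\<bar> \<le> b * norm h" "0 \<le> b"
  shows "n j k \<le> b"
  unfolding n_def using L assms by (intro norm_on_least[where C = "2 * L"] n_props) auto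

lemma n_le: "k \<in> dual_below N \<Longrightarrow> n j k \<le> 2 * L"
  using L by (intro n_least diff_abs_le) auto

lemma q_term_le: "k \<in> dual_below N \<Longrightarrow> w j * (n j k)\<^sup>2 \<le> w j * (4 * L\<^sup>2)"
  using power_mono[OF n_le[of k j] n_nonneg[of k j], of 2] w(1)[of j] by (intro mult_left_mono) auto

lemma q_summable:
  assumes "k \<in> dual_below N"
  shows "summable (\<lambda>j. w j * (n j k)\<^sup>2)"
proof (rule summable_comparison_test')
  show "summable (\<lambda>j. w j * (4 * L\<^sup>2))" using w(2) by (intro summable_mult2) (auto simp: sums_iff)
  show "norm (w j * (n j k)\<^sup>2) \<le> w j * (4 * L\<^sup>2)" for j
    using q_term_le[OF assms, of j] w(1)[of j] by (simp add: abs_mult)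
qed

lemma q_nonneg: "k \<in> dual_below N \<Longrightarrow> 0 \<le> q k"
  unfolding q_def by (intro suminf_nonneg q_summable w_term_nonneg)

lemma q_le:
  assumes k: "k \<in> dual_below N"
  shows "c * q k \<le> eta"
proof -
  have "q k \<le> (\<Sum>j. w j * (4 * L\<^sup>2))"
    unfolding q_def using w(2) q_term_le[OF k]
    by (intro suminf_le q_summable k summable_mult2) (auto simp: sums_iff)
  also have "\<dots> = 4 * L\<^sup>2"
    using suminf_mult2[of w "4 * L\<^sup>2"] w(2) by (simp add: sums_iff)
  finally have "c * q k \<le> c * (4 * L\<^sup>2)" using c by (intro mult_left_mono) auto
  then show ?thesis using L by (simp add: c_def)
qed

lemma F_le: "k \<in> dual_below N \<Longrightarrow> F x k \<le> N x"
  unfolding F_def using dual_below_le[of k N x] q_nonneg c by (smt (verit) mult_nonneg_nonneg)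

lemma F_bdd: "bdd_above (F x ` dual_below N)"
  using F_le by (intro bdd_aboveI2) auto

lemma F_le_Phi: "k \<in> dual_below N \<Longrightarrow> F x k \<le> Phi x"
  unfolding Phi_def by (intro cSUP_upper F_bdd)

lemma Phi_least: "(\<And>k. k \<in> dual_below N \<Longrightarrow> F x k \<le> b) \<Longrightarrow> Phi x \<le> b"
  unfolding Phi_def using hahn_banach_sublinear[OF N] by (intro cSUP_least) auto

lemma Phi_le: "Phi x \<le> N x"
  using F_le by (rule Phi_least)

lemma Phi_ge: "N x - eta \<le> Phi x"
proof -
  obtain k where k: "k \<in> dual_below N" "k x = N x" using dual_below_attained[OF N] by blast
  then show ?thesis using F_le_Phi[OF k(1), of x] q_le[OF k(1)] by (simp add: F_def)
qed

lemma F_shift: "k \<in> dual_below N \<Longrightarrow> F (x + h) k = F x k + k h"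
  using linear_add[OF dual_below_linear, of k N x h] by (simp add: F_def)

lemma Phi_shift: "Phi (x + h) \<le> Phi x + N h"
proof (rule Phi_least)
  fix k assume k: "k \<in> dual_below N"
  show "F (x + h) k \<le> Phi x + N h"
    using F_le_Phi[OF k, of x] dual_below_le[OF k, of h] by (simp add: F_shift[OF k])
qed

text \<open>Weak* upper semicontinuity of \<open>F x\<close>. The penalty \<open>q\<close> is a
  supremum of finite weighted sums of squares of evaluations at points \<open>h j\<close> in the
  unit ball of \<open>M\<close>, and such sums are weak* continuous in \<open>k\<close>.\<close>

lemma closed_superlevel: "closed {k \<in> dual_below N. a \<le> F x k}"
proof -
  define H where "H = {h :: nat \<Rightarrow> 'c. \<forall>j. h j \<in> M \<and> norm (h j) \<le> 1}"
  let ?S = "\<lambda>m h. {k. c * (\<Sum>j<m. w j * (k (h j) - d j (h j))\<^sup>2) \<le> k x - a}"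
  have "a \<le> F x k \<longleftrightarrow> k \<in> (\<Inter>m. \<Inter>h\<in>H. ?S m h)" if k: "k \<in> dual_below N" for k
  proof
    assume a: "a \<le> F x k"
    show "k \<in> (\<Inter>m. \<Inter>h\<in>H. ?S m h)"
    proof clarify
      fix m h assume h: "h \<in> H"
      have "(\<Sum>j<m. w j * (k (h j) - d j (h j))\<^sup>2) \<le> (\<Sum>j<m. w j * (n j k)\<^sup>2)"
      proof (intro sum_mono mult_left_mono)
        fix j
        have "\<bar>k (h j) - d j (h j)\<bar> \<le> n j k * norm (h j)" using h by (intro n_bound k) (auto simp: H_def)
        also have "\<dots> \<le> n j k * 1" using h n_nonneg[OF k] by (intro mult_left_mono) (auto simp: H_def)
        finally show "(k (h j) - d j (h j))\<^sup>2 \<le> (n j k)\<^sup>2"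
          using abs_le_square_iff n_nonneg[OF k, of j] by force
        show "0 \<le> w j" using w(1)[of j] by simp
      qed
      also have "\<dots> \<le> q k"
        unfolding q_def by (intro sum_le_suminf q_summable k w_term_nonneg) auto
      finally have "c * (\<Sum>j<m. w j * (k (h j) - d j (h j))\<^sup>2) \<le> c * q k" using c
        by (intro mult_left_mono) auto
      then show "c * (\<Sum>j<m. w j * (k (h j) - d j (h j))\<^sup>2) \<le> k x - a" using a by (simp add: F_def)
    qed
  next
    assume S: "k \<in> (\<Inter>m. \<Inter>h\<in>H. ?S m h)"
    have "(\<Sum>j<m. w j * (n j k)\<^sup>2) \<le> (k x - a) / c" for m
    proof (rule field_le_epsilon)
      fix e :: real assume e: "e > 0"
      \<comment> \<open>Passing from near-maximal evaluations to squares costs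
        \<open>2 * e' * n j k\<close>, at most \<open>e\<close> because \<open>n j k\<close> is at
        most \<open>2 * L\<close>.\<close>
      define e' where "e' = e / (4 * L)"
      have e': "e' > 0" using e L by (simp add: e'_def)
      have "\<exists>h. h \<in> M \<and> norm h \<le> 1 \<and> n j k - e' \<le> \<bar>k h - d j h\<bar>" for j
        using norm_on_approx[OF M diff_linear[OF k] diff_abs_le[OF k] _ e', of j] L unfolding n_def by auto
      then obtain h where h: "\<And>j. h j \<in> M \<and> norm (h j) \<le> 1 \<and> n j k - e' \<le> \<bar>k (h j) - d j (h j)\<bar>" by metis
      then have "h \<in> H" by (auto simp: H_def)
      then have *: "c * (\<Sum>j<m. w j * (k (h j) - d j (h j))\<^sup>2) \<le> k x - a" using S by blast
      have "w j * (n j k)\<^sup>2 \<le> w j * (k (h j) - d j (h j))\<^sup>2 + w j * e" for j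
      proof -
        have "(n j k)\<^sup>2 - 2 * e' * n j k \<le> (k (h j) - d j (h j))\<^sup>2"
          using h[of j] e' n_nonneg[OF k, of j] by (intro sq_ge_of_near) auto
        moreover have "2 * e' * n j k \<le> 2 * e' * (2 * L)" using n_le[OF k, of j] e'
          by (intro mult_left_mono) auto
        moreover have "2 * e' * (2 * L) = e" using L by (simp add: e'_def)
        ultimately have "(n j k)\<^sup>2 \<le> (k (h j) - d j (h j))\<^sup>2 + e" by linarith
        then have "w j * (n j k)\<^sup>2 \<le> w j * ((k (h j) - d j (h j))\<^sup>2 + e)" using w(1)[of j]
          by (intro mult_left_mono) auto
        then show ?thesis by (simp add: distrib_left)
      qed
      then have "(\<Sum>j<m. w j * (n j k)\<^sup>2) \<le> (\<Sum>j<m. w j * (k (h j) - d j (h j))\<^sup>2) + (\<Sum>j<m. w j) * e"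
        by (simp add: sum_distrib_right sum.distrib[symmetric] sum_mono)
      moreover have "(\<Sum>j<m. w j) * e \<le> 1 * e"
        using sum_le_suminf[of w "{..<m}"] w e by (intro mult_right_mono) (auto simp: sums_iff less_imp_le)
      moreover have "(\<Sum>j<m. w j * (k (h j) - d j (h j))\<^sup>2) \<le> (k x - a) / c"
        using * c by (simp add: pos_le_divide_eq mult.commute)
      ultimately show "(\<Sum>j<m. w j * (n j k)\<^sup>2) \<le> (k x - a) / c + e" by linarith
    qed
    then have "q k \<le> (k x - a) / c" unfolding q_def by (intro suminf_le_const q_summable k)
    then have "c * q k \<le> k x - a" using c by (simp add: pos_le_divide_eq mult.commute)
    then show "a \<le> F x k" by (simp add: F_def)
  qed
  then have "{k \<in> dual_below N. a \<le> F x k} = dual_below N \<inter> (\<Inter>m. \<Inter>h\<in>H. ?S m h)" by blast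
  also have "closed \<dots>"
    by (intro closed_Int closed_INT ballI closed_dual_below closed_Collect_le continuous_intros
        continuous_on_product_coordinates)
  finally show ?thesis .
qed

text \<open>An upper semicontinuous function attains its supremum on a compact set; here nested
  superlevel sets have a common point.\<close>

lemma F_attained: "\<exists>k\<in>dual_below N. F x k = Phi x"
proof -
  define T where "T = (\<lambda>m::nat. {k \<in> dual_below N. Phi x - inverse (Suc m) \<le> F x k})"
  have "dual_below N \<inter> \<Inter>(range T) \<noteq> {}"
  proof (rule compact_imp_fip[OF compact_dual_below])
    fix S assume "S \<in> range T"
    then show "closed S" unfolding T_def using closed_superlevel by auto
  next
    fix S assume "finite S" "S \<subseteq> range T"
    then obtain I where I: "finite I" "S = T ` I" by (meson finite_subset_image)
    obtain m where m: "\<And>i. i \<in> I \<Longrightarrow> i \<le> m" using I(1) finite_nat_set_iff_bounded_le by metis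
    have "Phi x - inverse (Suc m) < Phi x" by simp
    then obtain k where k: "k \<in> dual_below N" "Phi x - inverse (Suc m) < F x k"
      using less_cSUP_iff[OF hahn_banach_sublinear[OF N] F_bdd] unfolding Phi_def by blast
    have "k \<in> T i" if "i \<in> I" for i
    proof -
      have "inverse (real (Suc m)) \<le> inverse (real (Suc i))" using m[OF that]
        by (intro le_imp_inverse_le) auto
      then have "Phi x - inverse (real (Suc i)) \<le> F x k" using k(2) by linarith
      then show ?thesis using k(1) by (simp only: T_def mem_Collect_eq)
    qed
    then have "k \<in> dual_below N \<inter> \<Inter>S" using k(1) I(2) by auto
    then show "dual_below N \<inter> \<Inter>S \<noteq> {}" by blast
  qed
  then obtain k where k: "k \<in> dual_below N" and "\<And>m. k \<in> T m" by blast
  then have *: "Phi x - F x k \<le> inverse (real (Suc m))" for m by (simp add: T_def algebra_simps)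
  have "Phi x - F x k \<le> 0"
  proof (rule ccontr)
    assume "\<not> Phi x - F x k \<le> 0"
    then obtain m where "inverse (real (Suc m)) < Phi x - F x k"
      using reals_Archimedean[of "Phi x - F x k"] by auto
    with *[of m] show False by simp
  qed
  with F_le_Phi[OF k, of x] k show ?thesis by force
qed

lemma strong_max:
  assumes k0: "k0 \<in> dual_below N" "F x k0 = Phi x" and e: "e > 0"
  shows "\<exists>r>0. \<forall>k\<in>dual_below N. Phi x - r \<le> F x k \<longrightarrow> (\<forall>h\<in>M. \<bar>k h - k0 h\<bar> \<le> e * norm h)"
proof -
  obtain j where j: "\<forall>h\<in>M. \<bar>k0 h - d j h\<bar> \<le> e / 3 * norm h" using dense[OF k0(1), of "e / 3"] e by auto
  have A: "n j k0 \<le> e / 3" using j e by (intro n_least k0) auto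
  \<comment> \<open>Chosen so that \<open>c * w j * (n j k0 - n j k)\<^sup>2 / 4\<close> being at
    most \<open>r / 2\<close> means that the two distances to \<open>d j\<close> differ by at most
    \<open>e / 3\<close>.\<close>
  define r where "r = c * w j * (e / 3)\<^sup>2 / 2"
  have "r > 0" using c w(1)[of j] e by (simp add: r_def)
  moreover have "\<bar>k h - k0 h\<bar> \<le> e * norm h"
    if k: "k \<in> dual_below N" and r: "Phi x - r \<le> F x k" and h: "h \<in> M" for k h
  proof -
    \<comment> \<open>The midpoint is admissible, so its value is at most \<open>Phi x\<close>. As
      \<open>k0\<close> and \<open>k\<close> almost attain \<open>Phi x\<close>, the total convexity
      defect of \<open>q\<close> is small, and so is its \<open>j\<close>-th term.\<close>
    define m where "m = (\<lambda>h. (k0 h + k h) / 2)"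
    have m: "m \<in> dual_below N"
    proof -
      have "linear m"
        unfolding m_def using linear_add[OF dual_below_linear[OF k]] linear_add[OF dual_below_linear[OF k0(1)]]
          linear_scale[OF dual_below_linear[OF k]] linear_scale[OF dual_below_linear[OF k0(1)]]
        by (intro linearI) (auto simp: field_simps)
      moreover have "m y \<le> N y" for y
        using dual_below_le[OF k, of y] dual_below_le[OF k0(1), of y] by (simp add: m_def)
      ultimately show ?thesis by (simp add: dual_below_def)
    qed
    have nm: "n i m \<le> (n i k0 + n i k) / 2" for i
    proof (rule n_least[OF m])
      fix h assume h: "h \<in> M"
      have "m h - d i h = ((k0 h - d i h) + (k h - d i h)) / 2" by (simp add: m_def field_simps)
      then have "\<bar>m h - d i h\<bar> \<le> (\<bar>k0 h - d i h\<bar> + \<bar>k h - d i h\<bar>) / 2"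
        using abs_triangle_ineq[of "k0 h - d i h" "k h - d i h"] by (simp only: abs_divide) simp
      also have "\<dots> \<le> (n i k0 * norm h + n i k * norm h) / 2"
        using n_bound[OF k h, of i] n_bound[OF k0(1) h, of i] by simp
      finally show "\<bar>m h - d i h\<bar> \<le> (n i k0 + n i k) / 2 * norm h" by (simp add: field_simps)
    qed (use n_nonneg[OF k] n_nonneg[OF k0(1)] in simp)
    define defect where "defect = (\<lambda>i. 1/2 * (w i * (n i k0)\<^sup>2) + 1/2 * (w i * (n i k)\<^sup>2) - w i * (n i m)\<^sup>2)"
    have defect: "w i * ((n i k0 - n i k)\<^sup>2 / 4) \<le> defect i" for i
    proof -
      have "(n i m)\<^sup>2 \<le> ((n i k0 + n i k) / 2)\<^sup>2" using nm n_nonneg[OF m] by (intro power_mono) auto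
      also have "\<dots> = 1/2 * (n i k0)\<^sup>2 + 1/2 * (n i k)\<^sup>2 - (n i k0 - n i k)\<^sup>2 / 4"
        by (simp add: power2_eq_square field_simps)
      finally have "(n i k0 - n i k)\<^sup>2 / 4 \<le> 1/2 * (n i k0)\<^sup>2 + 1/2 * (n i k)\<^sup>2 - (n i m)\<^sup>2" by simp
      then have "w i * ((n i k0 - n i k)\<^sup>2 / 4) \<le> w i * (1/2 * (n i k0)\<^sup>2 + 1/2 * (n i k)\<^sup>2 - (n i m)\<^sup>2)"
        using w(1)[of i] by (intro mult_left_mono) auto
      also have "\<dots> = defect i" by (simp add: defect_def algebra_simps)
      finally show ?thesis .
    qed
    have nonneg: "0 \<le> defect i" for i
      using defect[of i] w(1)[of i] by (smt (verit) mult_nonneg_nonneg zero_le_divide_iff zero_le_power2)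
    have sums: "defect sums (1/2 * q k0 + 1/2 * q k - q m)"
      unfolding defect_def q_def by (intro sums_diff sums_add sums_mult summable_sums q_summable k k0 m)
    have "sum defect {j} \<le> suminf defect" using nonneg sums by (intro sum_le_suminf) (auto simp: sums_iff)
    then have "defect j \<le> 1/2 * q k0 + 1/2 * q k - q m" using sums by (simp add: sums_iff)
    then have "c * defect j \<le> c * (1/2 * q k0 + 1/2 * q k - q m)" using c by (intro mult_left_mono) auto
    also have "\<dots> = F x m - (F x k0 + F x k) / 2" by (simp add: F_def m_def field_simps)
    also have "\<dots> \<le> r / 2" using F_le_Phi[OF m, of x] k0(2) r by (simp add: field_simps)
    finally have "c * defect j \<le> r / 2" .
    moreover have "c * (w j * ((n j k0 - n j k)\<^sup>2 / 4)) \<le> c * defect j"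
      using defect c by (intro mult_left_mono) auto
    ultimately have "(c * w j / 4) * (n j k0 - n j k)\<^sup>2 \<le> (c * w j / 4) * (e / 3)\<^sup>2" by (simp add: r_def)
    then have "(n j k0 - n j k)\<^sup>2 \<le> (e / 3)\<^sup>2"
      using c w(1)[of j] by (subst (asm) mult_le_cancel_left_pos) auto
    then have "\<bar>n j k0 - n j k\<bar> \<le> e / 3" using e by (subst (asm) abs_le_square_iff[symmetric]) auto
    then have B: "n j k \<le> 2 * e / 3" using A by linarith
    have "\<bar>k h - k0 h\<bar> \<le> \<bar>k h - d j h\<bar> + \<bar>k0 h - d j h\<bar>" by linarith
    also have "\<dots> \<le> n j k * norm h + n j k0 * norm h"
      using n_bound[OF k h, of j] n_bound[OF k0(1) h, of j] by simp
    also have "\<dots> = (n j k + n j k0) * norm h" by (simp add: algebra_simps)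
    also have "\<dots> \<le> e * norm h" using A B by (intro mult_right_mono) auto
    finally show ?thesis .
  qed
  ultimately show ?thesis by blast
qed

text \<open>A maximiser \<open>k\<close> at \<open>x + h\<close> loses at most
  \<open>2 * L * norm h\<close> as a competitor at \<open>x\<close>. For small \<open>h\<close> it
  is therefore an almost maximiser at \<open>x\<close>, and \<open>strong_max\<close> puts it within
  \<open>e\<close> of \<open>k0\<close> on \<open>M\<close>. Then \<open>k h\<close> may be replaced
  by \<open>k0 h\<close> at cost \<open>e * norm h\<close>.\<close>

lemma Phi_smooth:
  "\<exists>k\<in>dual_below N. \<forall>e>0. \<exists>r>0. \<forall>h\<in>M. norm h < r \<longrightarrow> Phi (x + h) \<le> Phi x + k h + e * norm h"
proof -
  obtain k0 where k0: "k0 \<in> dual_below N" "F x k0 = Phi x" using F_attained by blast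
  have "\<exists>r>0. \<forall>h\<in>M. norm h < r \<longrightarrow> Phi (x + h) \<le> Phi x + k0 h + e * norm h" if e: "e > 0" for e
  proof -
    obtain r where r: "r > 0" and rk: "\<And>k h. k \<in> dual_below N \<Longrightarrow> Phi x - r \<le> F x k \<Longrightarrow> h \<in> M
        \<Longrightarrow> \<bar>k h - k0 h\<bar> \<le> e * norm h"
      using strong_max[OF k0 e] by blast
    have "Phi (x + h) \<le> Phi x + k0 h + e * norm h" if h: "h \<in> M" "norm h < r / (2 * L)" for h
    proof -
      obtain k where k: "k \<in> dual_below N" "F (x + h) k = Phi (x + h)" using F_attained by blast
      have "Phi x \<le> Phi (x + h) + N (- h)" using Phi_shift[of "x + h" "- h"] by simp
      moreover have "N (- h) \<le> L * norm h" using NL[of "- h"] by simp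
      moreover have "k h \<le> L * norm h" using abs_le[OF k(1), of h] by simp
      moreover have "2 * (L * norm h) < r" using h(2) L by (simp add: field_simps)
      moreover have eq: "Phi (x + h) = F x k + k h" using k(2) F_shift[OF k(1)] by simp
      ultimately have "Phi x - r \<le> F x k" by linarith
      then have "\<bar>k h - k0 h\<bar> \<le> e * norm h" using rk k(1) h(1) by blast
      then show ?thesis using eq F_le_Phi[OF k(1), of x] by linarith
    qed
    moreover have "r / (2 * L) > 0" using r L by simp
    ultimately show ?thesis by blast
  qed
  then show ?thesis using k0(1) by blast
qed

end

text \<open>Only the upper half of Frechet differentiability along \<open>M\<close> is recorded. At
  a minimum of \<open>f\<close> plus a perturbation, an upper estimate for the perturbation is a
  lower estimate for \<open>f\<close>. The functional \<open>N\<close> bounds both the increments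
  and the derivatives.\<close>

definition smooth_on :: "'c::real_normed_vector set \<Rightarrow> ('c \<Rightarrow> real) \<Rightarrow> ('c \<Rightarrow> real) \<Rightarrow> bool" where
  "smooth_on M N p \<longleftrightarrow> (\<forall>x h. p (x + h) \<le> p x + N h) \<and>
     (\<forall>x. \<exists>k\<in>dual_below N. \<forall>e>0. \<exists>r>0. \<forall>h\<in>M. norm h < r \<longrightarrow> p (x + h) \<le> p x + k h + e * norm h)"

text \<open>Separability of the dual supplies the sequence needed for \<open>smoothing\<close>: nets
  for the unit ball with errors \<open>1 / (m + 1)\<close>, scaled by \<open>L'\<close>. The scaled
  functionals need not lie below \<open>N\<close>, which is why the locale asks only for the bound
  by a multiple of the norm. Estimates pass from \<open>Q\<close> to \<open>M\<close> by
  continuity.\<close>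

lemma smooth_approximation:
  fixes N :: "'c::real_normed_vector \<Rightarrow> real"
  assumes sep: "separable_dual TYPE('c)" and Q: "countable Q" and M: "subspace M" "M \<subseteq> closure Q"
    and N: "sublinear N" and NL: "\<And>x. N x \<le> L * norm x" and eta: "eta > 0"
  shows "\<exists>p. smooth_on M N p \<and> (\<forall>x. N x - eta \<le> p x \<and> p x \<le> N x)"
proof -
  define L' where "L' = max L 1"
  have L': "L' > 0" "N x \<le> L' * norm x" for x
    using NL[of x] mult_right_mono[of L L' "norm x"] by (auto simp: L'_def intro: order_trans)
  have "\<exists>D. countable D \<and> D \<subseteq> dual_below norm \<and>
       (\<forall>k\<in>dual_below norm. \<exists>d\<in>D. \<forall>h\<in>Q. \<bar>k h - d h\<bar> \<le> inverse (Suc m) * norm h)" for m :: nat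
    using sep[unfolded separable_dual_def] Q by simp
  then obtain D where D: "\<And>m. countable (D m)" "\<And>m. D m \<subseteq> dual_below norm"
    and Dk: "\<And>m k. k \<in> dual_below norm \<Longrightarrow> \<exists>d\<in>D m. \<forall>h\<in>Q. \<bar>k h - d h\<bar> \<le> inverse (Suc m) * norm h" by metis
  define E where "E = (\<lambda>k h. L' * k h) ` (\<Union>m. D m)"
  have lip: "continuous_on UNIV k" if "k \<in> dual_below norm" for k :: "'c \<Rightarrow> real"
    using dual_below_linear[OF that] dual_below_abs_le[OF that]
    by (intro linear_continuous_on bounded_linear_intro[of _ 1]) (auto simp: linear_add linear_scale)
  have E: "\<exists>d\<in>E. \<forall>h\<in>M. \<bar>k h - d h\<bar> \<le> e * norm h" if k: "k \<in> dual_below N" and e: "e > 0" for k e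
  proof -
    define k' where "k' = (\<lambda>h. k h / L')"
    have k': "k' \<in> dual_below norm"
    proof -
      have "linear k'" unfolding k'_def
        using linear_add[OF dual_below_linear[OF k]] linear_scale[OF dual_below_linear[OF k]]
        by (intro linearI) (auto simp: add_divide_distrib)
      moreover have "k' x \<le> norm x" for x
        using order_trans[OF dual_below_le[OF k, of x] L'(2)] L'(1) by (simp add: k'_def field_simps)
      ultimately show ?thesis by (simp add: dual_below_def)
    qed
    obtain m where m: "inverse (real (Suc m)) < e / L'" using reals_Archimedean[of "e / L'"] e L'(1) by auto
    obtain d where d: "d \<in> D m" "\<forall>h\<in>Q. \<bar>k' h - d h\<bar> \<le> inverse (Suc m) * norm h" using Dk[OF k'] by blast
    have d': "d \<in> dual_below norm" using D(2) d(1) by blast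
    have "closed {h. \<bar>k' h - d h\<bar> \<le> inverse (Suc m) * norm h}"
      by (intro closed_Collect_le continuous_intros lip k' d')
    then have "closure Q \<subseteq> {h. \<bar>k' h - d h\<bar> \<le> inverse (Suc m) * norm h}"
      using d(2) by (intro closure_minimal) auto
    then have *: "\<bar>k' h - d h\<bar> \<le> inverse (Suc m) * norm h" if "h \<in> M" for h using M(2) that by blast
    have "\<bar>k h - L' * d h\<bar> \<le> e * norm h" if h: "h \<in> M" for h
    proof -
      have "k h - L' * d h = L' * (k' h - d h)"
        using L'(1) by (simp add: k'_def right_diff_distrib)
      then have "\<bar>k h - L' * d h\<bar> = L' * \<bar>k' h - d h\<bar>"
        using L'(1) by (simp add: abs_mult)
      also have "\<dots> \<le> L' * (e / L' * norm h)"
        using *[OF h] m L'(1) by (intro mult_left_mono order_trans[OF *[OF h]] mult_right_mono) auto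
      finally show ?thesis using L'(1) by simp
    qed
    moreover have "(\<lambda>h. L' * d h) \<in> E" unfolding E_def using d(1) by (intro imageI UN_I[of m]) auto
    ultimately show ?thesis by (intro bexI[of _ "\<lambda>h. L' * d h"] ballI)
  qed
  have "E \<noteq> {}" using E[of _ 1] hahn_banach_sublinear[OF N] by fastforce
  moreover have "countable E" unfolding E_def using D(1) by simp
  ultimately have r: "range (from_nat_into E) = E" by (rule range_from_nat_into)
  have "from_nat_into E j \<in> dual_below (\<lambda>x. L' * norm x)" for j
  proof -
    have "from_nat_into E j \<in> E" using r by blast
    then obtain k where k: "k \<in> dual_below norm" "from_nat_into E j = (\<lambda>h. L' * k h)" unfolding E_def using D(2) by blast
    have "linear (\<lambda>h. L' * k h)"
      using linear_add[OF dual_below_linear[OF k(1)]] linear_scale[OF dual_below_linear[OF k(1)]]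
      by (intro linearI) (auto simp: algebra_simps)
    then show ?thesis using k dual_below_le[OF k(1)] L'(1) by (simp add: dual_below_def)
  qed
  moreover have "\<exists>j. \<forall>h\<in>M. \<bar>k h - from_nat_into E j h\<bar> \<le> e * norm h"
    if ke: "k \<in> dual_below N" "e > 0" for k e
    using E[OF ke] r by (metis imageE)
  ultimately interpret smoothing N L' M "from_nat_into E" eta
    using N L' M(1) eta by unfold_locales auto
  show ?thesis
    using Phi_smooth Phi_shift Phi_ge Phi_le unfolding smooth_on_def by blast
qed

section \<open>A smooth variational principle\<close>

lemma geometric_steps_Cauchy:
  fixes a :: "nat \<Rightarrow> 'c::metric_space"
  assumes step: "\<And>i. dist (a (Suc i)) (a i) \<le> s * (1 / 2) ^ Suc i" and s: "s \<ge> 0"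
  shows "Cauchy a" and "dist (a n) (a 0) \<le> s"
proof -
  have *: "dist (a (n + k)) (a n) \<le> s * ((1 / 2) ^ n - (1 / 2) ^ (n + k))" for n k
  proof (induction k)
    case (Suc k)
    have "dist (a (n + Suc k)) (a n) \<le> dist (a (Suc (n + k))) (a (n + k)) + dist (a (n + k)) (a n)"
      using dist_triangle[of "a (n + Suc k)" "a n" "a (n + k)"] by simp
    also have "\<dots> \<le> s * (1 / 2) ^ Suc (n + k) + s * ((1 / 2) ^ n - (1 / 2) ^ (n + k))"
      using step[of "n + k"] Suc.IH by simp
    also have "\<dots> = s * ((1 / 2) ^ n - (1 / 2) ^ (n + Suc k))" by (simp add: algebra_simps)
    finally show ?case .
  qed simp
  have le: "dist (a m) (a n) \<le> s * (1 / 2) ^ n" if "n \<le> m" for m n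
  proof -
    have "dist (a m) (a n) \<le> s * ((1 / 2) ^ n - (1 / 2) ^ m)" using *[of n "m - n"] that by simp
    also have "\<dots> \<le> s * (1 / 2) ^ n" using s by (intro mult_left_mono) auto
    finally show ?thesis .
  qed
  from le[of 0 n] show "dist (a n) (a 0) \<le> s" by simp
  show "Cauchy a"
  proof (rule metric_CauchyI)
    fix e :: real assume e: "e > 0"
    have "(\<lambda>n. s * (1 / 2) ^ n) \<longlonglongrightarrow> s * 0" by (intro tendsto_intros LIMSEQ_power_zero) auto
    then have "eventually (\<lambda>n. s * (1 / 2) ^ n < e / 2) sequentially"
      using e by (intro order_tendstoD) auto
    then obtain n where n: "s * (1 / 2) ^ n < e / 2" by (auto simp: eventually_sequentially)
    have "dist (a i) (a j) < e" if "n \<le> i" "n \<le> j" for i j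
      using dist_triangle2[of "a i" "a j" "a n"] le[OF that(1)] le[OF that(2)] n
      by linarith
    then show "\<exists>n. \<forall>i\<ge>n. \<forall>j\<ge>n. dist (a i) (a j) < e" by blast
  qed
qed

text \<open>A Borwein-Preiss argument: penalties centred at successive approximate minimisers are
  added to \<open>B\<close>. The step from \<open>a n\<close> to \<open>a (Suc n)\<close> satisfies
  \<open>kap n * dist (a (Suc n)) (a n) <= 3 * eta n\<close>. One \<open>eta n\<close> comes from
  near-minimality of \<open>a n\<close>, one from the value of \<open>p n\<close> at 0, and one from
  near-minimality of \<open>a (Suc n)\<close>. This is the origin of the 3 in \<open>eta\<close>,
  and it makes the steps geometric with total length at most \<open>s\<close>.\<close>

lemma perturbed_minimum:
  fixes B :: "'c::real_normed_vector \<Rightarrow> real" and p :: "nat \<Rightarrow> 'c \<Rightarrow> real"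
  assumes compl: "complete (UNIV :: 'c set)" and z: "z \<in> D"
    and lsc: "\<And>X x C. (\<And>n. X n \<in> D) \<Longrightarrow> X \<longlonglongrightarrow> x \<Longrightarrow>
      (\<And>e. e > 0 \<Longrightarrow> eventually (\<lambda>n. B (X n) \<le> C + e) sequentially) \<Longrightarrow> x \<in> D \<and> B x \<le> C"
    and s: "s > 0" and kap: "\<And>i. kap i > 0" "\<And>i. kap (Suc i) \<le> kap i" "summable kap"
    and eta_def: "\<And>i. eta i = kap i * (s * (1 / 2) ^ Suc i) / 3"
    and p_ge: "\<And>i h. kap i * norm h \<le> p i h" and p_le: "\<And>i h. p i h \<le> kap i * norm h + eta i"
    and p_shift: "\<And>i x h. p i (x + h) \<le> p i x + kap i * norm h"
    and min: "\<And>x. x \<in> D \<Longrightarrow> B z \<le> B x + eta 0"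
  shows "\<exists>u\<in>D. \<exists>a. dist u z \<le> s \<and> (\<forall>x. summable (\<lambda>i. p i (x - a i))) \<and>
    (\<forall>x\<in>D. B u + (\<Sum>i. p i (u - a i)) \<le> B x + (\<Sum>i. p i (x - a i)))"
proof -
  have eta_pos: "eta i > 0" for i using kap(1)[of i] s by (simp add: eta_def)
  have eta_le: "eta i \<le> kap i * s" for i
  proof -
    have "(1 / 2 :: real) ^ Suc i \<le> 1" by (intro power_le_one) auto
    then have "s * (1 / 2) ^ Suc i \<le> s * 1" using s by (intro mult_left_mono) auto
    then have "kap i * (s * (1 / 2) ^ Suc i) \<le> kap i * s" using kap(1)[of i] by (intro mult_left_mono) auto
    moreover have "0 \<le> kap i * s" using kap(1)[of i] s by simp
    ultimately show ?thesis unfolding eta_def by linarith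
  qed
  have eta_dec: "eta (Suc i) \<le> eta i" for i
  proof -
    have "kap (Suc i) * (s * (1 / 2) ^ Suc (Suc i)) \<le> kap i * (s * (1 / 2) ^ Suc i)"
      using kap(1)[of "Suc i"] kap(2)[of i] s by (intro mult_mono) (auto simp: less_imp_le)
    then show ?thesis by (simp add: eta_def)
  qed
  have p0: "0 \<le> p i h" for i h
    using p_ge[of i h] kap(1)[of i] by (smt (verit) mult_nonneg_nonneg norm_ge_zero)
  \<comment> \<open>A state consists of the function perturbed so far and an approximate minimiser
    of it; \<open>R\<close> adds the penalty centred at that point.\<close>
  define P where "P = (\<lambda>n (F, a). a \<in> D \<and> (\<forall>x\<in>D. F a \<le> F x + eta n))"
  define R where "R = (\<lambda>n (F, a) (F', a' :: 'c). F' = (\<lambda>x. F x + p n (x - a)))"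
  have "\<exists>S. \<forall>n. (P n (S n) \<and> (n = 0 \<longrightarrow> S n = (B, z))) \<and> R n (S n) (S (Suc n))"
  proof (rule dependent_nat_choice)
    show "\<exists>S. P 0 S \<and> (0 = (0::nat) \<longrightarrow> S = (B, z))" using z min by (auto simp: P_def)
  next
    fix S n assume S: "P n S \<and> (n = 0 \<longrightarrow> S = (B, z))"
    obtain F a where Fa: "S = (F, a)" by (cases S)
    define F' where "F' = (\<lambda>x. F x + p n (x - a))"
    have a: "a \<in> D" and Fa': "\<And>x. x \<in> D \<Longrightarrow> F a \<le> F x + eta n" using S by (auto simp: P_def Fa)
    have bdd: "bdd_below (F' ` D)"
      using Fa' p0 by (intro bdd_belowI2[of _ "F a - eta n"]) (smt (verit) F'_def)
    have "(INF x\<in>D. F' x) < (INF x\<in>D. F' x) + eta (Suc n)" using eta_pos by simp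
    then obtain a' where a': "a' \<in> D" "F' a' < (INF x\<in>D. F' x) + eta (Suc n)"
      using cINF_less_iff[OF _ bdd] z by blast
    have "F' a' \<le> F' x + eta (Suc n)" if "x \<in> D" for x
      using a'(2) cINF_lower[OF bdd that] by linarith
    then have "P (Suc n) (F', a')" using a'(1) by (auto simp: P_def)
    then show "\<exists>S'. (P (Suc n) S' \<and> (Suc n = 0 \<longrightarrow> S' = (B, z))) \<and> R n S S'"
      by (intro exI[of _ "(F', a')"]) (auto simp: R_def Fa F'_def)
  qed
  then obtain S where "\<And>n. P n (S n)" "S 0 = (B, z)" "\<And>n. R n (S n) (S (Suc n))" by blast
  then have S: "\<And>n. P n (S n)" "fst (S 0) = B" "snd (S 0) = z" "\<And>n. R n (S n) (S (Suc n))" by auto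
  define F where "F = (\<lambda>n. fst (S n))"
  define a where "a = (\<lambda>n. snd (S n))"
  have a: "a n \<in> D" "x \<in> D \<Longrightarrow> F n (a n) \<le> F n x + eta n" for n x
    using S(1)[of n] by (auto simp: P_def F_def a_def case_prod_beta)
  have F0: "F 0 = B" "a 0 = z" using S(2,3) by (auto simp: F_def a_def)
  have FS: "F (Suc n) x = F n x + p n (x - a n)" for n x
    using S(4)[of n] by (simp add: R_def F_def a_def case_prod_beta)
  have step: "dist (a (Suc n)) (a n) \<le> s * (1 / 2) ^ Suc n" for n
  proof -
    have "F (Suc n) (a (Suc n)) \<le> F (Suc n) (a n) + eta (Suc n)" by (intro a)
    moreover have "F (Suc n) (a n) \<le> F n (a n) + eta n" using p_le[of n 0] by (simp add: FS)
    moreover have "F n (a n) + kap n * norm (a (Suc n) - a n) \<le> F (Suc n) (a (Suc n)) + eta n"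
      using a(2)[of "a (Suc n)" n] a(1) p_ge[of n "a (Suc n) - a n"] by (simp add: FS)
    ultimately have "kap n * norm (a (Suc n) - a n) \<le> 3 * eta n" using eta_dec[of n] by linarith
    also have "\<dots> = kap n * (s * (1 / 2) ^ Suc n)" by (simp add: eta_def)
    finally show ?thesis using kap(1)[of n] by (subst (asm) mult_le_cancel_left_pos) (auto simp: dist_norm)
  qed
  note geo = geometric_steps_Cauchy[of a s, OF step]
  have "Cauchy a" using geo(1) s by simp
  then obtain u where u: "a \<longlonglongrightarrow> u" using compl unfolding complete_def by blast
  have az: "dist (a n) z \<le> s" for n using geo(2)[of n] s F0 by simp
  have uz: "dist u z \<le> s"
    by (rule tendsto_upperbound[OF tendsto_dist[OF u tendsto_const]]) (use az in auto)
  have Fsum: "F n x = B x + (\<Sum>i<n. p i (x - a i))" for n x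
    by (induction n) (auto simp: F0 FS)
  have summ: "summable (\<lambda>i. p i (x - a i))" for x
  proof (rule summable_comparison_test')
    show "summable (\<lambda>i. kap i * (norm (x - z) + s + s))" using kap(3) by (intro summable_mult2)
    fix i
    have "norm (x - a i) \<le> norm (x - z) + s"
      using dist_triangle[of x "a i" z] az[of i] by (simp add: dist_norm norm_minus_commute)
    then have "kap i * norm (x - a i) \<le> kap i * (norm (x - z) + s)" using kap(1)[of i]
      by (intro mult_left_mono) auto
    then have "p i (x - a i) \<le> kap i * (norm (x - z) + s) + kap i * s"
      using p_le[of i "x - a i"] eta_le[of i] by linarith
    then show "norm (p i (x - a i)) \<le> kap i * (norm (x - z) + s + s)"
      using p0[of i] by (simp add: algebra_simps)
  qed
  have cont: "(\<lambda>m. p i (a m - a i)) \<longlonglongrightarrow> p i (u - a i)" for i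
  proof (rule tendsto_sandwich)
    show "eventually (\<lambda>m. p i (u - a i) - kap i * norm (u - a m) \<le> p i (a m - a i)) sequentially"
      using p_shift[of i "a m - a i" "u - a m" for m]
        by (intro always_eventually) (auto simp: algebra_simps)
    show "eventually (\<lambda>m. p i (a m - a i) \<le> p i (u - a i) + kap i * norm (a m - u)) sequentially"
      using p_shift[of i "u - a i" "a m - u" for m] by (intro always_eventually) (auto simp: algebra_simps)
    have "(\<lambda>m. p i (u - a i) - kap i * norm (u - a m)) \<longlonglongrightarrow> p i (u - a i) - kap i * norm (u - u)"
      by (intro tendsto_intros u)
    then show "(\<lambda>m. p i (u - a i) - kap i * norm (u - a m)) \<longlonglongrightarrow> p i (u - a i)" by simp
    have "(\<lambda>m. p i (u - a i) + kap i * norm (a m - u)) \<longlonglongrightarrow> p i (u - a i) + kap i * norm (u - u)"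
      by (intro tendsto_intros u)
    then show "(\<lambda>m. p i (u - a i) + kap i * norm (a m - u)) \<longlonglongrightarrow> p i (u - a i)" by simp
  qed
  have eta0: "eta \<longlonglongrightarrow> 0"
  proof (rule tendsto_sandwich)
    show "eventually (\<lambda>n. 0 \<le> eta n) sequentially" using eta_pos by (simp add: less_imp_le)
    show "eventually (\<lambda>n. eta n \<le> kap n * s) sequentially" using eta_le by simp
    show "(\<lambda>n. kap n * s) \<longlonglongrightarrow> 0" using tendsto_mult_left_zero[OF summable_LIMSEQ_zero[OF kap(3)]] .
  qed simp
  \<comment> \<open>The full series need not be handled along the sequence: only the first
    \<open>n\<close> penalties, continuous along \<open>a\<close>, are kept on the left, and
    nonnegativity discards the others. Afterwards \<open>n\<close> tends to infinity at the fixed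
    point \<open>u\<close>.\<close>
  have partial: "u \<in> D \<and> B u \<le> B x + (\<Sum>i. p i (x - a i)) - (\<Sum>i<n. p i (u - a i))" if x: "x \<in> D" for x n
  proof (rule lsc[OF a(1) u])
    fix e :: real assume e: "e > 0"
    have "(\<lambda>m. eta m - (\<Sum>i<n. p i (a m - a i))) \<longlonglongrightarrow> 0 - (\<Sum>i<n. p i (u - a i))"
      by (intro tendsto_intros eta0 cont)
    then have "eventually (\<lambda>m. eta m - (\<Sum>i<n. p i (a m - a i)) < - (\<Sum>i<n. p i (u - a i)) + e) sequentially"
      using e by (intro order_tendstoD) auto
    moreover have "eventually (\<lambda>m. n \<le> m) sequentially" by (rule eventually_ge_at_top)
    ultimately show "eventually (\<lambda>m. B (a m) \<le>
        B x + (\<Sum>i. p i (x - a i)) - (\<Sum>i<n. p i (u - a i)) + e) sequentially"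
    proof eventually_elim
      case (elim m)
      have "(\<Sum>i<n. p i (a m - a i)) \<le> (\<Sum>i<m. p i (a m - a i))"
        using elim(2) p0 by (intro sum_mono2) auto
      moreover have "F m (a m) \<le> F m x + eta m" by (rule a(2)[OF x])
      moreover have "(\<Sum>i<m. p i (x - a i)) \<le> (\<Sum>i. p i (x - a i))"
        using p0 by (intro sum_le_suminf summ) auto
      ultimately show ?case using elim(1) by (simp add: Fsum)
    qed
  qed
  have uD: "u \<in> D" using partial[OF z] by simp
  have "B u + (\<Sum>i. p i (u - a i)) \<le> B x + (\<Sum>i. p i (x - a i))" if x: "x \<in> D" for x
  proof -
    have "(\<Sum>i. p i (u - a i)) \<le> B x + (\<Sum>i. p i (x - a i)) - B u"
      using partial[OF x] by (intro suminf_le_const summ) (simp add: algebra_simps)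
    then show ?thesis by simp
  qed
  then show ?thesis using uD uz az summ by blast
qed

text \<open>Termwise differentiation: the increment of the tail of the series and the tail of the
  derivative are both controlled by the tail of the summable Lipschitz constants
  \<open>kap\<close>.\<close>

lemma perturbation_smooth:
  fixes N :: "'c::real_normed_vector \<Rightarrow> real" and p :: "nat \<Rightarrow> 'c \<Rightarrow> real"
    and a :: "nat \<Rightarrow> 'c" and z :: 'c
  assumes p0: "smooth_on M N p0" and p: "\<And>i. smooth_on M (\<lambda>x. kap i * norm x) (p i)"
    and kap: "\<And>i. kap i > 0" "kap sums K" and summ: "\<And>x. summable (\<lambda>i. p i (x - a i))"
  defines "Psi \<equiv> \<lambda>x. p0 (x - z) + (\<Sum>i. p i (x - a i))"
  shows "Psi (x + h) \<le> Psi x + (N h + K * norm h)"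
    and "\<exists>k\<in>dual_below (\<lambda>x. N x + K * norm x). \<forall>e>0. \<exists>r>0. \<forall>h\<in>M. norm h < r \<longrightarrow>
      Psi (x + h) \<le> Psi x + k h + e * norm h"
proof -
  have p0_shift: "p0 (x + h) \<le> p0 x + N h" for x h using p0 by (simp add: smooth_on_def)
  have p_shift: "p i (x + h) \<le> p i x + kap i * norm h" for i x h using p by (simp add: smooth_on_def)
  have kap_tail: "summable (\<lambda>i. kap (i + n) * c)" for n c
    using kap(2) by (intro summable_mult2 summable_ignore_initial_segment) (auto simp: sums_iff)
  have p_tail: "summable (\<lambda>i. p (i + n) (y - a (i + n)))" for y n
    using summable_ignore_initial_segment[OF summ[of y], of n] .
  have tail: "(\<Sum>i. p (i + n) (x + h - a (i + n))) \<le>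
      (\<Sum>i. p (i + n) (x - a (i + n))) + (\<Sum>i. kap (i + n)) * norm h" for n h
  proof -
    have "(\<Sum>i. p (i + n) (x + h - a (i + n))) \<le> (\<Sum>i. p (i + n) (x - a (i + n)) + kap (i + n) * norm h)"
    proof (rule suminf_le)
      show "p (i + n) (x + h - a (i + n)) \<le> p (i + n) (x - a (i + n)) + kap (i + n) * norm h" for i
        using p_shift[of "i + n" "x - a (i + n)" h] by (simp add: algebra_simps)
      show "summable (\<lambda>i. p (i + n) (x + h - a (i + n)))"
        by (rule p_tail)
      show "summable (\<lambda>i. p (i + n) (x - a (i + n)) + kap (i + n) * norm h)"
        by (rule summable_add[OF p_tail kap_tail])
    qed
    also have "\<dots> = (\<Sum>i. p (i + n) (x - a (i + n))) + (\<Sum>i. kap (i + n) * norm h)"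
      by (rule suminf_add[OF p_tail kap_tail, symmetric])
    also have "(\<Sum>i. kap (i + n) * norm h) = (\<Sum>i. kap (i + n)) * norm h"
      using kap_tail[of n 1] by (intro suminf_mult2[symmetric]) simp
    finally show ?thesis .
  qed
  show "Psi (x + h) \<le> Psi x + (N h + K * norm h)"
    using tail[of 0 h] p0_shift[of "x - z" h] kap(2) unfolding Psi_def
    by (simp add: algebra_simps sums_iff)
  obtain k0 where k0: "k0 \<in> dual_below N" and k0r: "\<forall>e>0. \<exists>r>0. \<forall>h\<in>M. norm h < r \<longrightarrow>
      p0 (x - z + h) \<le> p0 (x - z) + k0 h + e * norm h"
    using p0[unfolded smooth_on_def, THEN conjunct2, THEN spec, of "x - z"] by (elim bexE)
  have "\<forall>i. \<exists>k\<in>dual_below (\<lambda>x. kap i * norm x). \<forall>e>0. \<exists>r>0. \<forall>h\<in>M. norm h < r \<longrightarrow>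
      p i (x - a i + h) \<le> p i (x - a i) + k h + e * norm h" (is "\<forall>i. ?X i")
  proof
    fix i
    show "?X i" by (rule p[unfolded smooth_on_def, THEN conjunct2, THEN spec])
  qed
  from choice[OF this[unfolded Bex_def]]
  obtain k where k: "\<And>i. k i \<in> dual_below (\<lambda>x. kap i * norm x)"
    and kr: "\<And>i. \<forall>e>0. \<exists>r>0. \<forall>h\<in>M. norm h < r \<longrightarrow> p i (x - a i + h) \<le> p i (x - a i) + k i h + e * norm h"
    by blast
  have kabs: "\<bar>k i h\<bar> \<le> kap i * norm h" for i h by (rule dual_below_abs_le[OF k]) simp
  have ksum: "summable (\<lambda>i. k i h)" for h
  proof (rule summable_comparison_test'[where g = "\<lambda>i. kap i * norm h" and N = 0])
    show "summable (\<lambda>i. kap i * norm h)" using kap_tail[of 0 "norm h"] by simp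
    show "norm (k i h) \<le> kap i * norm h" for i using kabs[of i h] by simp
  qed
  define kk where "kk = (\<lambda>h. k0 h + (\<Sum>i. k i h))"
  have "kk \<in> dual_below (\<lambda>x. N x + K * norm x)"
  proof -
    have "linear kk"
    proof (rule linearI)
      fix x y :: 'c and t :: real
      show "kk (x + y) = kk x + kk y"
        unfolding kk_def linear_add[OF dual_below_linear[OF k]] linear_add[OF dual_below_linear[OF k0]]
        using suminf_add[OF ksum[of x] ksum[of y]] by simp
      show "kk (t *\<^sub>R x) = t *\<^sub>R kk x"
        unfolding kk_def linear_scale[OF dual_below_linear[OF k]] linear_scale[OF dual_below_linear[OF k0]]
        using suminf_mult[OF ksum[of x], of t] by (simp add: distrib_left)
    qed
    moreover have "(\<Sum>i. k i h) \<le> K * norm h" for h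
    proof -
      have "(\<Sum>i. k i h) \<le> (\<Sum>i. kap i * norm h)"
      proof (rule suminf_le[OF _ ksum])
        show "k i h \<le> kap i * norm h" for i using kabs[of i h] by simp
        show "summable (\<lambda>i. kap i * norm h)" using kap_tail[of 0 "norm h"] by simp
      qed
      also have "\<dots> = K * norm h" using kap(2) suminf_mult2[of kap "norm h"] by (simp add: sums_iff)
      finally show ?thesis .
    qed
    ultimately show ?thesis
      using dual_below_le[OF k0] by (auto simp: dual_below_def kk_def intro: add_mono)
  qed
  moreover have "\<exists>r>0. \<forall>h\<in>M. norm h < r \<longrightarrow> Psi (x + h) \<le> Psi x + kk h + e * norm h" if e: "e > 0" for e
  proof -
    obtain n where n: "\<bar>\<Sum>i. kap (i + n)\<bar> < e / 4"
      using suminf_exist_split[of "e / 4" kap] e kap(2) by (auto simp: sums_iff)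
    \<comment> \<open>The \<open>n + 1\<close> functions \<open>p0\<close> and \<open>p i\<close>
      with \<open>i < n\<close> use up \<open>e / 2\<close> in total; the two tails, of the
      functions and of the functionals, take \<open>e / 4\<close> each.\<close>
    define e' where "e' = e / (2 * (real n + 1))"
    have e': "e' > 0" "(real n + 1) * e' = e / 2" using e by (auto simp: e'_def field_simps)
    obtain r0 where r0: "r0 > 0" "\<And>h. h \<in> M \<Longrightarrow> norm h < r0 \<Longrightarrow>
        p0 (x - z + h) \<le> p0 (x - z) + k0 h + e' * norm h"
      using k0r[rule_format, OF e'(1)] by blast
    have "\<forall>i. \<exists>r>0. \<forall>h\<in>M. norm h < r \<longrightarrow> p i (x - a i + h) \<le> p i (x - a i) + k i h + e' * norm h"
      using kr e'(1) by simp
    from choice[OF this] obtain r where r: "\<And>i. r i > 0" "\<And>i h. h \<in> M \<Longrightarrow> norm h < r i \<Longrightarrow>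
        p i (x - a i + h) \<le> p i (x - a i) + k i h + e' * norm h"
      by blast
    define rr where "rr = Min (insert r0 (r ` {..<n}))"
    have rr: "rr > 0" "rr \<le> r0" "i < n \<Longrightarrow> rr \<le> r i" for i
      using r0(1) r(1) by (auto simp: rr_def)
    have "Psi (x + h) \<le> Psi x + kk h + e * norm h" if h: "h \<in> M" "norm h < rr" for h
    proof -
      have split: "(\<Sum>i. p i (y - a i)) = (\<Sum>i<n. p i (y - a i)) + (\<Sum>i. p (i + n) (y - a (i + n)))" for y
        using suminf_split_initial_segment[OF summ[of y], of n] by simp
      have ksplit: "(\<Sum>i. k i h) = (\<Sum>i<n. k i h) + (\<Sum>i. k (i + n) h)"
        using suminf_split_initial_segment[OF ksum[of h], of n] by simp
      have "(\<Sum>i<n. p i (x + h - a i)) \<le> (\<Sum>i<n. p i (x - a i) + k i h + e' * norm h)"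
      proof (rule sum_mono)
        fix i assume "i \<in> {..<n}"
        then show "p i (x + h - a i) \<le> p i (x - a i) + k i h + e' * norm h"
          using r(2)[OF h(1), of i] rr(3)[of i] h(2) by (simp add: algebra_simps)
      qed
      also have "\<dots> = (\<Sum>i<n. p i (x - a i)) + (\<Sum>i<n. k i h) + real n * e' * norm h"
        by (simp add: sum.distrib)
      finally have 1: "(\<Sum>i<n. p i (x + h - a i)) \<le>
          (\<Sum>i<n. p i (x - a i)) + (\<Sum>i<n. k i h) + real n * e' * norm h" .
      have 2: "p0 (x + h - z) \<le> p0 (x - z) + k0 h + e' * norm h"
        using r0(2)[OF h(1)] h(2) rr(2) by (simp add: algebra_simps)
      have "\<bar>\<Sum>i. k (i + n) h\<bar> \<le> (\<Sum>i. kap (i + n) * norm h)"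
      proof (rule order_trans[OF summable_rabs suminf_le])
        show "summable (\<lambda>i. \<bar>k (i + n) h\<bar>)"
          by (rule summable_rabs_comparison_test[OF _ kap_tail[of n "norm h"]]) (use kabs in auto)
        then show "summable (\<lambda>i. \<bar>k (i + n) h\<bar>)" .
        show "\<bar>k (i + n) h\<bar> \<le> kap (i + n) * norm h" for i by (rule kabs)
        show "summable (\<lambda>i. kap (i + n) * norm h)" by (rule kap_tail)
      qed
      also have "\<dots> = (\<Sum>i. kap (i + n)) * norm h"
        using kap_tail[of n 1] by (intro suminf_mult2[symmetric]) simp
      also have "\<dots> \<le> e / 4 * norm h" using n by (intro mult_right_mono) auto
      finally have 3: "- (e / 4 * norm h) \<le> (\<Sum>i. k (i + n) h)" by linarith
      have "(\<Sum>i. kap (i + n)) * norm h \<le> e / 4 * norm h" using n by (intro mult_right_mono) auto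
      then have 4: "(\<Sum>i. p (i + n) (x + h - a (i + n))) \<le> (\<Sum>i. p (i + n) (x - a (i + n))) + e / 4 * norm h"
        using tail[of n h] by linarith
      have "real n * e' * norm h + e' * norm h = ((real n + 1) * e') * norm h" by (simp add: algebra_simps)
      also have "\<dots> = e / 2 * norm h" by (simp only: e'(2))
      finally have 5: "real n * e' * norm h + e' * norm h = e / 2 * norm h" .
      have 6: "e / 2 * norm h + e / 4 * norm h + e / 4 * norm h = e * norm h" by simp
      have "p0 (x + h - z) + ((\<Sum>i<n. p i (x + h - a i)) + (\<Sum>i. p (i + n) (x + h - a (i + n))))
        \<le> p0 (x - z) + ((\<Sum>i<n. p i (x - a i)) + (\<Sum>i. p (i + n) (x - a (i + n)))) +
          (k0 h + ((\<Sum>i<n. k i h) + (\<Sum>i. k (i + n) h))) + e * norm h"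
        using 1 2 3 4 5 6 by linarith
      then show ?thesis unfolding Psi_def kk_def split[of "x + h"] split[of x] ksplit .
    qed
    then show ?thesis using rr(1) by blast
  qed
  ultimately show "\<exists>k\<in>dual_below (\<lambda>x. N x + K * norm x). \<forall>e>0. \<exists>r>0. \<forall>h\<in>M. norm h < r \<longrightarrow>
      Psi (x + h) \<le> Psi x + k h + e * norm h" by blast
qed

text \<open>\<open>lsc_at\<close> is stated with the punctured filter, so indices with
  \<open>X n = x\<close> are covered by the assumption \<open>c < f x\<close> itself.\<close>

lemma lsc_at_sequence:
  assumes "lsc_at f x" "X \<longlonglongrightarrow> x" "c < f x"
  shows "eventually (\<lambda>n. c < f (X n)) sequentially"
proof -
  have "c < Liminf (at x) f" using assms(1,3) by (auto simp: lsc_at_def)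
  then have "eventually (\<lambda>y. c < f y) (at x)" by (rule less_LiminfD)
  then have "eventually (\<lambda>y. c < f y) (nhds x)"
    using assms(3) by (auto simp: eventually_at_filter elim: eventually_mono)
  then show ?thesis using assms(2) by (auto simp: filterlim_iff)
qed

lemma smooth_on_add_const:
  "smooth_on M N p \<Longrightarrow> smooth_on M N (\<lambda>x. p x + c)"
  unfolding smooth_on_def by (simp add: algebra_simps)

text \<open>Shifted upwards because a penalty must dominate the norm it replaces in order to hold
  the minimising sequence together.\<close>

lemma smooth_approximation_above:
  fixes N :: "'c::real_normed_vector \<Rightarrow> real"
  assumes "separable_dual TYPE('c)" "countable Q" "subspace M" "M \<subseteq> closure Q"
    and "sublinear N" "\<And>x. N x \<le> L * norm x" "eta > 0"
  shows "\<exists>p. smooth_on M N p \<and> (\<forall>x. N x \<le> p x \<and> p x \<le> N x + eta)"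
proof -
  obtain p where p: "smooth_on M N p" "\<And>x. N x - eta \<le> p x \<and> p x \<le> N x"
    using smooth_approximation[OF assms] by blast
  have "N x \<le> p x + eta \<and> p x + eta \<le> N x + eta" for x using p(2)[of x] by auto
  then show ?thesis using smooth_on_add_const[OF p(1), of eta] by blast
qed

text \<open>With \<open>p0\<close> a smooth substitute for \<open>N\<close>, the point
  \<open>z\<close> almost minimises \<open>f\<close> plus \<open>p0\<close> shifted to
  \<open>z\<close>. The perturbed minimum \<open>u\<close> has a smooth total perturbation
  \<open>Psi\<close>, and \<open>k\<close> is its derivative at \<open>u\<close>; hence
  \<open>- k\<close> acts as a subgradient along \<open>M\<close>.\<close>

theorem smooth_variational_principle:
  fixes f :: "'c::real_normed_vector \<Rightarrow> ereal" and N :: "'c \<Rightarrow> real"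
  assumes compl: "complete (UNIV :: 'c set)" and sep: "separable_dual TYPE('c)"
    and Q: "countable Q" and M: "subspace M" "closed M" "M \<subseteq> closure Q"
    and N: "sublinear N" and NL: "\<And>x. N x \<le> L * norm x"
    and z: "z \<in> M" and r: "r > 0" and fz: "f z = ereal fz"
    and lsc: "\<And>x. x \<in> cball z r \<Longrightarrow> lsc_at f x"
    and min: "\<And>x. x \<in> cball z r \<Longrightarrow> ereal (fz - N (x - z)) \<le> f x"
    and eps: "eps > 0"
  shows "\<exists>u\<in>M. \<exists>k\<in>dual_below (\<lambda>x. N x + eps * norm x). \<exists>fu. f u = ereal fu \<and> dist u z < eps \<and>
    \<bar>fu - fz\<bar> < eps \<and>
    (\<forall>e>0. \<exists>d>0. \<forall>h\<in>M. norm h < d \<longrightarrow> ereal (fu - k h - e * norm h) \<le> f (u + h))"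
proof -
  define L' where "L' = max L 0"
  have L': "0 \<le> L'" "N x \<le> L' * norm x" for x
    using NL[of x] mult_right_mono[of L L' "norm x"] by (auto simp: L'_def intro: order_trans)
  \<comment> \<open>The radius \<open>s < r\<close> keeps \<open>u\<close> inside the ball, and
    \<open>(L' + eps + 1) * s <= eps / 2\<close> makes both \<open>u\<close> and its value
    \<open>eps\<close>-close to those of \<open>z\<close>.\<close>
  define s where "s = min (r / 2) (eps / (2 * (L' + eps + 1)))"
  have s: "s > 0" "s < r" using r eps L'(1) by (auto simp: s_def)
  have "s \<le> eps / (2 * (L' + eps + 1))" by (simp add: s_def)
  then have s3: "(L' + eps + 1) * s \<le> eps / 2" using L'(1) eps by (simp add: field_simps)
  have s4: "s < eps" "L' * s + eps * s < eps"
  proof -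
    have "0 \<le> L' * s" "0 < eps * s" using L'(1) s eps by auto
    moreover have "L' * s + eps * s + s \<le> eps / 2" using s3 by (simp add: algebra_simps)
    ultimately show "s < eps" "L' * s + eps * s < eps" using s(1) eps by linarith+
  qed
  define kap where "kap = (\<lambda>i::nat. eps * (1 / 2) ^ Suc i)"
  have kap: "kap i > 0" "kap (Suc i) \<le> kap i" "kap sums eps" for i
    using eps sums_mult[OF power_half_series, of eps] by (auto simp: kap_def)
  define eta where "eta = (\<lambda>i. kap i * (s * (1 / 2) ^ Suc i) / 3)"
  have eta: "eta i > 0" for i using kap(1)[of i] s by (simp add: eta_def)
  obtain p0 where p0: "smooth_on M N p0" "\<And>x. N x \<le> p0 x \<and> p0 x \<le> N x + eta 0"
    using smooth_approximation_above[OF sep Q M(1,3) N NL eta] by blast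
  have "\<forall>i. \<exists>q. smooth_on M (\<lambda>x. kap i * norm x) q \<and> (\<forall>x. kap i * norm x \<le> q x \<and> q x \<le>
      kap i * norm x + eta i)"
  proof
    fix i
    have "sublinear (\<lambda>x::'c. kap i * norm x)"
      unfolding sublinear_def using kap(1)[of i] norm_triangle_ineq
      by (auto simp: distrib_left[symmetric] intro!: mult_left_mono)
    then show "\<exists>q. smooth_on M (\<lambda>x. kap i * norm x) q \<and> (\<forall>x. kap i * norm x \<le> q x \<and> q x \<le>
        kap i * norm x + eta i)"
      using smooth_approximation_above[OF sep Q M(1,3) _ _ eta[of i], of "\<lambda>x. kap i * norm x" "kap i"] by simp
  qed
  from choice[OF this] obtain p where p: "\<And>i. smooth_on M (\<lambda>x. kap i * norm x) (p i)"
    "\<And>i x. kap i * norm x \<le> p i x" "\<And>i x. p i x \<le> kap i * norm x + eta i" by blast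
  \<comment> \<open>On this set \<open>f\<close> is real valued, the lower bound by
    \<open>min\<close> excluding minus infinity. Its possible lack of closedness is compensated in
    \<open>lscB\<close>, where a bound on \<open>B\<close> along the sequence forces a finite value
    at the limit.\<close>
  define D where "D = {x \<in> M \<inter> cball z r. f x < \<infinity>}"
  define g where "g = (\<lambda>x. real_of_ereal (f x))"
  have fin: "f x = ereal (g x)" if "x \<in> cball z r" "f x < \<infinity>" for x
    using min[OF that(1)] that(2) unfolding g_def by (cases "f x") auto
  have zD: "z \<in> D" using z r fz by (simp add: D_def)
  have gz: "g z = fz" by (simp add: g_def fz)
  define B where "B = (\<lambda>x. g x + p0 (x - z))"
  have p0_shift: "p0 (x + h) \<le> p0 x + L' * norm h" for x h
    using p0(1) L'(2)[of h] unfolding smooth_on_def by (meson add_left_mono order_trans)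
  have lscB: "x \<in> D \<and> B x \<le> C"
    if X: "\<And>n. X n \<in> D" "X \<longlonglongrightarrow> x" and BX: "\<And>e. e > 0 \<Longrightarrow>
        eventually (\<lambda>n. B (X n) \<le> C + e) sequentially" for X x C
  proof -
    have x: "x \<in> M" "x \<in> cball z r"
      using closed_sequentially[OF M(2) _ X(2)] closed_sequentially[OF closed_cball _ X(2)] X(1)
      by (auto simp: D_def)
    have "f x \<le> ereal (C - p0 (x - z))"
    proof (rule ccontr)
      assume "\<not> f x \<le> ereal (C - p0 (x - z))"
      then have "ereal (C - p0 (x - z)) < f x" by simp
      then obtain c where c: "C - p0 (x - z) < c" "ereal c < f x"
        using ereal_dense2 by (metis less_ereal.simps(1))
      define e where "e = (c - (C - p0 (x - z))) / 2"
      have e: "e > 0" "C - p0 (x - z) + 2 * e = c" using c(1) by (simp_all add: e_def field_simps)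
      have "(\<lambda>n. L' * norm (x - X n)) \<longlonglongrightarrow> L' * norm (x - x)" by (intro tendsto_intros X(2))
      then have "eventually (\<lambda>n. L' * norm (x - X n) < e) sequentially"
        using e(1) by (intro order_tendstoD) auto
      moreover note BX[OF e(1)] lsc_at_sequence[OF lsc[OF x(2)] X(2) c(2)]
      ultimately have "eventually (\<lambda>n. False) sequentially"
      proof eventually_elim
        case (elim n)
        have "f (X n) = ereal (g (X n))" using X(1)[of n] by (intro fin) (auto simp: D_def)
        moreover have "p0 (x - z) \<le> p0 (X n - z) + L' * norm (x - X n)"
          using p0_shift[of "X n - z" "x - X n"] by simp
        ultimately show False using elim e(2) by (simp add: B_def)
      qed
      then show False by simp
    qed
    moreover from this have "f x < \<infinity>" using le_less_trans by fastforce
    ultimately show ?thesis using x fin[OF x(2)] by (simp add: D_def B_def)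
  qed
  have Bmin: "B z \<le> B x + eta 0" if "x \<in> D" for x
  proof -
    have xc: "x \<in> cball z r" "f x < \<infinity>" using that by (auto simp: D_def)
    have "fz - N (x - z) \<le> g x" using min[OF xc(1)] fin[OF xc] by simp
    moreover have "p0 0 \<le> eta 0" using p0(2)[of 0] sublinear_zero[OF N] by simp
    ultimately show ?thesis using p0(2)[of "x - z"] by (simp add: B_def gz)
  qed
  have pshift: "p i (x + h) \<le> p i x + kap i * norm h" for i x h
    using p(1)[of i] by (simp add: smooth_on_def)
  have ksumm: "summable kap" using kap(3) by (simp add: sums_iff)
  have "\<exists>u\<in>D. \<exists>a. dist u z \<le> s \<and> (\<forall>x. summable (\<lambda>i. p i (x - a i))) \<and>
    (\<forall>x\<in>D. B u + (\<Sum>i. p i (u - a i)) \<le> B x + (\<Sum>i. p i (x - a i)))"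
  proof (rule perturbed_minimum[where kap = kap and eta = eta and p = p and B = B and s = s and D = D and z = z,
        OF compl zD _ s(1) kap(1,2) ksumm _ p(2,3) pshift Bmin])
    show "x \<in> D \<and> B x \<le> C" if "\<And>n. X n \<in> D" "X \<longlonglongrightarrow> x"
      "\<And>e. e > 0 \<Longrightarrow> eventually (\<lambda>n. B (X n) \<le> C + e) sequentially" for X x C
      using that by (rule lscB)
  qed (simp add: eta_def)
  then obtain u a where u: "u \<in> D" "dist u z \<le> s" and summ: "\<And>x. summable (\<lambda>i. p i (x - a i))"
    and umin: "\<And>x. x \<in> D \<Longrightarrow> B u + (\<Sum>i. p i (u - a i)) \<le> B x + (\<Sum>i. p i (x - a i))"
    by blast
  define Psi where "Psi = (\<lambda>x. p0 (x - z) + (\<Sum>i. p i (x - a i)))"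
  have Pmin: "g u + Psi u \<le> g x + Psi x" if "x \<in> D" for x
    using umin[OF that] by (simp add: B_def Psi_def)
  have Psi: "Psi (x + h) \<le> Psi x + (N h + eps * norm h)"
    "\<exists>k\<in>dual_below (\<lambda>x. N x + eps * norm x). \<forall>e>0. \<exists>r>0. \<forall>h\<in>M. norm h < r \<longrightarrow>
      Psi (x + h) \<le> Psi x + k h + e * norm h" for x h
    unfolding Psi_def by (rule perturbation_smooth[OF p0(1) p(1) kap(1,3) summ])+
  obtain k where k: "k \<in> dual_below (\<lambda>x. N x + eps * norm x)"
    and kr: "\<forall>e>0. \<exists>r>0. \<forall>h\<in>M. norm h < r \<longrightarrow> Psi (u + h) \<le> Psi u + k h + e * norm h"
    using Psi(2)[where x = u] by (elim bexE)
  have uM: "u \<in> M" "u \<in> cball z r" "f u < \<infinity>" using u(1) by (auto simp: D_def)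
  have fu: "f u = ereal (g u)" using fin uM by blast
  have nuz: "norm (u - z) \<le> s" "norm (z - u) \<le> s" using u(2) by (auto simp: dist_norm norm_minus_commute)
  have "g u \<le> fz + L' * s + eps * s"
  proof -
    have "Psi z \<le> Psi u + (N (z - u) + eps * norm (z - u))"
      using Psi(1)[where x = u and h = "z - u"] by simp
    moreover have "N (z - u) \<le> L' * s" using L' nuz(2) order_trans[OF L'(2) mult_left_mono] by blast
    moreover have "eps * norm (z - u) \<le> eps * s" using eps nuz by (intro mult_left_mono) auto
    ultimately show ?thesis using Pmin[OF zD] gz by linarith
  qed
  moreover have "fz - L' * s \<le> g u"
  proof -
    have "fz - N (u - z) \<le> g u" using min[OF uM(2)] fu by simp
    moreover have "N (u - z) \<le> L' * s" using L' nuz(1) order_trans[OF L'(2) mult_left_mono] by blast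
    ultimately show ?thesis by linarith
  qed
  moreover have "0 < eps * s" using eps s by simp
  ultimately have "\<bar>g u - fz\<bar> < eps" using s4(2) by linarith
  moreover have "\<exists>d>0. \<forall>h\<in>M. norm h < d \<longrightarrow> ereal (g u - k h - e * norm h) \<le> f (u + h)" if e: "e > 0" for e
  proof -
    obtain d where d: "d > 0" "\<And>h. h \<in> M \<Longrightarrow> norm h < d \<Longrightarrow> Psi (u + h) \<le> Psi u + k h + e * norm h"
      using kr e by blast
    \<comment> \<open>Increments shorter than \<open>r - s\<close> stay in the ball around
      \<open>z\<close>; where \<open>f\<close> is infinite there is nothing to show.\<close>
    have "ereal (g u - k h - e * norm h) \<le> f (u + h)" if h: "h \<in> M" "norm h < min d (r - s)" for h
    proof (cases "f (u + h) < \<infinity>")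
      case True
      have "dist z (u + h) \<le> dist z u + dist u (u + h)" by (rule dist_triangle)
      then have c: "u + h \<in> cball z r" using u(2) h(2) by (simp add: dist_norm norm_minus_commute)
      then have "u + h \<in> D" using True subspace_add[OF M(1) uM(1) h(1)] by (simp add: D_def)
      from Pmin[OF this] d(2)[OF h(1)] h(2) have "g u - k h - e * norm h \<le> g (u + h)" by simp
      then show ?thesis using fin[OF c True] by simp
    qed simp
    then show ?thesis using d(1) s(2) by (intro exI[of _ "min d (r - s)"]) auto
  qed
  ultimately show ?thesis using uM(1) k fu u(2) s4(1) by (meson le_less_trans)
qed

section \<open>Countable sets closed under choices and rational combinations\<close>

lemma countable_closure_exists:
  fixes w :: "'c::real_normed_vector \<Rightarrow> nat \<Rightarrow> 'c set"
  assumes w: "\<And>x i. countable (w x i)"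
  obtains Q where "countable Q" "z \<in> Q" "\<And>x i. x \<in> Q \<Longrightarrow> w x i \<subseteq> Q"
    "\<And>x y. x \<in> Q \<Longrightarrow> y \<in> Q \<Longrightarrow> x + y \<in> Q" "\<And>q x. q \<in> \<rat> \<Longrightarrow> x \<in> Q \<Longrightarrow> q *\<^sub>R x \<in> Q"
proof -
  define enlarge where "enlarge = (\<lambda>S. S \<union> (\<Union>x\<in>S. \<Union>i. w x i) \<union> (\<lambda>(x, y). x + y) ` (S \<times> S) \<union>
    (\<lambda>(q, x). q *\<^sub>R x) ` (\<rat> \<times> S))"
  define A where "A = rec_nat {z} (\<lambda>_. enlarge)"
  have A: "A 0 = {z}" "A (Suc n) = enlarge (A n)" for n by (simp_all add: A_def)
  have "A n \<subseteq> A (Suc n)" for n by (auto simp: A enlarge_def)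
  then have mono: "n \<le> m \<Longrightarrow> A n \<subseteq> A m" for n m by (rule lift_Suc_mono_le)
  have step: "enlarge (A n) \<subseteq> (\<Union>n. A n)" for n using A(2) by blast
  have "countable (A n)" for n
    by (induction n) (auto simp: A enlarge_def w countable_rat intro!: countable_UN countable_SIGMA)
  then have "countable (\<Union>n. A n)" by simp
  moreover have "z \<in> (\<Union>n. A n)" using A(1) by blast
  moreover have "w x i \<subseteq> (\<Union>n. A n)" if x: "x \<in> (\<Union>n. A n)" for x i
  proof -
    obtain n where "x \<in> A n" using x by blast
    then have "w x i \<subseteq> enlarge (A n)" by (auto simp: enlarge_def)
    then show ?thesis using step by blast
  qed
  moreover have "x + y \<in> (\<Union>n. A n)" if xy: "x \<in> (\<Union>n. A n)" "y \<in> (\<Union>n. A n)" for x y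
  proof -
    obtain n m where "x \<in> A n" "y \<in> A m" using xy by blast
    then have "x \<in> A (max n m)" "y \<in> A (max n m)" using mono[of n "max n m"] mono[of m "max n m"] by auto
    then have "x + y \<in> enlarge (A (max n m))" by (auto simp: enlarge_def)
    then show ?thesis using step by blast
  qed
  moreover have "q *\<^sub>R x \<in> (\<Union>n. A n)" if qx: "q \<in> \<rat>" "x \<in> (\<Union>n. A n)" for q x
  proof -
    obtain n where "x \<in> A n" using qx by blast
    then have "q *\<^sub>R x \<in> enlarge (A n)" using qx(1) by (auto simp: enlarge_def)
    then show ?thesis using step by blast
  qed
  ultimately show thesis by (rule that)
qed

lemma subspace_closure_rational:
  fixes Q :: "'c::real_normed_vector set"
  assumes "z \<in> Q" and add: "\<And>x y. x \<in> Q \<Longrightarrow> y \<in> Q \<Longrightarrow> x + y \<in> Q"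
    and scale: "\<And>q x. q \<in> \<rat> \<Longrightarrow> x \<in> Q \<Longrightarrow> q *\<^sub>R x \<in> Q"
  shows "subspace (closure Q)"
proof (rule subspaceI)
  show "0 \<in> closure Q" using scale[of 0 z] \<open>z \<in> Q\<close> closure_subset by fastforce
  show "x + y \<in> closure Q" if xy: "x \<in> closure Q" "y \<in> closure Q" for x y
  proof -
    obtain X Y where "\<And>n. X n \<in> Q" "X \<longlonglongrightarrow> x" "\<And>n. Y n \<in> Q" "Y \<longlonglongrightarrow> y"
      using xy unfolding closure_sequential by blast
    then show ?thesis unfolding closure_sequential
      by (intro exI[of _ "\<lambda>n. X n + Y n"]) (auto intro: add tendsto_add)
  qed
  show "c *\<^sub>R x \<in> closure Q" if x: "x \<in> closure Q" for c x
  proof -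
    obtain X where X: "\<And>n. X n \<in> Q" "X \<longlonglongrightarrow> x" using x unfolding closure_sequential by blast
    have "\<exists>q. q \<in> \<rat> \<and> dist q c < inverse (real (Suc n))" for n
    proof -
      have "c - inverse (real (Suc n)) < c" by simp
      then obtain q where "q \<in> \<rat>" "c - inverse (real (Suc n)) < q" "q < c" using Rats_dense_in_real by blast
      then show ?thesis by (intro exI[of _ q]) (auto simp: dist_real_def)
    qed
    then obtain q where q: "\<And>n. q n \<in> \<rat>" "\<And>n. dist (q n) c < inverse (real (Suc n))" by metis
    have "q \<longlonglongrightarrow> c"
    proof (rule LIMSEQ_I)
      fix e :: real assume "e > 0"
      then obtain n0 where n0: "inverse (real (Suc n0)) < e" using reals_Archimedean by blast
      have "norm (q n - c) < e" if "n0 \<le> n" for n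
      proof -
        have "inverse (real (Suc n)) \<le> inverse (real (Suc n0))" using that by (intro le_imp_inverse_le) auto
        then show ?thesis using q(2)[of n] n0 unfolding dist_norm by linarith
      qed
      then show "\<exists>n0. \<forall>n\<ge>n0. norm (q n - c) < e" by blast
    qed
    then show ?thesis unfolding closure_sequential using X q(1)
      by (intro exI[of _ "\<lambda>n. q n *\<^sub>R X n"]) (auto intro: scale tendsto_scaleR)
  qed
qed

section \<open>Separable reduction\<close>

lemma sublinear_sum:
  assumes N: "sublinear N" and "finite I" and c: "\<And>i. i \<in> I \<Longrightarrow> 0 \<le> c i"
  shows "N (\<Sum>i\<in>I. c i *\<^sub>R x i) \<le> (\<Sum>i\<in>I. c i * N (x i))"
  using assms(2) c
proof (induction I)
  case empty
  then show ?case using sublinear_zero[OF N] by simp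
next
  case (insert i I)
  have "N (\<Sum>i\<in>insert i I. c i *\<^sub>R x i) \<le> N (c i *\<^sub>R x i) + N (\<Sum>i\<in>I. c i *\<^sub>R x i)"
    using insert.hyps sublinear_add[OF N] by simp
  also have "\<dots> \<le> c i * N (x i) + (\<Sum>i\<in>I. c i * N (x i))"
    using insert.IH insert.prems sublinear_scale[OF N, of "c i" "x i"] by simp
  finally show ?case using insert.hyps by simp
qed

text \<open>By the sandwich theorem, a functional below \<open>N\<close> supports \<open>f\<close> at \<open>x\<close>, up to errors
  \<open>c |y - x|\<close> at the points \<open>y\<close> near \<open>x\<close>, if and only if the following expression is nonnegative
  for all finite families of such points \<open>v i\<close> and weights \<open>lam i\<close>, with \<open>t = f x\<close>. It is
  continuous in \<open>x\<close> and \<open>t\<close>, which is why countably many choices of the \<open>v i\<close> suffice.\<close>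

definition support_gap ::
  "('c::real_normed_vector \<Rightarrow> ereal) \<Rightarrow> ('c \<Rightarrow> real) \<Rightarrow> nat \<Rightarrow> (nat \<Rightarrow> real) \<Rightarrow> (nat \<Rightarrow> real) \<Rightarrow> (nat \<Rightarrow> 'c) \<Rightarrow>
   'c \<Rightarrow> real \<Rightarrow> real"
  where "support_gap f N j lam c v x t =
    (\<Sum>i=1..j. lam i * (real_of_ereal (f (v i)) - t + c i * norm (v i - x))) + N (\<Sum>i=1..j. lam i *\<^sub>R (v i - x))"

text \<open>The error depends on the total weight but not on the points \<open>v\<close>. So the
  centre may be moved back after \<open>v\<close> has been exchanged for a different family.\<close>

lemma support_gap_move:
  assumes N: "sublinear N" and NL: "\<And>x. N x \<le> L * norm x"
    and lam: "\<And>i. i \<in> {1..j} \<Longrightarrow> 0 \<le> lam i" and c: "\<And>i. i \<in> {1..j} \<Longrightarrow> 0 \<le> c i \<and> c i \<le> 1"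
  shows "support_gap f N j lam c v y s \<le>
    support_gap f N j lam c v x t + (\<Sum>i=1..j. lam i) * (\<bar>s - t\<bar> + (1 + L) * norm (x - y))"
proof -
  let ?S = "\<Sum>i=1..j. lam i"
  have S: "0 \<le> ?S" using lam by (intro sum_nonneg) auto
  have "(\<Sum>i=1..j. lam i * (real_of_ereal (f (v i)) - s + c i * norm (v i - y))) \<le>
    (\<Sum>i=1..j. lam i * (real_of_ereal (f (v i)) - t + c i * norm (v i - x)) + lam i * (\<bar>s - t\<bar> + norm (x - y)))"
  proof (rule sum_mono)
    fix i assume i: "i \<in> {1..j}"
    have "norm (v i - y) \<le> norm (v i - x) + norm (x - y)"
      using norm_triangle_ineq[of "v i - x" "x - y"] by simp
    then have "c i * norm (v i - y) \<le> c i * (norm (v i - x) + norm (x - y))" using c[OF i]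
      by (intro mult_left_mono) auto
    also have "\<dots> \<le> c i * norm (v i - x) + 1 * norm (x - y)"
      unfolding distrib_left using c[OF i] by (intro add_left_mono mult_right_mono) auto
    finally have "real_of_ereal (f (v i)) - s + c i * norm (v i - y) \<le>
      (real_of_ereal (f (v i)) - t + c i * norm (v i - x)) + (\<bar>s - t\<bar> + norm (x - y))" by linarith
    then show "lam i * (real_of_ereal (f (v i)) - s + c i * norm (v i - y)) \<le>
      lam i * (real_of_ereal (f (v i)) - t + c i * norm (v i - x)) + lam i * (\<bar>s - t\<bar> + norm (x - y))"
      unfolding distrib_left[symmetric] using lam[OF i] by (intro mult_left_mono) auto
  qed
  also have "\<dots> = (\<Sum>i=1..j. lam i * (real_of_ereal (f (v i)) - t + c i * norm (v i - x))) + ?S * (\<bar>s - t\<bar> + norm (x - y))"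
    by (simp add: sum.distrib sum_distrib_right)
  finally have 1: "(\<Sum>i=1..j. lam i * (real_of_ereal (f (v i)) - s + c i * norm (v i - y))) \<le>
    (\<Sum>i=1..j. lam i * (real_of_ereal (f (v i)) - t + c i * norm (v i - x))) + ?S * (\<bar>s - t\<bar> + norm (x - y))" .
  have "(\<Sum>i=1..j. lam i *\<^sub>R (v i - y)) = (\<Sum>i=1..j. lam i *\<^sub>R (v i - x)) + ?S *\<^sub>R (x - y)"
    by (simp add: sum.distrib[symmetric] scaleR_left.sum scaleR_add_right[symmetric])
  then have "N (\<Sum>i=1..j. lam i *\<^sub>R (v i - y)) \<le> N (\<Sum>i=1..j. lam i *\<^sub>R (v i - x)) + N (?S *\<^sub>R (x - y))"
    using sublinear_add[OF N] by simp
  moreover have "N (?S *\<^sub>R (x - y)) = ?S * N (x - y)" by (rule sublinear_scale[OF N S])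
  moreover have "?S * N (x - y) \<le> ?S * (L * norm (x - y))" by (rule mult_left_mono[OF NL S])
  ultimately have 2: "N (\<Sum>i=1..j. lam i *\<^sub>R (v i - y)) \<le>
      N (\<Sum>i=1..j. lam i *\<^sub>R (v i - x)) + ?S * (L * norm (x - y))"
    by linarith
  have "?S * (\<bar>s - t\<bar> + (1 + L) * norm (x - y)) = ?S * (\<bar>s - t\<bar> + norm (x - y)) + ?S * (L * norm (x - y))"
    by (simp add: algebra_simps)
  with 1 2 show ?thesis unfolding support_gap_def by linarith
qed

text \<open>The list \<open>ps\<close> holds weights, indices \<open>m\<close> of the errors \<open>1 / (m + 1)\<close>, and bounds for the distances
  to the centre. Its \<open>i\<close>-th entry is \<open>ps ! (i - 1)\<close>.\<close>

definition witness ::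
  "('c::real_normed_vector \<Rightarrow> ereal) \<Rightarrow> ('c \<Rightarrow> real) \<Rightarrow> 'c \<Rightarrow> rat \<Rightarrow> rat \<Rightarrow> (rat \<times> nat \<times> rat) list \<Rightarrow>
   (nat \<Rightarrow> 'c) \<Rightarrow> bool"
  where "witness f N x t s ps v \<longleftrightarrow>
    (\<forall>i\<in>{1..length ps}. f (v i) < \<infinity> \<and> norm (v i - x) < of_rat (snd (snd (ps ! (i - 1))))) \<and>
    support_gap f N (length ps) (\<lambda>i. of_rat (fst (ps ! (i - 1)))) (\<lambda>i. inverse (Suc (fst (snd (ps ! (i - 1)))))) v x (of_rat t)
      < of_rat s"

text \<open>The parameters \<open>t\<close>, \<open>s\<close> and \<open>ps\<close> range over
  countable types; this is what allows a countable set to contain witnesses for all of them at each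
  of its points.\<close>

definition rich :: "('c::real_normed_vector \<Rightarrow> ereal) \<Rightarrow> ('c \<Rightarrow> real) \<Rightarrow> 'c set \<Rightarrow> bool" where
  "rich f N Q \<longleftrightarrow> (\<forall>x\<in>Q. \<forall>t s ps. (\<exists>v. witness f N x t s ps v) \<longrightarrow>
     (\<exists>v. witness f N x t s ps v \<and> v ` {1..length ps} \<subseteq> Q))"

lemma rich_set_exists:
  fixes f :: "'c::real_normed_vector \<Rightarrow> ereal"
  obtains Q where "countable Q" "z \<in> Q" "subspace (closure Q)" "rich f N Q"
proof -
  \<comment> \<open>\<open>from_nat\<close> enumerates the parameter triples. If no witness exists,
    the chosen points are arbitrary but still finite in number.\<close>
  define w where "w = (\<lambda>x i. case from_nat i of (t, s, ps) \<Rightarrow> (SOME v. witness f N x t s ps v) ` {1..length ps})"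
  have "countable (w x i)" for x i by (auto simp: w_def split: prod.split)
  then obtain Q where Q: "countable Q" "z \<in> Q" and wQ: "\<And>x i. x \<in> Q \<Longrightarrow> w x i \<subseteq> Q"
    and add: "\<And>x y. x \<in> Q \<Longrightarrow> y \<in> Q \<Longrightarrow> x + y \<in> Q" and scale: "\<And>q x. q \<in> \<rat> \<Longrightarrow> x \<in> Q \<Longrightarrow> q *\<^sub>R x \<in> Q"
    using countable_closure_exists[of w z] by metis
  have "rich f N Q"
    unfolding rich_def
  proof (intro ballI allI impI)
    fix x t s ps assume x: "x \<in> Q" and ex: "\<exists>v. witness f N x t s ps v"
    have "w x (to_nat (t, s, ps)) = (SOME v. witness f N x t s ps v) ` {1..length ps}" by (simp add: w_def)
    then show "\<exists>v. witness f N x t s ps v \<and> v ` {1..length ps} \<subseteq> Q"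
      using someI_ex[OF ex] wQ[OF x, of "to_nat (t, s, ps)"] by metis
  qed
  then show thesis using that Q subspace_closure_rational[OF Q(2) add scale] by blast
qed

text \<open>Weights are rounded upwards, so they stay nonnegative and the increments
  \<open>d i\<close> are nonnegative too; sublinearity of \<open>N\<close> then bounds the change by
  \<open>r * S\<close>, which is less than the available gap \<open>g\<close>.\<close>

lemma rational_perturbation:
  fixes mu :: "nat \<Rightarrow> real"
  assumes N: "sublinear N" and mu: "\<And>i. i \<in> {1..j} \<Longrightarrow> 0 \<le> mu i"
    and neg: "support_gap f N j mu c v x t < 0"
  shows "\<exists>lam :: nat \<Rightarrow> rat. (\<forall>i\<in>{1..j}. 0 \<le> lam i) \<and> support_gap f N j (\<lambda>i. of_rat (lam i)) c v x t < 0"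
proof -
  define C where "C = (\<lambda>i. real_of_ereal (f (v i)) - t + c i * norm (v i - x))"
  define W where "W = (\<lambda>i. v i - x)"
  define S where "S = (\<Sum>i=1..j. \<bar>C i\<bar> + \<bar>N (W i)\<bar>)"
  have S: "0 \<le> S" unfolding S_def by (intro sum_nonneg) auto
  define g where "g = - support_gap f N j mu c v x t"
  have g: "g > 0" using neg by (simp add: g_def)
  define r where "r = g / (2 * (S + 1))"
  have r: "r > 0" using g S by (simp add: r_def)
  have rS: "r * S < g" using g S by (simp add: r_def field_simps) (smt (verit) mult_nonneg_nonneg)
  have "\<exists>q::rat. mu i < of_rat q \<and> of_rat q < mu i + r" for i
    using of_rat_dense[of "mu i" "mu i + r"] r by auto
  then obtain lam :: "nat \<Rightarrow> rat" where lam: "\<And>i. mu i < of_rat (lam i)" "\<And>i. of_rat (lam i) < mu i + r" by metis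
  define d where "d = (\<lambda>i. of_rat (lam i) - mu i)"
  have d: "0 \<le> d i" "d i \<le> r" for i using lam[of i] by (auto simp: d_def)
  have "support_gap f N j (\<lambda>i. of_rat (lam i)) c v x t \<le> support_gap f N j mu c v x t + r * S"
  proof -
    have "(\<Sum>i=1..j. of_rat (lam i) * C i) = (\<Sum>i=1..j. mu i * C i) + (\<Sum>i=1..j. d i * C i)"
      by (simp add: d_def sum.distrib[symmetric] algebra_simps)
    moreover have "N (\<Sum>i=1..j. of_rat (lam i) *\<^sub>R W i) \<le>
        N (\<Sum>i=1..j. mu i *\<^sub>R W i) + (\<Sum>i=1..j. d i * N (W i))"
    proof -
      have "(\<Sum>i=1..j. of_rat (lam i) *\<^sub>R W i) = (\<Sum>i=1..j. mu i *\<^sub>R W i) + (\<Sum>i=1..j. d i *\<^sub>R W i)"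
        by (simp add: d_def sum.distrib[symmetric] algebra_simps)
      then have "N (\<Sum>i=1..j. of_rat (lam i) *\<^sub>R W i) \<le> N (\<Sum>i=1..j. mu i *\<^sub>R W i) + N (\<Sum>i=1..j. d i *\<^sub>R W i)"
        using sublinear_add[OF N] by simp
      also have "N (\<Sum>i=1..j. d i *\<^sub>R W i) \<le> (\<Sum>i=1..j. d i * N (W i))" using d
        by (intro sublinear_sum[OF N]) auto
      finally show ?thesis by simp
    qed
    moreover have "(\<Sum>i=1..j. d i * C i) + (\<Sum>i=1..j. d i * N (W i)) \<le> r * S"
      unfolding S_def sum_distrib_left sum.distrib[symmetric]
    proof (rule sum_mono)
      fix i
      have "d i * C i + d i * N (W i) = d i * (C i + N (W i))" by (simp add: distrib_left)
      also have "\<dots> \<le> d i * (\<bar>C i\<bar> + \<bar>N (W i)\<bar>)" using d by (intro mult_left_mono) auto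
      also have "\<dots> \<le> r * (\<bar>C i\<bar> + \<bar>N (W i)\<bar>)" using d by (intro mult_right_mono) auto
      finally show "d i * C i + d i * N (W i) \<le> r * (\<bar>C i\<bar> + \<bar>N (W i)\<bar>)" .
    qed
    ultimately show ?thesis unfolding support_gap_def C_def W_def by linarith
  qed
  also have "\<dots> < 0" using rS by (simp add: g_def)
  finally have "support_gap f N j (\<lambda>i. of_rat (lam i)) c v x t < 0" .
  moreover have "0 \<le> lam i" if "i \<in> {1..j}" for i
    using mu[OF that] lam(1)[of i]
      by (metis less_eq_real_def of_rat_0 of_rat_less order_less_trans linorder_not_less not_less_iff_gr_or_eq)
  ultimately show ?thesis by blast
qed

text \<open>If the sandwich theorem did not apply, finitely many points near \<open>u\<close> would
  have a negative gap. After rounding the weights and moving the centre to some \<open>y\<close> in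
  \<open>Q\<close>, richness replaces these points by points of \<open>Q\<close>. Moving the centre
  back to \<open>u\<close> leaves a negative gap, which contradicts the support that
  \<open>k\<close> provides on \<open>Q\<close>. The resulting functional need not extend
  \<open>k\<close>.\<close>

lemma separable_reduction:
  fixes f :: "'c::real_normed_vector \<Rightarrow> ereal" and N :: "'c \<Rightarrow> real"
  assumes N: "sublinear N" and sym: "\<And>x. N (- x) = N x" and NL: "\<And>x. N x \<le> L * norm x" and L: "0 \<le> L"
    and finite: "\<And>x. f x \<noteq> -\<infinity>"
    and Q: "rich f N Q" and u: "u \<in> closure Q" and fu: "f u = ereal fu" and k: "k \<in> dual_below N"
    and d: "\<And>m. d m > 0"
    and supp: "\<And>m v. v \<in> Q \<Longrightarrow> norm (v - u) < d m \<Longrightarrow>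
        ereal (fu + k (v - u) - inverse (Suc m) * norm (v - u)) \<le> f v"
  shows "\<exists>k\<in>dual_below N. \<forall>m v. norm (v - u) < d m \<longrightarrow> ereal (fu + k (v - u) - inverse (Suc m) * norm (v - u)) \<le> f v"
proof -
  define F where "F = (\<lambda>v. real_of_ereal (f v))"
  have F: "f v = ereal (F v)" if "f v < \<infinity>" for v
    using that finite[of v] unfolding F_def by (cases "f v") auto
  define T where "T = {(v - u, F v - fu + inverse (Suc m) * norm (v - u)) | v m. f v < \<infinity> \<and>
      norm (v - u) < d m}"
  have "0 \<le> b + N w" if wb: "(w, b) \<in> convex hull T" for w b
  proof (rule ccontr)
    assume "\<not> 0 \<le> b + N w"
    obtain j mu x where mux: "\<forall>i\<in>{1::nat..j}. 0 \<le> mu i \<and> x i \<in> T"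
      and sum: "(\<Sum>i=1..j. mu i *\<^sub>R x i) = (w, b)"
      using wb[unfolded convex_hull_indexed mem_Collect_eq] by (elim exE conjE, intro that)
    have mu: "0 \<le> mu i" and x: "x i \<in> T" if "i \<in> {1..j}" for i using mux that by auto
    have "\<forall>i. \<exists>v m. i \<in> {1..j} \<longrightarrow> x i = (v - u, F v - fu + inverse (Suc m) * norm (v - u)) \<and> f v < \<infinity> \<and>
        norm (v - u) < d m"
      using x unfolding T_def by blast
    then obtain v m where vm: "\<And>i. i \<in> {1..j} \<Longrightarrow>
        x i = (v i - u, F (v i) - fu + inverse (Suc (m i)) * norm (v i - u)) \<and>
        f (v i) < \<infinity> \<and> norm (v i - u) < d (m i)" by metis
    define c where "c = (\<lambda>i. inverse (real (Suc (m i))))"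
    have c: "0 \<le> c i" "c i \<le> 1" for i by (auto simp: c_def field_simps)
    have "w = (\<Sum>i=1..j. mu i *\<^sub>R (v i - u))"
      using arg_cong[OF sum, of fst] vm by (simp add: fst_sum)
    moreover have "b = (\<Sum>i=1..j. mu i * (F (v i) - fu + c i * norm (v i - u)))"
      using arg_cong[OF sum, of snd] vm by (simp add: snd_sum c_def)
    ultimately have "support_gap f N j mu c v u fu < 0"
      using \<open>\<not> 0 \<le> b + N w\<close> by (simp add: support_gap_def F_def)
    from rational_perturbation[OF N mu this] obtain lam :: "nat \<Rightarrow> rat"
      where lam: "i \<in> {1..j} \<Longrightarrow> 0 \<le> lam i"
        and neg: "support_gap f N j (\<lambda>i. of_rat (lam i)) c v u fu < 0" for i
      by blast
    have lam0: "0 \<le> (of_rat (lam i) :: real)" if "i \<in> {1..j}" for i using lam[OF that] by simp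
    define g where "g = - support_gap f N j (\<lambda>i. of_rat (lam i)) c v u fu"
    have g: "g > 0" using neg by (simp add: g_def)
    define S where "S = (\<Sum>i=1..j. (of_rat (lam i) :: real))"
    have S: "0 \<le> S" unfolding S_def using lam0 by (intro sum_nonneg) auto
    have "\<exists>q::rat. i \<in> {1..j} \<longrightarrow> norm (v i - u) < of_rat q \<and> of_rat q < d (m i)" for i
      using vm[of i] of_rat_dense[of "norm (v i - u)" "d (m i)"] by auto
    then obtain e :: "nat \<Rightarrow> rat" where e: "\<And>i. i \<in> {1..j} \<Longrightarrow>
        norm (v i - u) < of_rat (e i) \<and> of_rat (e i) < d (m i)" by metis
    \<comment> \<open>The first bound limits the cost of each change of centre to
      \<open>g / 4\<close>. The others leave room for the rational radius \<open>e i\<close> on both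
      sides: the old points are within \<open>e i\<close> of \<open>y\<close>, and points within
      \<open>e i\<close> of \<open>y\<close> are within \<open>d (m i)\<close> of
      \<open>u\<close>.\<close>
    define tau where "tau = Min (insert (g / (4 * (S + 1) * (2 + L)))
      ((\<lambda>i. min (of_rat (e i) - norm (v i - u)) (d (m i) - of_rat (e i))) ` {1..j}))"
    have tau: "tau > 0" "tau \<le> g / (4 * (S + 1) * (2 + L))"
      using g S L e by (auto simp: tau_def)
    have tau_i: "tau \<le> of_rat (e i) - norm (v i - u)" "tau \<le> d (m i) - of_rat (e i)" if "i \<in> {1..j}" for i
    proof -
      have "tau \<le> min (of_rat (e i) - norm (v i - u)) (d (m i) - of_rat (e i))"
        unfolding tau_def using that by (intro Min_le) auto
      then show "tau \<le> of_rat (e i) - norm (v i - u)" "tau \<le> d (m i) - of_rat (e i)" by auto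
    qed
    have Stau: "S * (tau + (1 + L) * tau) \<le> g / 4"
    proof -
      have "tau * (4 * (S + 1) * (2 + L)) \<le> g" using tau(2) S L by (subst (asm) pos_le_divide_eq) auto
      moreover have "S * (tau + (1 + L) * tau) \<le> (S + 1) * (tau + (1 + L) * tau)"
        using tau(1) L by (intro mult_right_mono) auto
      ultimately show ?thesis by (simp add: algebra_simps)
    qed
    obtain y where y: "y \<in> Q" "dist y u < tau" using u tau(1) unfolding closure_approachable by blast
    have yu: "norm (u - y) < tau" "norm (y - u) < tau" using y(2)
      by (auto simp: dist_norm norm_minus_commute)
    obtain t :: rat where t: "fu < of_rat t" "of_rat t < fu + tau"
      using of_rat_dense[of fu "fu + tau"] tau(1) by auto
    \<comment> \<open>The first move leaves a gap of at most \<open>- 3 * g / 4\<close>, below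
      \<open>s\<close>; the second one adds at most \<open>g / 4\<close> to something below
      \<open>s\<close>, which is still negative.\<close>
    obtain s :: rat where s: "- (g / 2) < of_rat s" "of_rat s < - (g / 4)"
      using of_rat_dense[of "- (g / 2)" "- (g / 4)"] g by auto
    define ps where "ps = map (\<lambda>i. (lam i, m i, e i)) [1..<Suc j]"
    have lps: "length ps = j" by (simp add: ps_def)
    have ps: "ps ! (i - 1) = (lam i, m i, e i)" if "i \<in> {1..j}" for i
      using that unfolding ps_def by (subst nth_map) (auto simp: nth_upt simp del: upt_Suc)
    have gap_ps: "support_gap f N j (\<lambda>i. of_rat (fst (ps ! (i - 1)))) (\<lambda>i. inverse (Suc (fst (snd (ps ! (i - 1)))))) v' y' t' =
        support_gap f N j (\<lambda>i. of_rat (lam i)) c v' y' t'" for v' y' t'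
      unfolding support_gap_def
        by (intro arg_cong2[of _ _ _ _ "(+)"] arg_cong[of _ _ N] sum.cong) (auto simp: ps[simplified] c_def)
    have move: "support_gap f N j (\<lambda>i. of_rat (lam i)) c v' y' s' \<le>
        support_gap f N j (\<lambda>i. of_rat (lam i)) c v' x' t' + g / 4"
      if "\<bar>s' - t'\<bar> < tau" "norm (x' - y') < tau" for v' y' s' x' t'
    proof -
      have "S * (\<bar>s' - t'\<bar> + (1 + L) * norm (x' - y')) \<le> S * (tau + (1 + L) * tau)"
        using that L by (intro mult_left_mono[OF _ S] add_mono mult_left_mono) auto
      then show ?thesis
        using support_gap_move[where f = f and N = N and L = L and j = j and lam = "\<lambda>i. of_rat (lam i)" and c = c
            and v = v' and y = y' and s = s' and x = x' and t = t', OF N NL lam0] c Stau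
        unfolding S_def by fastforce
    qed
    have "witness f N y t s ps v"
      unfolding witness_def lps gap_ps
    proof (intro conjI ballI)
      fix i assume i: "i \<in> {1..j}"
      show "f (v i) < \<infinity>" using vm[OF i] by blast
      have "norm (v i - y) \<le> norm (v i - u) + norm (u - y)"
        using norm_triangle_ineq[of "v i - u" "u - y"] by simp
      then show "norm (v i - y) < of_rat (snd (snd (ps ! (i - 1))))"
        using tau_i(1)[OF i] yu ps[OF i] by simp
    next
      have "support_gap f N j (\<lambda>i. of_rat (lam i)) c v y (of_rat t) \<le> - g + g / 4"
        using move[of "of_rat t" fu u y v] t yu by (simp add: g_def)
      then show "support_gap f N j (\<lambda>i. of_rat (lam i)) c v y (of_rat t) < of_rat s"
        using s(1) g by linarith
    qed
    then obtain v' where v': "witness f N y t s ps v'" "v' ` {1..j} \<subseteq> Q"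
      using Q y(1) unfolding rich_def lps[symmetric] by blast
    have near: "f (v' i) < \<infinity>" "norm (v' i - y) < of_rat (e i)" if "i \<in> {1..j}" for i
      using v'(1)[unfolded witness_def lps, THEN conjunct1, rule_format, OF that]
      unfolding ps[OF that] by simp_all
    have "support_gap f N j (\<lambda>i. of_rat (lam i)) c v' y (of_rat t) < of_rat s"
      using v'(1) unfolding witness_def lps gap_ps by blast
    then have "support_gap f N j (\<lambda>i. of_rat (lam i)) c v' u fu < 0"
      using move[of fu "of_rat t" y u v'] t yu s(2) by simp
    \<comment> \<open>The weighted sum of the support inequalities at points of \<open>Q\<close>
      bounds \<open>k\<close> of the combination from above, and \<open>k\<close> is at least
      \<open>- N\<close> by symmetry.\<close>
    moreover have "0 \<le> support_gap f N j (\<lambda>i. of_rat (lam i)) c v' u fu"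
    proof -
      have lin: "linear k" by (rule dual_below_linear[OF k])
      have "k (\<Sum>i=1..j. of_rat (lam i) *\<^sub>R (v' i - u)) = (\<Sum>i=1..j. of_rat (lam i) * k (v' i - u))"
        by (simp add: linear_sum[OF lin] linear_scale[OF lin])
      also have "\<dots> \<le> (\<Sum>i=1..j. of_rat (lam i) * (F (v' i) - fu + c i * norm (v' i - u)))"
      proof (intro sum_mono mult_left_mono lam0)
        fix i assume i: "i \<in> {1..j}"
        have "norm (v' i - u) \<le> norm (v' i - y) + norm (y - u)"
          using norm_triangle_ineq[of "v' i - y" "y - u"] by simp
        then have "norm (v' i - u) < d (m i)" using near(2)[OF i] yu tau_i(2)[OF i] by linarith
        then have "ereal (fu + k (v' i - u) - inverse (Suc (m i)) * norm (v' i - u)) \<le> f (v' i)"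
          using v'(2) i by (intro supp) auto
        then show "k (v' i - u) \<le> F (v' i) - fu + c i * norm (v' i - u)"
          using F[OF near(1)[OF i]] by (simp add: c_def)
      qed
      finally have "k (\<Sum>i=1..j. of_rat (lam i) *\<^sub>R (v' i - u)) \<le>
        (\<Sum>i=1..j. of_rat (lam i) * (F (v' i) - fu + c i * norm (v' i - u)))" .
      moreover have "- N (\<Sum>i=1..j. of_rat (lam i) *\<^sub>R (v' i - u)) \<le>
          k (\<Sum>i=1..j. of_rat (lam i) *\<^sub>R (v' i - u))"
        using dual_below_ge[OF k] sym by metis
      ultimately show ?thesis unfolding support_gap_def F_def by linarith
    qed
    ultimately show False by simp
  qed
  then obtain k' where k': "k' \<in> dual_below N" "\<And>w b. (w, b) \<in> T \<Longrightarrow> k' w \<le> b"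
    using dual_below_sandwich[OF N sym, of T] by blast
  have "ereal (fu + k' (v - u) - inverse (Suc m) * norm (v - u)) \<le> f v" if "norm (v - u) < d m" for m v
  proof (cases "f v < \<infinity>")
    case True
    then have "(v - u, F v - fu + inverse (Suc m) * norm (v - u)) \<in> T" using that unfolding T_def by blast
    from k'(2)[OF this] show ?thesis using F[OF True] by simp
  qed simp
  then show ?thesis using k'(1) by blast
qed

text \<open>The variational principle is run on the closure of a rich countable set, and separable
  reduction then trades its functional for one that supports \<open>f\<close> at the same point
  \<open>u\<close> in all directions.\<close>

theorem fuzzy_subgradient:
  fixes f :: "'c::real_normed_vector \<Rightarrow> ereal" and N :: "'c \<Rightarrow> real"
  assumes compl: "complete (UNIV :: 'c set)" and sep: "separable_dual TYPE('c)"
    and finite: "\<And>x. f x \<noteq> -\<infinity>"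
    and N: "sublinear N" and sym: "\<And>x. N (- x) = N x" and NL: "\<And>x. N x \<le> L * norm x" and L: "0 \<le> L"
    and r: "r > 0" and fz: "f z = ereal fz"
    and lsc: "\<And>x. x \<in> cball z r \<Longrightarrow> lsc_at f x"
    and min: "\<And>x. x \<in> cball z r \<Longrightarrow> ereal (fz - N (x - z)) \<le> f x"
    and eps: "eps > 0"
  obtains u fu k where "f u = ereal fu" "dist u z < eps" "\<bar>fu - fz\<bar> < eps"
    and "k \<in> dual_below (\<lambda>x. N x + eps * norm x)"
    and "\<And>e. e > 0 \<Longrightarrow> \<exists>d>0. \<forall>h. norm h < d \<longrightarrow> ereal (fu + k h - e * norm h) \<le> f (u + h)"
proof -
  define N' where "N' = (\<lambda>x. N x + eps * norm x)"
  have N': "sublinear N'"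
    unfolding N'_def sublinear_def
  proof (intro conjI allI impI)
    fix x y :: 'c and t :: real
    have "eps * norm (x + y) \<le> eps * (norm x + norm y)" using eps norm_triangle_ineq
      by (intro mult_left_mono) auto
    then show "N (x + y) + eps * norm (x + y) \<le> N x + eps * norm x + (N y + eps * norm y)"
      using sublinear_add[OF N, of x y] by (simp add: distrib_left)
    show "N (t *\<^sub>R x) + eps * norm (t *\<^sub>R x) = t * (N x + eps * norm x)" if "0 \<le> t"
      using sublinear_scale[OF N that, of x] that by (simp add: distrib_left)
  qed
  have sym': "N' (- x) = N' x" for x by (simp add: N'_def sym)
  have N'L: "N' x \<le> (L + eps) * norm x" for x using NL[of x] by (simp add: N'_def distrib_right)
  \<comment> \<open>Richness is required for \<open>N'\<close>, since the derivative found at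
    \<open>u\<close> is bounded by \<open>N'\<close> and not by \<open>N\<close>.\<close>
  obtain Q where Q: "countable Q" "z \<in> Q" "subspace (closure Q)" "rich f N' Q" by (rule rich_set_exists)
  obtain u k fu where u: "u \<in> closure Q" and k: "k \<in> dual_below N'" and fu: "f u = ereal fu" "dist u z < eps" "\<bar>fu - fz\<bar> < eps"
    and supp: "\<forall>e>0. \<exists>d>0. \<forall>h\<in>closure Q. norm h < d \<longrightarrow> ereal (fu - k h - e * norm h) \<le> f (u + h)"
    using smooth_variational_principle[OF compl sep Q(1,3) closed_closure order_refl N NL _ r fz lsc min eps]
      closure_subset[of Q] Q(2) unfolding N'_def by blast
  have "\<forall>m::nat. \<exists>d>0. \<forall>h\<in>closure Q. norm h < d \<longrightarrow> ereal (fu - k h - inverse (Suc m) * norm h) \<le> f (u + h)"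
    using supp by simp
  from choice[OF this] obtain d where d: "\<And>m. d m > 0"
    and dm: "\<And>m h. h \<in> closure Q \<Longrightarrow> norm h < d m \<Longrightarrow>
        ereal (fu - k h - inverse (Suc m) * norm h) \<le> f (u + h)" by blast
  have lin: "linear k" by (rule dual_below_linear[OF k])
  have k': "(\<lambda>h. - k h) \<in> dual_below N'"
  proof -
    have "- k x \<le> N' x" for x using dual_below_ge[OF k, of x] sym'[of x] by simp
    then show ?thesis using linear_compose_neg[OF lin] by (simp add: dual_below_def)
  qed
  have "\<exists>k\<in>dual_below N'. \<forall>m v. norm (v - u) < d m \<longrightarrow> ereal (fu + k (v - u) - inverse (Suc m) * norm (v - u)) \<le> f v"
  proof (rule separable_reduction[OF N' sym' N'L _ finite Q(4) u fu(1) k' d])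
    show "0 \<le> L + eps" using L eps by simp
    fix m v assume v: "v \<in> Q" "norm (v - u) < d m"
    have "v - u \<in> closure Q" using subspace_diff[OF Q(3) _ u] v(1) closure_subset by blast
    from dm[OF this v(2)] show "ereal (fu + - k (v - u) - inverse (Suc m) * norm (v - u)) \<le> f v" by simp
  qed
  then obtain k2 where k2: "k2 \<in> dual_below N'"
    and k2s: "\<And>m v. norm (v - u) < d m \<Longrightarrow>
        ereal (fu + k2 (v - u) - inverse (Suc m) * norm (v - u)) \<le> f v" by blast
  have "\<exists>d>0. \<forall>h. norm h < d \<longrightarrow> ereal (fu + k2 h - e * norm h) \<le> f (u + h)" if e: "e > 0" for e
  proof -
    obtain m where m: "inverse (real (Suc m)) < e" using reals_Archimedean[OF e] by blast
    have "ereal (fu + k2 h - e * norm h) \<le> f (u + h)" if h: "norm h < d m" for h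
    proof -
      have "inverse (real (Suc m)) * norm h \<le> e * norm h" using m by (intro mult_right_mono) auto
      then have "ereal (fu + k2 h - e * norm h) \<le>
          ereal (fu + k2 h - inverse (real (Suc m)) * norm h)" by simp
      also have "\<dots> \<le> f (u + h)" using k2s[of "u + h" m] h by simp
      finally show ?thesis .
    qed
    then show ?thesis using d by blast
  qed
  then show thesis using that fu k2 unfolding N'_def by blast
qed

section \<open>Slopes and subdifferential slopes\<close>

lemma complete_UNIV_prod:
  assumes "complete (UNIV :: 'a::real_normed_vector set)" "complete (UNIV :: 'b::real_normed_vector set)"
  shows "complete (UNIV :: ('a \<times> 'b) set)"
  unfolding complete_def
proof (intro allI impI)
  fix X :: "nat \<Rightarrow> 'a \<times> 'b" assume "(\<forall>n. X n \<in> UNIV) \<and> Cauchy X"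
  then have X: "Cauchy (\<lambda>n. fst (X n))" "Cauchy (\<lambda>n. snd (X n))" by (auto intro: Cauchy_fst Cauchy_snd)
  then obtain x y where "(\<lambda>n. fst (X n)) \<longlonglongrightarrow> x" "(\<lambda>n. snd (X n)) \<longlonglongrightarrow> y"
    using assms unfolding complete_def by blast
  then have "X \<longlonglongrightarrow> (x, y)" using tendsto_Pair by fastforce
  then show "\<exists>l\<in>UNIV. X \<longlonglongrightarrow> l" by blast
qed

section \<open>Frechet subgradients and the upper bound for the slope\<close>

lemma frechet_subdiffD:
  assumes fz: "f z = ereal fz" and xy: "(xs, ys) \<in> frechet_subdiff f z" and e: "e > 0"
  shows "eventually (\<lambda>w. ereal (fz + (blinfun_apply xs (fst (w - z)) + blinfun_apply ys (snd (w - z))) - e * norm (w - z)) \<le> f w) (at z)"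
proof -
  have "ereal (- e) < Liminf (at z) (\<lambda>w. (f w - f z -
           ereal (blinfun_apply xs (fst (w - z)) + blinfun_apply ys (snd (w - z))))
         / ereal (norm (w - z)))"
    using xy e unfolding frechet_subdiff_def by (auto intro: less_le_trans[of _ 0])
  then have "eventually (\<lambda>w. ereal (- e) < (f w - f z -
           ereal (blinfun_apply xs (fst (w - z)) + blinfun_apply ys (snd (w - z))))
         / ereal (norm (w - z))) (at z)" by (rule less_LiminfD)
  moreover have "eventually (\<lambda>w. w \<noteq> z) (at z)" by (rule eventually_neq_at_within)
  ultimately show ?thesis
  proof eventually_elim
    case (elim w)
    then have "0 < ereal (norm (w - z))" by simp
    then have "ereal (- e) * ereal (norm (w - z)) < f w - f z - ereal (blinfun_apply xs (fst (w - z)) + blinfun_apply ys (snd (w - z)))"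
      using elim(1) by (subst (asm) ereal_less_divide_iff) auto
    then show ?case using fz by (cases "f w") auto
  qed
qed

lemma frechet_subdiffI:
  assumes fz: "f z = ereal fz"
    and ev: "\<And>e. e > 0 \<Longrightarrow> eventually (\<lambda>w. ereal (fz + (blinfun_apply xs (fst (w - z)) + blinfun_apply ys (snd (w - z))) - e * norm (w - z)) \<le> f w) (at z)"
  shows "(xs, ys) \<in> frechet_subdiff f z"
  unfolding frechet_subdiff_def mem_Collect_eq prod.case le_Liminf_iff
proof (intro allI impI)
  fix y :: ereal assume "y < 0"
  then obtain c where c: "y < ereal c" "ereal c < 0" using ereal_dense2 by blast
  then have "- c > 0" by simp
  have "eventually (\<lambda>w. w \<noteq> z) (at z)" by (rule eventually_neq_at_within)
  with ev[OF \<open>- c > 0\<close>] show "eventually (\<lambda>w. y < (f w - f z -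
           ereal (blinfun_apply xs (fst (w - z)) + blinfun_apply ys (snd (w - z))))
         / ereal (norm (w - z))) (at z)"
  proof eventually_elim
    case (elim w)
    then have n: "0 < ereal (norm (w - z))" by simp
    have "ereal (norm (w - z)) * ereal c \<le>
        f w - f z - ereal (blinfun_apply xs (fst (w - z)) + blinfun_apply ys (snd (w - z)))"
      using elim(1) fz by (cases "f w") (auto simp: algebra_simps)
    then have "ereal c \<le> (f w - f z - ereal (blinfun_apply xs (fst (w - z)) + blinfun_apply ys (snd (w - z))))
         / ereal (norm (w - z))" using n by (subst ereal_le_divide_pos) auto
    with c(1) show ?case by (rule less_le_trans)
  qed
qed

lemma rho_dist_pos: "w \<noteq> z \<Longrightarrow> \<rho> > 0 \<Longrightarrow> 0 < rho_dist \<rho> w z"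
  unfolding rho_dist_def by (cases w; cases z) (auto simp: less_max_iff_disj)

lemma rho_slope_nonneg: "0 \<le> rho_slope \<rho> f z"
  by (simp add: rho_slope_def)

text \<open>If \<open>D\<close> is the \<open>rho_dist\<close> of the increment, its second
  component has norm at most \<open>D / \<rho>\<close>. A functional of norm below
  \<open>\<rho>\<^sup>2\<close> changes it by at most \<open>\<rho> * D\<close>; this is why the
  square appears on the right.\<close>

lemma rho_slope_le_subdiff:
  fixes f :: "'a::real_normed_vector \<times> 'b::real_normed_vector \<Rightarrow> ereal"
  assumes fz: "f z = ereal fz" and rho: "\<rho> > 0"
  shows "rho_slope \<rho> f z \<le> subdiff_rho_slope (\<rho>\<^sup>2) f z + ereal \<rho>"
proof -
  have "rho_slope \<rho> f z \<le> ereal (norm xs) + ereal \<rho>"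
    if xy: "(xs, ys) \<in> frechet_subdiff f z" and ys: "norm ys < \<rho>\<^sup>2" for xs ys
  proof -
    have "Limsup (at z) (\<lambda>w. max (f z - f w) 0 / ereal (rho_dist \<rho> w z)) \<le> ereal (norm xs + \<rho>)"
      unfolding Limsup_le_iff
    proof (intro allI impI)
      fix y :: ereal assume "ereal (norm xs + \<rho>) < y"
      then obtain c where c: "norm xs + \<rho> < c" "ereal c < y" using ereal_dense2
        by (metis less_ereal.simps(1))
      \<comment> \<open>The error of the subgradient is measured in the product norm, which is at
        most \<open>1 + 1 / \<rho>\<close> times \<open>rho_dist\<close>.\<close>
      define e where "e = (c - (norm xs + \<rho>)) / (1 + 1 / \<rho>)"
      have e: "e > 0" using c(1) rho by (simp add: e_def add_pos_pos)
      have ec: "norm xs + \<rho> + e * (1 + 1 / \<rho>) = c"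
      proof -
        have "1 + 1 / \<rho> \<noteq> 0" using rho by (smt (verit) divide_pos_pos)
        then show ?thesis by (simp add: e_def)
      qed
      have "eventually (\<lambda>w. w \<noteq> z) (at z)" by (rule eventually_neq_at_within)
      with frechet_subdiffD[OF fz xy e]
      show "eventually (\<lambda>w. max (f z - f w) 0 / ereal (rho_dist \<rho> w z) < y) (at z)"
      proof eventually_elim
        case (elim w)
        define D where "D = rho_dist \<rho> w z"
        have D: "D > 0" using rho_dist_pos[OF elim(2) rho] by (simp add: D_def)
        define hx where "hx = fst (w - z)"
        define hy where "hy = snd (w - z)"
        have a: "norm hx \<le> D" by (simp add: D_def rho_dist_def hx_def dist_norm)
        have "\<rho> * norm hy \<le> D" by (simp add: D_def rho_dist_def hy_def dist_norm)
        then have b: "norm hy \<le> D / \<rho>" using rho by (simp add: field_simps)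
        have "norm (w - z) \<le> norm hx + norm hy"
          unfolding hx_def hy_def by (metis norm_Pair_le prod.collapse)
        then have n: "norm (w - z) \<le> D * (1 + 1 / \<rho>)" using a b by (simp add: algebra_simps)
        have "- blinfun_apply xs hx \<le> norm xs * norm hx" using norm_blinfun[of xs hx] by simp
        also have "\<dots> \<le> norm xs * D" using a by (intro mult_left_mono) auto
        finally have 1: "- blinfun_apply xs hx \<le> norm xs * D" .
        have "- blinfun_apply ys hy \<le> norm ys * norm hy" using norm_blinfun[of ys hy] by simp
        also have "\<dots> \<le> \<rho>\<^sup>2 * (D / \<rho>)" using ys b by (intro mult_mono) auto
        also have "\<dots> = \<rho> * D" using rho by (simp add: power2_eq_square)
        finally have 2: "- blinfun_apply ys hy \<le> \<rho> * D" .
        have 3: "e * norm (w - z) \<le> e * (D * (1 + 1 / \<rho>))" using e n by (intro mult_left_mono) auto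
        have "norm xs * D + \<rho> * D + e * (D * (1 + 1 / \<rho>)) = D * c" unfolding ec[symmetric]
          by (simp only: algebra_simps)
        then have "- (blinfun_apply xs hx + blinfun_apply ys hy) + e * norm (w - z) \<le> D * c"
          using 1 2 3 by linarith
        then have "max (f z - f w) 0 \<le> ereal D * ereal c"
          using elim(1) D c(1) rho fz unfolding hx_def[symmetric] hy_def[symmetric]
          by (cases "f w") (auto intro!: mult_nonneg_nonneg add_nonneg_nonneg intro: order_trans[OF _ less_imp_le[OF c(1)]])
        then have "max (f z - f w) 0 / ereal D \<le> ereal c" using D by (subst ereal_divide_le_pos) auto
        then show ?case using c(2) unfolding D_def by (rule le_less_trans)
      qed
    qed
    moreover have "0 \<le> ereal (norm xs + \<rho>)" using rho by simp
    ultimately show ?thesis unfolding rho_slope_def by simp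
  qed
  then have "rho_slope \<rho> f z - ereal \<rho> \<le> subdiff_rho_slope (\<rho>\<^sup>2) f z"
    unfolding subdiff_rho_slope_def by (intro INF_greatest) (auto simp: ereal_minus_le)
  then show ?thesis by (simp add: ereal_minus_le)
qed

lemma ereal_divide_antimono:
  fixes a :: ereal
  assumes "0 \<le> a" "0 < d" "d \<le> d'"
  shows "a / ereal d' \<le> a / ereal d"
  using assms by (cases a) (auto intro!: divide_left_mono)

section \<open>Monotonicity in the parameter and the limits as suprema\<close>

lemma rho_slope_antimono:
  assumes "0 < r" "r \<le> s"
  shows "rho_slope s f z \<le> rho_slope r f z"
proof -
  have "eventually (\<lambda>w. w \<noteq> z) (at z)" by (rule eventually_neq_at_within)
  then have "eventually (\<lambda>w. max (f z - f w) 0 / ereal (rho_dist s w z) \<le>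
      max (f z - f w) 0 / ereal (rho_dist r w z)) (at z)"
  proof eventually_elim
    case (elim w)
    have p: "0 < rho_dist r w z" "0 < rho_dist s w z" using rho_dist_pos[OF elim] assms by auto
    have "r * dist (snd w) (snd z) \<le> s * dist (snd w) (snd z)" using assms by (intro mult_right_mono) auto
    then have "rho_dist r w z \<le> rho_dist s w z" unfolding rho_dist_def by auto
    then show ?case using p by (intro ereal_divide_antimono) auto
  qed
  then show ?thesis unfolding rho_slope_def by (intro max.mono Limsup_mono) auto
qed

lemma subdiff_rho_slope_antimono:
  assumes "r \<le> s"
  shows "subdiff_rho_slope s f z \<le> subdiff_rho_slope r f z"
  unfolding subdiff_rho_slope_def using assms by (intro INF_superset_mono) auto

lemma Lim_at_right_antimono:
  fixes \<phi> :: "real \<Rightarrow> ereal"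
  assumes anti: "\<And>r s. 0 < r \<Longrightarrow> r \<le> s \<Longrightarrow> \<phi> s \<le> \<phi> r"
  shows "Lim (at_right 0) \<phi> = (SUP r\<in>{0<..}. \<phi> r)"
proof (rule tendsto_Lim)
  show "(\<phi> \<longlongrightarrow> (SUP r\<in>{0<..}. \<phi> r)) (at_right 0)"
  proof (rule order_tendstoI)
    fix a assume "a < (SUP r\<in>{0<..}. \<phi> r)"
    then obtain r where r: "r > 0" "a < \<phi> r" by (auto simp: less_SUP_iff)
    show "eventually (\<lambda>s. a < \<phi> s) (at_right 0)"
      using r anti by (intro eventually_at_rightI[of 0 r]) (auto intro: less_le_trans)
  next
    fix a assume a: "(SUP r\<in>{0<..}. \<phi> r) < a"
    have "\<phi> s < a" if "s > 0" for s using le_less_trans[OF SUP_upper a, of s] that by simp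
    then show "eventually (\<lambda>s. \<phi> s < a) (at_right 0)" by (intro eventually_at_rightI[of 0 1]) auto
  qed
qed simp

definition outer_set :: "('a::metric_space \<times> 'b::metric_space \<Rightarrow> ereal) \<Rightarrow> 'a \<times> 'b \<Rightarrow> real \<Rightarrow> ('a \<times> 'b) set" where
  "outer_set f zb \<rho> = {z. dist (fst z) (fst zb) < \<rho> \<and> 0 < f z \<and> f z < ereal \<rho>}"

lemma outer_set_mono: "r \<le> s \<Longrightarrow> outer_set f zb r \<subseteq> outer_set f zb s"
  unfolding outer_set_def by (auto intro: less_le_trans)

lemma strict_outer_slope_SUP:
  "strict_outer_slope f zb = (SUP r\<in>{0<..}. INF z\<in>outer_set f zb r. rho_slope r f z)"
  unfolding strict_outer_slope_def outer_set_def[symmetric]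
  by (intro Lim_at_right_antimono INF_mono') (auto intro: INF_mono[OF bexI] rho_slope_antimono dest: subsetD[OF outer_set_mono])

lemma strict_outer_subdiff_slope_SUP:
  "strict_outer_subdiff_slope f zb = (SUP r\<in>{0<..}. INF z\<in>outer_set f zb r. subdiff_rho_slope r f z)"
  unfolding strict_outer_subdiff_slope_def outer_set_def[symmetric]
  by (intro Lim_at_right_antimono INF_mono') (auto intro: INF_mono[OF bexI] subdiff_rho_slope_antimono dest: subsetD[OF outer_set_mono])

text \<open>The pointwise estimate at \<open>s\<close> pairs the slope with the subdifferential
  slope at the square of \<open>s\<close>. The latter is still a legitimate parameter in the
  supremum on the right, and for \<open>s\<close> at most 1 its outer set lies in the one for
  \<open>r\<close>.\<close>

lemma strict_outer_slope_le:
  fixes f :: "'a::real_normed_vector \<times> 'b::real_normed_vector \<Rightarrow> ereal"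
  shows "strict_outer_slope f zb \<le> strict_outer_subdiff_slope f zb"
proof (unfold strict_outer_slope_SUP, rule SUP_least, rule ereal_le_epsilon2)
  fix r e :: real assume r: "r \<in> {0<..}" and e: "0 < e"
  define s where "s = min (min r e) 1"
  have s: "s > 0" "s \<le> r" "s \<le> e" "s \<le> 1" using r e by (auto simp: s_def)
  have s2: "s\<^sup>2 \<le> s" using mult_left_mono[OF s(4), of s] s(1) by (simp add: power2_eq_square)
  have "(INF z\<in>outer_set f zb r. rho_slope r f z) - ereal s \<le>
      (INF z\<in>outer_set f zb (s\<^sup>2). subdiff_rho_slope (s\<^sup>2) f z)"
  proof (rule INF_greatest)
    fix z assume z: "z \<in> outer_set f zb (s\<^sup>2)"
    then obtain fz where fz: "f z = ereal fz" by (cases "f z") (auto simp: outer_set_def)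
    have "z \<in> outer_set f zb r" using z outer_set_mono[of "s\<^sup>2" r f zb] s s2 by auto
    then have "(INF z\<in>outer_set f zb r. rho_slope r f z) \<le> rho_slope r f z" by (rule INF_lower)
    also have "\<dots> \<le> rho_slope s f z" using s by (intro rho_slope_antimono) auto
    also have "\<dots> \<le> subdiff_rho_slope (s\<^sup>2) f z + ereal s" using fz s(1) by (rule rho_slope_le_subdiff)
    finally show "(INF z\<in>outer_set f zb r. rho_slope r f z) - ereal s \<le> subdiff_rho_slope (s\<^sup>2) f z"
      by (simp add: ereal_minus_le)
  qed
  also have "\<dots> \<le> strict_outer_subdiff_slope f zb"
    unfolding strict_outer_subdiff_slope_SUP using s(1) by (intro SUP_upper) auto
  finally have "(INF z\<in>outer_set f zb r. rho_slope r f z) \<le> strict_outer_subdiff_slope f zb + ereal s"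
    by (simp add: ereal_minus_le)
  also have "\<dots> \<le> strict_outer_subdiff_slope f zb + ereal e" using s(3) by (intro add_left_mono) auto
  finally show "(INF z\<in>outer_set f zb r. rho_slope r f z) \<le> strict_outer_subdiff_slope f zb + ereal e" .
qed

section \<open>The reverse inequality in Asplund spaces\<close>

lemma P2_dist_le:
  assumes "P2 f yb"
  obtains c \<delta> where "c > 0" "\<delta> > 0" "\<And>z. 0 < f z \<Longrightarrow> f z < ereal \<delta> \<Longrightarrow> ereal (c * dist (snd z) yb) \<le> f z"
proof -
  obtain c where c: "0 < ereal c" "ereal c < Liminf (filtercomap f (at_right 0)) (\<lambda>z. f z / ereal (dist (snd z) yb))"
    using assms ereal_dense2 unfolding P2_def by blast
  have "eventually (\<lambda>z. ereal c < f z / ereal (dist (snd z) yb)) (filtercomap f (at_right 0))"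
    by (rule less_LiminfD[OF c(2)])
  then obtain P where P: "eventually P (at_right (0::ereal))" and Pf: "\<And>z. P (f z) \<Longrightarrow>
      ereal c < f z / ereal (dist (snd z) yb)"
    unfolding eventually_filtercomap by blast
  obtain b where b: "b > 0" "\<And>y. 0 < y \<Longrightarrow> y < b \<Longrightarrow> P y"
    using P eventually_at_right[of "0::ereal" 1 P] by auto
  obtain \<delta> where d: "0 < ereal \<delta>" "ereal \<delta> < b" using ereal_dense2 b(1) by blast
  show thesis
  proof (rule that[of c \<delta>])
    show "c > 0" "\<delta> > 0" using c(1) d(1) by auto
    fix z assume z: "0 < f z" "f z < ereal \<delta>"
    show "ereal (c * dist (snd z) yb) \<le> f z"
    \<comment> \<open>At distance zero the quotient is infinite and says nothing; positivity of
      \<open>f z\<close> suffices there.\<close>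
    proof (cases "dist (snd z) yb = 0")
      case True
      then show ?thesis using z(1) by (simp add: less_imp_le flip: zero_ereal_def)
    next
      case False
      then have p: "0 < ereal (dist (snd z) yb)" by simp
      have "ereal c < f z / ereal (dist (snd z) yb)" using z d b(2) by (intro Pf) auto
      then have "ereal c * ereal (dist (snd z) yb) < f z" using p
        by (subst (asm) ereal_less_divide_iff) auto
      then show ?thesis by simp
    qed
  qed
qed

lemma local_slope_bound:
  assumes fz: "f z = ereal fz" and slope: "rho_slope \<rho> f z < ereal \<gamma>" and rho: "\<rho> > 0"
  obtains t where "t > 0" "\<And>w. dist w z < t \<Longrightarrow> ereal (fz - \<gamma> * rho_dist \<rho> w z) \<le> f w"
proof -
  have "Limsup (at z) (\<lambda>w. max (f z - f w) 0 / ereal (rho_dist \<rho> w z)) < ereal \<gamma>"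
    using slope by (simp add: rho_slope_def)
  then have "eventually (\<lambda>w. max (f z - f w) 0 / ereal (rho_dist \<rho> w z) < ereal \<gamma>) (at z)"
    by (rule Limsup_lessD)
  then obtain t where t: "t > 0"
    and tw: "\<And>w. w \<noteq> z \<Longrightarrow> dist w z < t \<Longrightarrow> max (f z - f w) 0 / ereal (rho_dist \<rho> w z) < ereal \<gamma>"
    unfolding eventually_at by auto
  have "ereal (fz - \<gamma> * rho_dist \<rho> w z) \<le> f w" if "dist w z < t" for w
  proof (cases "w = z")
    case True
    then show ?thesis using fz by (simp add: rho_dist_def)
  next
    case False
    have "max (f z - f w) 0 < ereal \<gamma> * ereal (rho_dist \<rho> w z)"
      using tw[OF False that] rho_dist_pos[OF False rho] by (subst (asm) ereal_divide_less_iff) auto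
    then show ?thesis using fz by (cases "f w") auto
  qed
  with t show thesis by (rule that)
qed

lemma split_functional:
  fixes k :: "'a::real_normed_vector \<times> 'b::real_normed_vector \<Rightarrow> real"
  assumes k: "k \<in> dual_below (\<lambda>h. a * norm (fst h) + b * norm (snd h) + e * norm h)"
    and a: "0 \<le> a" and b: "0 \<le> b" and e: "0 \<le> e"
  obtains xs ys where "norm xs \<le> a + e" "norm ys \<le>
      b + e" "\<And>h. k h = blinfun_apply xs (fst h) + blinfun_apply ys (snd h)"
proof -
  have lin: "linear k" by (rule dual_below_linear[OF k])
  have abs: "\<bar>k h\<bar> \<le> a * norm (fst h) + b * norm (snd h) + e * norm h" for h
    by (rule dual_below_abs_le[OF k]) simp
  have x: "bounded_linear (\<lambda>x. k (x, 0))"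
  proof (rule bounded_linear_intro[where K = "a + e"])
    show "k (x + y, 0) = k (x, 0) + k (y, 0)" for x y using linear_add[OF lin, of "(x, 0)" "(y, 0)"] by simp
    show "k (r *\<^sub>R x, 0) = r *\<^sub>R k (x, 0)" for r x using linear_scale[OF lin, of r "(x, 0)"] by simp
    show "norm (k (x, 0)) \<le> norm x * (a + e)" for x using abs[of "(x, 0)"] by (simp add: algebra_simps)
  qed
  have y: "bounded_linear (\<lambda>y. k (0, y))"
  proof (rule bounded_linear_intro[where K = "b + e"])
    show "k (0, x + y) = k (0, x) + k (0, y)" for x y using linear_add[OF lin, of "(0, x)" "(0, y)"] by simp
    show "k (0, r *\<^sub>R x) = r *\<^sub>R k (0, x)" for r x using linear_scale[OF lin, of r "(0, x)"] by simp
    show "norm (k (0, y)) \<le> norm y * (b + e)" for y using abs[of "(0, y)"] by (simp add: algebra_simps)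
  qed
  show thesis
  proof (rule that[of "Blinfun (\<lambda>x. k (x, 0))" "Blinfun (\<lambda>y. k (0, y))"])
    show "norm (Blinfun (\<lambda>x. k (x, 0))) \<le> a + e"
      using a e abs[of "(_, 0)"]
        by (intro norm_blinfun_bound) (auto simp: bounded_linear_Blinfun_apply[OF x] algebra_simps)
    show "norm (Blinfun (\<lambda>y. k (0, y))) \<le> b + e"
      using b e abs[of "(0, _)"]
        by (intro norm_blinfun_bound) (auto simp: bounded_linear_Blinfun_apply[OF y] algebra_simps)
    show "k h = blinfun_apply (Blinfun (\<lambda>x. k (x, 0))) (fst h) + blinfun_apply (Blinfun (\<lambda>y. k (0, y))) (snd h)" for h
      using linear_add[OF lin, of "(fst h, 0)" "(0, snd h)"]
      by (simp add: bounded_linear_Blinfun_apply[OF x] bounded_linear_Blinfun_apply[OF y])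
  qed
qed

text \<open>The slope bound and the lower semicontinuity are transferred to
  \<open>pos_part f\<close>, to which the fuzzy result applies. At \<open>u\<close> the value is
  positive, and lower semicontinuity keeps \<open>pos_part f\<close> positive nearby, so it
  coincides with \<open>f\<close> around \<open>u\<close> and the subgradient is one of
  \<open>f\<close>. The seminorm \<open>N\<close> replaces the maximum in \<open>rho_dist\<close> by
  the larger sum.\<close>

lemma subgradient_near:
  fixes f :: "'a::real_normed_vector \<times> 'b::real_normed_vector \<Rightarrow> ereal"
  assumes compl: "complete (UNIV :: ('a \<times> 'b) set)" and sep: "separable_dual TYPE('a \<times> 'b)"
    and fz: "f z = ereal fz" "fz > 0" and slope: "rho_slope \<rho> f z < ereal \<gamma>" and rho: "\<rho> > 0" and gam: "\<gamma> > 0"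
    and eta: "eta > 0" and lsc: "\<And>w. dist w z < eta \<Longrightarrow> lsc_at (pos_part f) w" and eps: "eps > 0"
  obtains u fu xs ys where "f u = ereal fu" "fu > 0" "\<bar>fu - fz\<bar> < eps" "dist u z < eps" "(xs, ys) \<in> frechet_subdiff f u"
    "norm xs \<le> \<gamma> + eps" "norm ys \<le> \<gamma> * \<rho> + eps"
proof -
  let ?g = "pos_part f"
  define N where "N = (\<lambda>h :: 'a \<times> 'b. \<gamma> * norm (fst h) + \<gamma> * \<rho> * norm (snd h))"
  have sub: "sublinear N"
    unfolding sublinear_def
  proof (intro conjI allI impI)
    fix x y :: "'a \<times> 'b" and t :: real
    have "\<gamma> * norm (fst (x + y)) \<le> \<gamma> * (norm (fst x) + norm (fst y))"
      using gam by (intro mult_left_mono) (auto simp: norm_triangle_ineq)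
    moreover have "\<gamma> * \<rho> * norm (snd (x + y)) \<le> \<gamma> * \<rho> * (norm (snd x) + norm (snd y))"
      using gam rho by (intro mult_left_mono) (auto simp: norm_triangle_ineq)
    ultimately show "N (x + y) \<le> N x + N y" unfolding N_def by (simp only: distrib_left)
    show "N (t *\<^sub>R x) = t * N x" if "0 \<le> t" using that by (simp add: N_def algebra_simps)
  qed
  have NL: "N h \<le> (\<gamma> + \<gamma> * \<rho>) * norm h" for h
  proof -
    have "norm (fst h) \<le> norm h" "norm (snd h) \<le> norm h"
      using norm_fst_le[of "fst h" "snd h"] norm_snd_le[of "snd h" "fst h"] by auto
    then have "\<gamma> * norm (fst h) \<le> \<gamma> * norm h" "\<gamma> * \<rho> * norm (snd h) \<le> \<gamma> * \<rho> * norm h"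
      using gam rho by (auto intro!: mult_left_mono)
    then show ?thesis by (simp add: N_def distrib_right)
  qed
  obtain t where t: "t > 0" and tw: "\<And>w. dist w z < t \<Longrightarrow> ereal (fz - \<gamma> * rho_dist \<rho> w z) \<le> f w"
    using local_slope_bound[OF fz(1) slope rho] by blast
  define r where "r = min t eta / 2"
  have r: "r > 0" "r < t" "r < eta" using t eta by (auto simp: r_def)
  have gz: "?g z = ereal fz" using fz by (simp add: pos_part_def)
  have g_min: "ereal (fz - N (w - z)) \<le> ?g w" if w: "w \<in> cball z r" for w
  proof -
    have "dist (fst w) (fst z) + \<rho> * dist (snd w) (snd z) \<ge> rho_dist \<rho> w z" using rho
      by (simp add: rho_dist_def)
    then have "\<gamma> * rho_dist \<rho> w z \<le> \<gamma> * (dist (fst w) (fst z) + \<rho> * dist (snd w) (snd z))"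
      using gam by (intro mult_left_mono) auto
    also have "\<dots> = N (w - z)" by (simp add: N_def dist_norm algebra_simps)
    finally have "ereal (fz - N (w - z)) \<le> ereal (fz - \<gamma> * rho_dist \<rho> w z)" by simp
    also have "\<dots> \<le> f w" using w r(2) by (intro tw) (simp add: dist_commute)
    also have "\<dots> \<le> ?g w" by (simp add: pos_part_def)
    finally show ?thesis .
  qed
  have g_fin: "?g w \<noteq> -\<infinity>" for w by (simp add: pos_part_def max_def)
  have g_lsc: "lsc_at ?g w" if "w \<in> cball z r" for w using that r(3) by (intro lsc) (simp add: dist_commute)
  \<comment> \<open>The bound by \<open>fz\<close> makes \<open>fu\<close> positive, and the bound
    by \<open>eta\<close> keeps \<open>u\<close> where lower semicontinuity is known.\<close>
  define eps' where "eps' = min eps (min fz eta)"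
  have eps': "eps' > 0" "eps' \<le> eps" "eps' \<le> fz" "eps' \<le> eta" using eps fz(2) eta by (auto simp: eps'_def)
  have L0: "0 \<le> \<gamma> + \<gamma> * \<rho>" using gam rho by simp
  have sym: "N (- x) = N x" for x by (simp add: N_def)
  obtain u fu k where gu: "?g u = ereal fu" and u: "dist u z < eps'" "\<bar>fu - fz\<bar> < eps'"
    and k: "k \<in> dual_below (\<lambda>x. N x + eps' * norm x)"
    and supp: "\<And>e. e > 0 \<Longrightarrow> \<exists>d>0. \<forall>h. norm h < d \<longrightarrow> ereal (fu + k h - e * norm h) \<le> ?g (u + h)"
    using fuzzy_subgradient[OF compl sep g_fin sub sym NL L0 r(1) gz g_lsc g_min eps'(1)] by blast
  have fu: "fu > 0" using u(2) eps'(3) by linarith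
  have f_eq: "f w = ?g w" if "0 < ?g w" for w using that
    by (auto simp: pos_part_def max_def split: if_splits)
  have fu': "f u = ereal fu" using f_eq[of u] gu fu by simp
  have g_pos: "eventually (\<lambda>w. 0 < ?g w) (at u)"
  proof -
    have "lsc_at ?g u" using u(1) eps'(4) by (intro lsc) simp
    then have "0 < Liminf (at u) ?g" using gu fu
      by (auto simp: lsc_at_def intro: less_le_trans[of _ "ereal fu"])
    then show ?thesis by (rule less_LiminfD)
  qed
  obtain xs ys where xy: "norm xs \<le> \<gamma> + eps'" "norm ys \<le> \<gamma> * \<rho> + eps'"
    "\<And>h. k h = blinfun_apply xs (fst h) + blinfun_apply ys (snd h)"
    using split_functional[OF k[unfolded N_def]] gam rho eps'(1) by (metis less_imp_le mult_pos_pos)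
  have "(xs, ys) \<in> frechet_subdiff f u"
  proof (rule frechet_subdiffI[where f = f and z = u and fz = fu, OF fu'])
    fix e :: real assume "e > 0"
    then obtain d where d: "d > 0" "\<And>h. norm h < d \<Longrightarrow> ereal (fu + k h - e * norm h) \<le> ?g (u + h)"
      using supp by blast
    have "eventually (\<lambda>w. dist w u < d) (at u)" using d(1) by (auto simp: eventually_at)
    with g_pos show "eventually (\<lambda>w. ereal (fu + (blinfun_apply xs (fst (w - u)) + blinfun_apply ys (snd (w - u))) - e * norm (w - u)) \<le> f w) (at u)"
    proof eventually_elim
      case (elim w)
      have "ereal (fu + k (w - u) - e * norm (w - u)) \<le> ?g (u + (w - u))" using elim(2)
        by (intro d(2)) (simp add: dist_norm)
      then show ?case using f_eq[OF elim(1)] by (simp add: xy(3))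
    qed
  qed
  moreover have "\<bar>fu - fz\<bar> < eps" "dist u z < eps" "norm xs \<le> \<gamma> + eps" "norm ys \<le> \<gamma> * \<rho> + eps"
    using u xy(1,2) eps'(2) by linarith+
  ultimately show thesis using that fu' fu by blast
qed

lemma strict_outer_slope_ge:
  fixes f :: "'a::real_normed_vector \<times> 'b::real_normed_vector \<Rightarrow> ereal"
  assumes P2: "P2 f yb" and asp: "asplund TYPE('a)" "asplund TYPE('b)" and lsc: "lsc_near (pos_part f) (xb, yb)"
  shows "strict_outer_subdiff_slope f (xb, yb) \<le> strict_outer_slope f (xb, yb)"
proof (rule dense_ge)
  fix g assume g: "strict_outer_slope f (xb, yb) < g"
  have compl: "complete (UNIV :: ('a \<times> 'b) set)" using asp
    by (intro complete_UNIV_prod) (auto simp: asplund_def)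
  have sep: "separable_dual TYPE('a \<times> 'b)" by (intro separable_dual_prod asplund_separable_dual asp)
  have slope_le: "(INF z\<in>outer_set f (xb, yb) s. rho_slope s f z) \<le>
      strict_outer_slope f (xb, yb)" if "s > 0" for s
    unfolding strict_outer_slope_SUP using that by (intro SUP_upper) auto
  have "0 \<le> strict_outer_slope f (xb, yb)"
    using slope_le[of 1] rho_slope_nonneg by (meson INF_greatest order_trans zero_less_one)
  then have g0: "0 < g" using g by simp
  show "strict_outer_subdiff_slope f (xb, yb) \<le> g"
  proof (cases g)
    case (real \<gamma>)
    then have gam: "\<gamma> > 0" using g0 by simp
    obtain c \<delta> where c: "c > 0" "\<delta> > 0" "\<And>z. 0 < f z \<Longrightarrow> f z < ereal \<delta> \<Longrightarrow> ereal (c * dist (snd z) yb) \<le> f z"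
      using P2_dist_le[OF P2] by blast
    obtain eta where eta: "eta > 0" "\<And>w. dist w (xb, yb) < eta \<Longrightarrow> lsc_at (pos_part f) w"
      using lsc unfolding lsc_near_def eventually_nhds_metric by blast
    have "(INF z\<in>outer_set f (xb, yb) r. subdiff_rho_slope r f z) \<le> g" if r: "r > 0" for r
    proof (rule ereal_le_epsilon2)
      fix e :: real assume e: "e > 0"
      \<comment> \<open>The bounds by \<open>\<delta>\<close>, \<open>eta / 4\<close> and
        \<open>c * eta / 4\<close> put \<open>z\<close> within \<open>eta / 2\<close> of the base
        point by means of \<open>P2\<close>. The last two, together with
        \<open>eps <= r / 4\<close>, place \<open>u\<close> in the outer set for \<open>r\<close>
        and give \<open>norm ys < r\<close>.\<close>
      define s where "s = Min {\<delta>, eta / 4, c * eta / 4, r / 4, r / (4 * \<gamma>)}"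
      have s: "s > 0" "s \<le> \<delta>" "s \<le> eta / 4" "s \<le> c * eta / 4" "s \<le> r / 4" "s \<le> r / (4 * \<gamma>)"
        using c eta r gam by (auto simp: s_def)
      have "(INF z\<in>outer_set f (xb, yb) s. rho_slope s f z) < g" using slope_le[OF s(1)] g
        by (rule le_less_trans)
      then obtain z where z: "z \<in> outer_set f (xb, yb) s" "rho_slope s f z < ereal \<gamma>"
        unfolding INF_less_iff real by blast
      then obtain fz where fz: "f z = ereal fz" "fz > 0" "fz < s"
        by (cases "f z") (auto simp: outer_set_def)
      have "c * dist (snd z) yb \<le> fz" using c(3)[of z] fz s(2) by simp
      then have "c * dist (snd z) yb < c * (eta / 4)" using fz(3) s(4) by simp
      then have dy: "dist (snd z) yb < eta / 4" using c(1) by (simp only: mult_less_cancel_left_pos)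
      have dx: "dist (fst z) xb < s" using z(1) by (simp add: outer_set_def)
      have "dist z (xb, yb) \<le> dist (fst z) xb + dist (snd z) yb"
        unfolding dist_prod_def by (simp add: sqrt_sum_squares_le_sum)
      then have dz: "dist z (xb, yb) < eta / 2" using dx dy s(3) by linarith
      have lsc': "lsc_at (pos_part f) w" if "dist w z < eta / 2" for w
        using dist_triangle[of w "(xb, yb)" z] that dz by (intro eta(2)) linarith
      define eps where "eps = min (r / 4) e"
      have eps: "eps > 0" "eps \<le> r / 4" "eps \<le> e" using r e by (auto simp: eps_def)
      have eta2: "eta / 2 > 0" using eta(1) by simp
      obtain u fu xs ys where u: "f u = ereal fu" "fu > 0" "\<bar>fu - fz\<bar> < eps" "dist u z < eps"
        and sub: "(xs, ys) \<in> frechet_subdiff f u" "norm xs \<le> \<gamma> + eps" "norm ys \<le> \<gamma> * s + eps"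
        using subgradient_near[OF compl sep fz(1,2) z(2) s(1) gam eta2 lsc' eps(1)] by blast
      have "fu < r" using u(3) fz(3) s(5) eps(2) r by linarith
      moreover have "dist (fst u) xb < r"
      proof -
        have "dist (fst u) xb \<le> dist (fst u) (fst z) + dist (fst z) xb" by (rule dist_triangle)
        moreover have "dist (fst u) (fst z) \<le> dist u z" by (rule dist_fst_le)
        ultimately show ?thesis using u(4) dx s(5) eps(2) r by linarith
      qed
      ultimately have uS: "u \<in> outer_set f (xb, yb) r" using u(1,2) by (simp add: outer_set_def)
      have "\<gamma> * s \<le> r / 4" using s(6) gam by (simp add: field_simps)
      then have "norm ys < r" using sub(3) eps(2) r by linarith
      then have "subdiff_rho_slope r f u \<le> ereal (norm xs)"
        unfolding subdiff_rho_slope_def using sub(1) by (intro INF_lower2[of "(xs, ys)"]) auto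
      also have "\<dots> \<le> g + ereal e" using sub(2) eps(3) real by simp
      finally show "(INF z\<in>outer_set f (xb, yb) r. subdiff_rho_slope r f z) \<le> g + ereal e"
        using uS by (rule INF_lower2[rotated])
    qed
    then show ?thesis unfolding strict_outer_subdiff_slope_SUP by (intro SUP_least) auto
  qed (use g0 in auto)
qed

theorem theorem3p3:
  fixes f :: "'a::real_normed_vector \<times> 'b::real_normed_vector \<Rightarrow> ereal"
    and xb :: 'a and yb :: 'b
  assumes "\<And>z. f z \<noteq> -\<infinity>"
    and "f (xb, yb) = 0"
    and "P1 f yb"
    and "P2 f yb"
  shows "(\<forall>\<rho>>0. \<forall>z. f z < \<infinity> \<longrightarrow>
            rho_slope \<rho> f z \<le> subdiff_rho_slope (\<rho>\<^sup>2) f z + ereal \<rho>)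
       \<and> strict_outer_slope f (xb, yb) \<le> strict_outer_subdiff_slope f (xb, yb)
       \<and> (asplund TYPE('a) \<and> asplund TYPE('b) \<and> lsc_near (pos_part f) (xb, yb) \<longrightarrow>
            strict_outer_slope f (xb, yb) = strict_outer_subdiff_slope f (xb, yb))"
proof (intro conjI allI impI)
  fix \<rho> :: real and z assume "0 < \<rho>" "f z < \<infinity>"
  moreover from this obtain fz where "f z = ereal fz" using assms(1)[of z] by (cases "f z") auto
  ultimately show "rho_slope \<rho> f z \<le> subdiff_rho_slope (\<rho>\<^sup>2) f z + ereal \<rho>"
    by (intro rho_slope_le_subdiff)
next
  show "strict_outer_slope f (xb, yb) \<le> strict_outer_subdiff_slope f (xb, yb)"
    by (rule strict_outer_slope_le)
next
  assume "asplund TYPE('a) \<and> asplund TYPE('b) \<and> lsc_near (pos_part f) (xb, yb)"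
  then show "strict_outer_slope f (xb, yb) = strict_outer_subdiff_slope f (xb, yb)"
    using strict_outer_slope_le strict_outer_slope_ge[OF assms(4)] by (intro antisym) auto
qed

end
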